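(* Let $0\leq\sigma\leq 1$ and $T\geq 4$. Then $\int_{1}^{T}|\zeta(\sigma+it)|^{2}dt$ is bounded from above as follows: (1) if $\sigma=1$, by $\frac{\pi^{2}}{6}\cdot T+18.34\cdot\sqrt{T}$; (2) if $\frac{1}{2}<\sigma<1$, by $\zeta(2\sigma)\cdot T+\frac{2.12}{\left(\sigma-\frac{1}{2}\right)(1-\sigma)^{2}}\cdot\max\{T^{2-2\sigma}\log(T),\sqrt{T}\}$; (3) if $\sigma=\frac{1}{2}$, by $T\log(T)+2\cdot T\sqrt{\log(T)}+21.16\cdot T$; (4) if $0<\sigma<\frac{1}{2}$, by $\frac{\zeta(2-2\sigma)}{(2\pi)^{1-2\sigma}(2-2\sigma)}\cdot T^{2-2\sigma}+\frac{7.75}{\sigma^{2}\left(\frac{1}{2}-\sigma\right)}\cdot T$; (5) if $\sigma=0$, by $\frac{\pi}{24}\cdot T^{2}+9.3\cdot T\log(T)$.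
   Context: $\zeta$ is the Riemann zeta function and $\log$ the natural logarithm. *)

theory Defs
  imports "HOL-Complex_Analysis.Complex_Analysis"
begin

text \<open>
  The Riemann zeta function: the analytic continuation to the complex plane without \<open>1\<close> of the
  Dirichlet series. By the identity theorem all candidates agree on \<open>- {1}\<close>; the value at the
  pole \<open>1\<close> is unspecified.
\<close>

definition zeta :: "complex \<Rightarrow> complex" where
  "zeta = (SOME f. f holomorphic_on - {1} \<and>
     (\<forall>s. Re s > 1 \<longrightarrow> (\<lambda>n. 1 / of_nat (Suc n) powr s) sums f s))"

end

theory Submission imports Defs begin

text \<open>
  For \<open>Re s \<ge> 1/2\<close> the zeta function is a Dirichlet polynomial of length about \<open>T\<close> plus
  \<open>N\<^bsup>1 - s\<^esup> / (s - 1)\<close>, up to \<open>O(N\<^bsup>- Re s\<^esup>)\<close>. In the mean square of the polynomial with weight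
  \<open>t\<^bsup>a\<^esup>\<close> the diagonal gives the main term, and the other terms carry the kernel \<open>sin (u T) / u\<close> with
  \<open>u = ln (n / m)\<close>. Since \<open>1 / (2 sinh (u / 2)) = \<surd>(m n) / (n - m)\<close>, Hilbert's inequality bounds
  the part \<open>sin (u T) / (2 sinh (u / 2))\<close> without the loss of a logarithm, and the difference
  \<open>1 / u - 1 / (2 sinh (u / 2))\<close> is bounded and tends to \<open>0\<close>.

  For \<open>\<sigma> < 1/2\<close> the functional equation leads to the same mean square at \<open>1 - \<sigma>\<close> with weight
  \<open>(t / 2\<pi>)\<^bsup>1 - 2\<sigma>\<^esup>\<close>, up to a lower-order factor obtained from the digamma function. The functional
  equation itself follows on \<open>(0, 1)\<close> from two expansions of \<open>1 / x - 1 / (e\<^bsup>x\<^esup> - 1)\<close>, one in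
  exponentials and one in partial fractions, whose Mellin transforms are computed termwise; it then
  serves to continue the zeta function to the left half plane.
\<close>

section \<open>The zeta function in the right half plane\<close>

text \<open>Off the diagonal, the kernel bounds leave \<open>pi\<close> times the sum of
  \<open>n powr (1 - 2 * \<sigma>)\<close> and a quarter of the squared sum of
  \<open>n powr (- \<sigma>)\<close>, both of order \<open>T powr (2 - 2 * \<sigma>)\<close> up to
  logarithms. The shape of each case is decided by the cross term between the polynomial and
  \<open>N powr (1 - s) / (s - 1)\<close>, a term of size about
  \<open>T powr (1 - \<sigma>) / t\<close>. Bounding the polynomial pointwise there costs a factor
  \<open>ln T\<close>. For \<open>1/2 < \<sigma> < 1\<close> this is the logarithm of the claim, and
  at \<open>\<sigma> = 1\<close> the squared logarithms fit below \<open>sqrt T\<close>. At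
  \<open>\<sigma> = 1/2\<close> it would spoil the coefficient of \<open>T * ln T\<close>, so an
  AM-GM inequality with a weight close to \<open>sqrt (ln T)\<close> takes its place. For
  \<open>\<sigma> < 1/2\<close> the weight \<open>t powr a\<close> with
  \<open>a = 1 - 2 * \<sigma>\<close> turns the logarithm into \<open>1 / a\<close>, which puts
  \<open>1/2 - \<sigma>\<close> into the denominator. At \<open>\<sigma> = 0\<close> even
  \<open>T\<close> times the squared harmonic sum is too large, hence an average over the upper end
  point.\<close>

lemma powr_neg_diff_bound:
  fixes s :: complex and a x :: real
  assumes "0 < a" "a \<le> x" "0 \<le> Re s"
  shows "cmod (of_real x powr (-s) - of_real a powr (-s)) \<le> cmod s * a powr (- Re s - 1) * (x - a)"
proof -
  have "cmod (of_real x powr (-s) - of_real a powr (-s)) \<le> (cmod s * a powr (- Re s - 1)) * cmod (of_real x - of_real a)"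
  proof (rule field_differentiable_bound[of "of_real ` {a..}" "\<lambda>z. z powr (-s)" "\<lambda>z. -s * z powr (-s-1)"])
    show "convex (complex_of_real ` {a..})"
      by (intro convex_linear_image) (auto simp: bounded_linear.linear bounded_linear_of_real)
    fix z :: complex assume "z \<in> of_real ` {a..}"
    then obtain y where y: "z = of_real y" "y \<ge> a" by auto
    have "z \<notin> \<real>\<^sub>\<le>\<^sub>0" using y assms by (auto simp: complex_nonpos_Reals_iff)
    then show "((\<lambda>z. z powr - s) has_field_derivative - s * z powr (- s - 1)) (at z within complex_of_real ` {a..})"
      by (auto intro!: derivative_eq_intros)
    have "cmod (z powr (-s-1)) = y powr (- Re s - 1)"
      using y assms by (subst norm_powr_real_powr) auto
    also have "... \<le> a powr (- Re s - 1)"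
      using y assms by (intro powr_mono2') auto
    finally show "norm (- s * z powr (- s - 1)) \<le> cmod s * a powr (- Re s - 1)"
      by (simp add: norm_mult mult_left_mono)
  qed (use assms in auto)
  then show ?thesis using assms by (simp flip: of_real_diff)
qed

text \<open>\<open>zterm n s\<close> is \<open>s - 1\<close> times \<open>n\<^bsup>- s\<^esup>\<close> minus the integral of \<open>x\<^bsup>- s\<^esup>\<close> over
  \<open>[n, n + 1]\<close>, and \<open>zreg s\<close> is \<open>(s - 1) \<zeta>(s)\<close> for \<open>Re s > 0\<close>.\<close>

definition zterm :: "nat \<Rightarrow> complex \<Rightarrow> complex" where
  "zterm n s = (s - 1) * of_nat n powr (-s) - of_nat n powr (1 - s) + of_nat (Suc n) powr (1 - s)"

definition zreg :: "complex \<Rightarrow> complex" where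
  "zreg s = 1 + (\<Sum>n. zterm (Suc n) s)"

lemma holomorphic_zterm: "zterm (Suc n) holomorphic_on A"
  unfolding zterm_def by (intro holomorphic_intros) (auto simp del: of_nat_Suc)

text \<open>The term is the increment of \<open>f\<close> over \<open>[n, n + 1]\<close>, and the
  derivative of \<open>f\<close> contains the small difference of
  \<open>powr_neg_diff_bound\<close>. The power of \<open>n\<close> gained makes the series converge
  for \<open>Re s > 0\<close>.\<close>

lemma norm_zterm_le:
  assumes "0 \<le> Re s" "n > 0"
  shows "cmod (zterm n s) \<le> cmod (s - 1) * cmod s * real n powr (- Re s - 1)"
proof -
  define f where "f = (\<lambda>z. (s - 1) * of_nat n powr (-s) * z + z powr (1 - s))"
  define S where "S = closed_segment (of_nat n) (of_nat (Suc n) :: complex)"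
  have S: "\<exists>y. z = of_real y \<and> real n \<le> y \<and> y \<le> real n + 1" if "z \<in> S" for z
  proof -
    have "S = of_real ` closed_segment (real n) (real (Suc n))"
      unfolding S_def using closed_segment_of_real[of "real n" "real (Suc n)"] by simp
    then show ?thesis using that by (auto simp: closed_segment_eq_real_ivl)
  qed
  have "cmod (f (of_nat (Suc n)) - f (of_nat n)) \<le> (cmod (s - 1) * cmod s * real n powr (- Re s - 1)) * cmod (of_nat (Suc n) - of_nat n :: complex)"
  proof (rule field_differentiable_bound[of S f "\<lambda>z. (s - 1) * (of_nat n powr (-s) - z powr (-s))"])
    show "convex S" by (simp add: S_def)
    fix z assume "z \<in> S"
    then obtain y where y: "z = of_real y" "real n \<le> y" "y \<le> real n + 1" using S by blast
    have "z \<notin> \<real>\<^sub>\<le>\<^sub>0" using y assms by (auto simp: complex_nonpos_Reals_iff)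
    then show "(f has_field_derivative (s - 1) * (of_nat n powr (-s) - z powr (-s))) (at z within S)"
      unfolding f_def by (auto intro!: derivative_eq_intros simp: algebra_simps)
    have "cmod (of_real y powr (-s) - of_real (real n) powr (-s)) \<le> cmod s * real n powr (- Re s - 1) * (y - real n)"
      using assms y by (intro powr_neg_diff_bound) auto
    also have "... \<le> cmod s * real n powr (- Re s - 1) * 1"
      using y by (intro mult_left_mono) auto
    finally show "norm ((s - 1) * (of_nat n powr (-s) - z powr (-s))) \<le> cmod (s - 1) * cmod s * real n powr (- Re s - 1)"
      using y by (simp add: norm_mult norm_minus_commute mult.assoc mult_left_mono)
  qed (auto simp: S_def)
  moreover have "f (of_nat (Suc n)) - f (of_nat n) = zterm n s"
    by (simp add: f_def zterm_def algebra_simps)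
  ultimately show ?thesis by simp
qed

lemma summable_Suc_powr: "p < -1 \<Longrightarrow> summable (\<lambda>n. real (Suc n) powr p)"
  using summable_real_powr_iff[of p] by (subst summable_Suc_iff) auto

lemma summable_zterm:
  assumes "0 < Re s"
  shows "summable (\<lambda>n. zterm (Suc n) s)"
proof (rule summable_comparison_test)
  show "\<exists>N. \<forall>n\<ge>N. norm (zterm (Suc n) s) \<le> cmod (s - 1) * cmod s * real (Suc n) powr (- Re s - 1)"
    using norm_zterm_le[of s "Suc n" for n] assms by auto
  show "summable (\<lambda>n. cmod (s - 1) * cmod s * real (Suc n) powr (- Re s - 1))"
    using assms by (intro summable_mult summable_Suc_powr) auto
qed

lemma holomorphic_zreg: "zreg holomorphic_on {s. Re s > 0}"
proof (rule holomorphic_uniform_sequence[where f = "\<lambda>m s. 1 + (\<Sum>n<m. zterm (Suc n) s)"])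
  show "open {s. Re s > 0}" by (rule open_halfspace_Re_gt)
  show "(\<lambda>s. 1 + (\<Sum>n<m. zterm (Suc n) s)) holomorphic_on {s. 0 < Re s}" for m
    by (intro holomorphic_intros holomorphic_zterm)
  fix x :: complex assume x: "x \<in> {s. 0 < Re s}"
  define d where "d = Re x / 2"
  have sub: "Re z \<ge> d \<and> cmod z \<le> cmod x + d \<and> cmod (z - 1) \<le> cmod x + d + 1" if "z \<in> cball x d" for z
  proof -
    have "cmod (x - z) \<le> d" using that by (simp add: dist_norm)
    then have "\<bar>Re (x - z)\<bar> \<le> d" using abs_Re_le_cmod order_trans by blast
    then have "Re z \<ge> d" using abs_ge_self[of "Re (x - z)"] unfolding d_def by simp
    moreover have "cmod z \<le> cmod x + cmod (x - z)"
      using norm_triangle_sub[of z x] by (simp add: norm_minus_commute)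
    moreover have "cmod (z - 1) \<le> cmod z + 1" using norm_triangle_ineq4[of z 1] by simp
    ultimately show ?thesis using \<open>cmod (x - z) \<le> d\<close> by auto
  qed
  have dpos: "d > 0" using x by (simp add: d_def)
  have "uniform_limit (cball x d) (\<lambda>m s. \<Sum>n<m. zterm (Suc n) s) (\<lambda>s. \<Sum>n. zterm (Suc n) s) sequentially"
  proof (rule Weierstrass_m_test)
    fix n z assume "z \<in> cball x d"
    note * = sub[OF this]
    have "cmod (zterm (Suc n) z) \<le> cmod (z - 1) * cmod z * real (Suc n) powr (- Re z - 1)"
      using * dpos by (intro norm_zterm_le) auto
    also have "... \<le> (cmod x + d + 1) * (cmod x + d) * real (Suc n) powr (- d - 1)"
      using * dpos by (intro mult_mono powr_mono) auto
    finally show "cmod (zterm (Suc n) z) \<le> (cmod x + d + 1) * (cmod x + d) * real (Suc n) powr (- d - 1)" .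
  next
    show "summable (\<lambda>n. (cmod x + d + 1) * (cmod x + d) * real (Suc n) powr (- d - 1))"
      using dpos by (intro summable_mult summable_Suc_powr) auto
  qed
  then have "uniform_limit (cball x d) (\<lambda>m s. 1 + (\<Sum>n<m. zterm (Suc n) s)) zreg sequentially"
    unfolding zreg_def by (intro uniform_limit_intros)
  moreover have "cball x d \<subseteq> {s. 0 < Re s}" using sub dpos by fastforce
  ultimately show "\<exists>d>0. cball x d \<subseteq> {s. 0 < Re s} \<and>
     uniform_limit (cball x d) (\<lambda>m s. 1 + (\<Sum>n<m. zterm (Suc n) s)) zreg sequentially"
    using dpos by blast
qed

text \<open>The powers \<open>n powr (1 - s)\<close> telescope; the leading 1 in \<open>zreg\<close>
  cancels the one at \<open>n = 1\<close>.\<close>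

lemma zterm_partial_sum:
  "1 + (\<Sum>n<M. zterm (Suc n) s) = (s - 1) * (\<Sum>n=1..M. of_nat n powr (-s)) + of_nat (Suc M) powr (1 - s)"
proof (induction M)
  case (Suc M)
  show ?case using Suc.IH by (simp add: zterm_def algebra_simps)
qed simp

lemma zreg_LIMSEQ:
  assumes "0 < Re s"
  shows "(\<lambda>M. (s - 1) * (\<Sum>n=1..M. of_nat n powr (-s)) + of_nat (Suc M) powr (1 - s)) \<longlonglongrightarrow> zreg s"
  unfolding zreg_def zterm_partial_sum[symmetric]
  by (intro tendsto_intros summable_LIMSEQ summable_zterm assms)

text \<open>At 1 the quotient is 0 by convention, so the statements about it stay away from that
  point.\<close>

definition zhalf :: "complex \<Rightarrow> complex" where
  "zhalf s = zreg s / (s - 1)"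

lemma holomorphic_zhalf: "zhalf holomorphic_on {s. Re s > 0} - {1}"
  unfolding zhalf_def
  by (intro holomorphic_intros holomorphic_on_subset[OF holomorphic_zreg]) auto

lemma zhalf_LIMSEQ:
  assumes "0 < Re s" "s \<noteq> 1"
  shows "(\<lambda>M. (\<Sum>n=1..M. of_nat n powr (-s)) + of_nat (Suc M) powr (1 - s) / (s - 1)) \<longlonglongrightarrow> zhalf s"
  using tendsto_divide[OF zreg_LIMSEQ[OF assms(1)] tendsto_const[of "s - 1"]] assms
  by (simp add: zhalf_def add_divide_distrib)

lemma tendsto_nat_powr_zero:
  assumes "Re s < 0"
  shows "(\<lambda>n. of_nat (Suc n) powr s :: complex) \<longlonglongrightarrow> 0"
proof (rule tendsto_norm_zero_cancel)
  have "(\<lambda>n. real (Suc n) powr Re s) \<longlonglongrightarrow> 0"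
    using assms by (intro tendsto_neg_powr filterlim_compose[OF filterlim_real_sequentially filterlim_Suc])
  moreover have "cmod (of_nat (Suc n) powr s) = real (Suc n) powr Re s" for n
    by (subst norm_powr_real_powr) auto
  ultimately show "(\<lambda>n. cmod (of_nat (Suc n) powr s)) \<longlonglongrightarrow> 0" by simp
qed

lemma zhalf_sums:
  assumes "1 < Re s"
  shows "(\<lambda>n. 1 / of_nat (Suc n) powr s) sums zhalf s"
proof -
  have s: "s \<noteq> 1" "0 < Re s" using assms by auto
  have "(\<lambda>M. of_nat (Suc M) powr (1 - s) / (s - 1)) \<longlonglongrightarrow> 0 / (s - 1)"
    using s assms by (intro tendsto_intros tendsto_nat_powr_zero) auto
  from tendsto_diff[OF zhalf_LIMSEQ[OF s(2,1)] this]
  have "(\<lambda>M. \<Sum>n=1..M. of_nat n powr (-s)) \<longlonglongrightarrow> zhalf s" by simp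
  moreover have "(\<Sum>n=1..M. of_nat n powr (-s)) = (\<Sum>n<M. 1 / of_nat (Suc n) powr s)" for M
    by (simp add: powr_minus divide_inverse sum.atLeast1_atMost_eq del: of_nat_Suc)
  ultimately show ?thesis by (simp add: sums_def)
qed

section \<open>The functional equation\<close>

text \<open>The substitution \<open>t = v * x powr r\<close> in Euler's integral;
  \<open>r = 2\<close> serves Gaussians and \<open>r = 1\<close> exponentials. Nonnegative integrals
  let Tonelli be applied later without integrability proofs.\<close>

lemma nn_integral_powr_exp:
  fixes a v r :: real
  assumes "a > 0" "v > 0" "r > 0"
  shows "(\<integral>\<^sup>+x. ennreal (r * x powr (r * a - 1) * exp (- v * x powr r)) * indicator {0<..} x \<partial>lborel)
     = ennreal (Gamma a * v powr (- a))"
proof -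
  define f where "f = (\<lambda>t::real. t powr (a - 1) / exp t)"
  define g where "g = (\<lambda>x::real. v * x powr r)"
  have "(f has_integral Gamma a) {0..}" using Gamma_integral_real[OF assms(1)] by (simp add: f_def)
  then have "((\<lambda>t. if t \<in> {0<..} then f t else 0) has_integral Gamma a) {0..}"
    by (rule has_integral_spike[of "{0}", rotated 2]) auto
  then have fint: "(f has_integral Gamma a) {0<..}"
    by (subst (asm) has_integral_restrict) auto
  have img: "g ` {0<..} = {0<..}"
  proof (intro equalityI subsetI)
    fix y :: real assume "y \<in> {0<..}"
    then have "y = g ((y / v) powr (1 / r))" "(y / v) powr (1 / r) \<in> {0<..}"
      using assms by (auto simp: g_def powr_powr)
    then show "y \<in> g ` {0<..}" by blast
  qed (use assms in \<open>auto simp: g_def\<close>)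
  have "inj_on g {0<..}"
  proof (rule inj_onI)
    fix x y assume *: "x \<in> {0<..}" "y \<in> {0<..}" "g x = g y"
    then have "(x powr r) powr (1/r) = (y powr r) powr (1/r)" using assms by (simp add: g_def)
    then show "x = y" using * assms by (simp add: powr_powr)
  qed
  moreover have "f absolutely_integrable_on {0<..}"
    using fint by (intro nonnegative_absolutely_integrable_1) (auto simp: f_def has_integral_integrable_integral)
  ultimately have "(\<lambda>x. \<bar>v * (r * x powr (r - 1))\<bar> * f (g x)) absolutely_integrable_on {0<..} \<and>
      integral {0<..} (\<lambda>x. \<bar>v * (r * x powr (r - 1))\<bar> * f (g x)) = Gamma a"
    using fint img
    by (subst has_absolute_integral_change_of_variables_1')
       (auto simp: g_def has_integral_integrable_integral intro!: derivative_eq_intros)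
  then have "((\<lambda>x. \<bar>v * (r * x powr (r - 1))\<bar> * f (g x)) has_integral Gamma a) {0<..}"
    using set_lebesgue_integral_eq_integral(1) by (auto simp: has_integral_iff)
  from has_integral_mult_right[OF this, of "v powr (-a)"]
  have "((\<lambda>x. r * x powr (r * a - 1) * exp (- v * x powr r)) has_integral v powr (-a) * Gamma a) {0<..}"
  proof (rule has_integral_eq[rotated])
    fix x :: real assume x: "x \<in> {0<..}"
    have "x powr (r - 1) * x powr (r * (a - 1)) = x powr (r * a - 1)"
      by (simp flip: powr_add) (simp add: algebra_simps)
    moreover have "v powr (-a) * (v * v powr (a - 1)) = 1"
      using assms by (simp add: powr_diff powr_minus field_simps)
    moreover have "v powr (-a) * (\<bar>v * (r * x powr (r - 1))\<bar> * f (g x)) =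
       (v powr (-a) * (v * v powr (a - 1))) * r * (x powr (r - 1) * x powr (r * (a - 1))) * exp (- v * x powr r)"
      using assms x by (simp add: f_def g_def powr_mult powr_powr exp_minus divide_inverse)
    ultimately show "v powr (-a) * (\<bar>v * (r * x powr (r - 1))\<bar> * f (g x)) = r * x powr (r * a - 1) * exp (- v * x powr r)"
      by simp
  qed
  from nn_integral_has_integral_lebesgue'[OF _ this] assms show ?thesis
    by (simp add: mult.commute)
qed

lemma nn_integral_powr_exp':
  fixes a v :: real
  assumes "a > 0" "v > 0"
  shows "(\<integral>\<^sup>+x. ennreal (x powr (a - 1) * exp (- v * x)) * indicator {0<..} x \<partial>lborel)
     = ennreal (Gamma a * v powr (- a))"
proof -
  have "(\<integral>\<^sup>+x. ennreal (x powr (a - 1) * exp (- v * x)) * indicator {0<..} x \<partial>lborel)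
     = (\<integral>\<^sup>+x. ennreal (1 * x powr (1 * a - 1) * exp (- v * x powr 1)) * indicator {0<..} x \<partial>lborel)"
    by (rule nn_integral_cong) (auto simp: indicator_def)
  then show ?thesis using nn_integral_powr_exp[OF assms zero_less_one] by metis
qed

text \<open>Writes \<open>1 / (x\<^sup>2 + b\<^sup>2)\<close> as the integral of
  \<open>exp (- v * (x\<^sup>2 + b\<^sup>2))\<close> over \<open>v > 0\<close> and exchanges the
  integrals. The inner one is Gaussian and gives \<open>Gamma ((s+1)/2)\<close>, the outer one gives
  \<open>Gamma ((1 - s)/2)\<close>; the arguments add up to 1, so the reflection formula yields the
  cosine.\<close>

lemma nn_integral_powr_div_sum_squares:
  fixes s b :: real
  assumes "0 < s" "s < 1" "b > 0"
  shows "(\<integral>\<^sup>+x. ennreal (x powr (s - 1) * (2 * x / (x\<^sup>2 + b\<^sup>2))) * indicator {0<..} x \<partial>lborel)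
     = ennreal (pi / cos (pi * s / 2) * b powr (s - 1))"
proof -
  have "(\<integral>\<^sup>+x. ennreal (x powr (s - 1) * (2 * x / (x\<^sup>2 + b\<^sup>2))) * indicator {0<..} x \<partial>lborel)
    = (\<integral>\<^sup>+x. (\<integral>\<^sup>+v. ennreal (2 * x powr s * exp (- v * (x\<^sup>2 + b\<^sup>2))) * (indicator {0<..} v * indicator {0<..} x) \<partial>lborel) \<partial>lborel)"
  proof (intro nn_integral_cong)
    fix x :: real
    show "ennreal (x powr (s - 1) * (2 * x / (x\<^sup>2 + b\<^sup>2))) * indicator {0<..} x = (\<integral>\<^sup>+v. ennreal (2 * x powr s * exp (- v * (x\<^sup>2 + b\<^sup>2))) * (indicator {0<..} v * indicator {0<..} x) \<partial>lborel)"
    proof (cases "x > 0")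
      case True
      have pos: "x\<^sup>2 + b\<^sup>2 > 0" using True by (simp add: add_pos_nonneg)
      have "(\<integral>\<^sup>+v. ennreal (2 * x powr s * exp (- v * (x\<^sup>2 + b\<^sup>2))) * (indicator {0<..} v * indicator {0<..} x) \<partial>lborel)
        = (\<integral>\<^sup>+v. ennreal (2 * x powr s) * (ennreal (v powr (1 - 1) * exp (- (x\<^sup>2 + b\<^sup>2) * v)) * indicator {0<..} v) \<partial>lborel)"
        using True by (intro nn_integral_cong) (auto simp: indicator_def ennreal_mult' algebra_simps)
      also have "... = ennreal (2 * x powr s) * ennreal (Gamma 1 * (x\<^sup>2 + b\<^sup>2) powr (-1))"
        by (subst nn_integral_cmult, measurable) (subst nn_integral_powr_exp', use pos in auto)
      also have "... = ennreal (x powr (s - 1) * (2 * x / (x\<^sup>2 + b\<^sup>2)))"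
        using True pos by (simp add: powr_minus powr_diff field_simps flip: ennreal_mult)
      finally show ?thesis using True by simp
    qed simp
  qed
  also have "... = (\<integral>\<^sup>+v. (\<integral>\<^sup>+x. ennreal (2 * x powr s * exp (- v * (x\<^sup>2 + b\<^sup>2))) * (indicator {0<..} v * indicator {0<..} x) \<partial>lborel) \<partial>lborel)"
    by (rule lborel_pair.Fubini'[symmetric]) (measurable)
  also have "... = (\<integral>\<^sup>+v. ennreal (Gamma ((s+1)/2)) * (ennreal (v powr ((1 - s) / 2 - 1) * exp (- b\<^sup>2 * v)) * indicator {0<..} v) \<partial>lborel)"
  proof (intro nn_integral_cong)
    fix v :: real
    show "(\<integral>\<^sup>+x. ennreal (2 * x powr s * exp (- v * (x\<^sup>2 + b\<^sup>2))) * (indicator {0<..} v * indicator {0<..} x) \<partial>lborel)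
      = ennreal (Gamma ((s+1)/2)) * (ennreal (v powr ((1 - s) / 2 - 1) * exp (- b\<^sup>2 * v)) * indicator {0<..} v)"
    proof (cases "v > 0")
      case True
      have "(\<integral>\<^sup>+x. ennreal (2 * x powr s * exp (- v * (x\<^sup>2 + b\<^sup>2))) * (indicator {0<..} v * indicator {0<..} x) \<partial>lborel)
        = (\<integral>\<^sup>+x. ennreal (exp (- b\<^sup>2 * v)) * (ennreal (2 * x powr (2 * ((s+1)/2) - 1) * exp (- v * x powr 2)) * indicator {0<..} x) \<partial>lborel)"
      proof (intro nn_integral_cong)
        fix x :: real
        have "2 * x powr s * exp (- v * (x\<^sup>2 + b\<^sup>2)) = exp (- b\<^sup>2 * v) * (2 * x powr (2 * ((s+1)/2) - 1) * exp (- v * x powr 2))" if "x > 0"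
          using that by (simp add: distrib_left exp_add exp_diff exp_minus field_simps)
        then show "ennreal (2 * x powr s * exp (- v * (x\<^sup>2 + b\<^sup>2))) * (indicator {0<..} v * indicator {0<..} x)
          = ennreal (exp (- b\<^sup>2 * v)) * (ennreal (2 * x powr (2 * ((s+1)/2) - 1) * exp (- v * x powr 2)) * indicator {0<..} x)"
          using True by (cases "x > 0") (simp_all flip: ennreal_mult)
      qed
      also have "... = ennreal (exp (- b\<^sup>2 * v)) * ennreal (Gamma ((s+1)/2) * v powr (- ((s+1)/2)))"
        by (subst nn_integral_cmult, measurable) (subst nn_integral_powr_exp, use True assms in auto)
      also have "- ((s+1)/2) = (1 - s) / 2 - 1" by (simp add: field_simps)
      finally show ?thesis using True assms
        by (simp add: Gamma_real_nonneg mult_ac flip: ennreal_mult)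
    qed simp
  qed
  also have "... = ennreal (Gamma ((s+1)/2)) * ennreal (Gamma ((1 - s)/2) * (b\<^sup>2) powr (- ((1 - s)/2)))"
    by (subst nn_integral_cmult, measurable) (subst nn_integral_powr_exp', use assms in auto)
  also have "... = ennreal (Gamma ((s+1)/2) * Gamma ((1 - s)/2) * b powr (s - 1))"
  proof -
    have "(b\<^sup>2) powr (- ((1 - s)/2)) = b powr (2 * - ((1 - s)/2))"
      unfolding powr_powr[symmetric] using assms by simp
    also have "2 * - ((1 - s)/2) = s - 1" by (simp add: field_simps)
    finally have "(b\<^sup>2) powr (- ((1 - s)/2)) = b powr (s - 1)" .
    moreover have "0 \<le> Gamma ((s+1)/2)" "0 \<le> Gamma ((1 - s)/2)"
      using assms by (intro Gamma_real_nonneg; simp)+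
    ultimately show ?thesis by (simp only: mult.assoc) (rule ennreal_mult[symmetric], auto)
  qed
  also have "Gamma ((s+1)/2) * Gamma ((1 - s)/2) = pi / cos (pi * s / 2)"
  proof -
    have "complex_of_real (Gamma a * Gamma (1 - a)) = of_real (pi / sin (pi * a))" for a
    proof -
      have "complex_of_real (Gamma a * Gamma (1 - a)) = Gamma (of_real a) * Gamma (1 - of_real a)"
        using Gamma_complex_of_real[of a] Gamma_complex_of_real[of "1 - a"] by simp
      also have "... = of_real pi / sin (of_real pi * of_real a)" by (rule Gamma_reflection_complex)
      also have "... = of_real (pi / sin (pi * a))"
        using sin_of_real[of "pi * a", where 'a = complex] by simp
      finally show ?thesis .
    qed
    then have "Gamma ((s+1)/2) * Gamma (1 - (s+1)/2) = pi / sin (pi * ((s+1)/2))"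
      by (simp only: of_real_eq_iff)
    moreover have "sin (pi * ((s+1)/2)) = cos (pi * s / 2)"
      by (simp add: sin_add algebra_simps add_divide_distrib)
    moreover have "1 - (s+1)/2 = (1 - s)/2" by (simp add: field_simps)
    ultimately show ?thesis by simp
  qed
  finally show ?thesis .
qed

lemma real_powr_integral:
  fixes p a b :: real
  assumes "0 \<le> a" "a \<le> b" "p < 1"
  shows "((\<lambda>u. u powr (-p)) has_integral (b powr (1 - p) - a powr (1 - p)) / (1 - p)) {a..b}"
proof -
  have "((\<lambda>u. u powr (-p)) has_integral b powr (1 - p) / (1 - p) - a powr (1 - p) / (1 - p)) {a..b}"
  \<comment> \<open>For \<open>a = 0\<close> the primitive is continuous at the end point but need
    not be differentiable there.\<close>
  proof (rule fundamental_theorem_of_calculus_interior)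
    show "continuous_on {a..b} (\<lambda>x. x powr (1 - p) / (1 - p))"
      using assms by (intro continuous_intros continuous_on_powr') auto
    fix x assume "x \<in> {a<..<b}"
    then show "((\<lambda>x. x powr (1 - p) / (1 - p)) has_vector_derivative x powr - p) (at x)"
      using assms by (auto simp flip: has_real_derivative_iff_has_vector_derivative intro!: derivative_eq_intros)
  qed fact
  then show ?thesis by (simp add: diff_divide_distrib)
qed

text \<open>Each summand is the integral of \<open>u powr (-p)\<close> over
  \<open>[n, n + 1]\<close> minus its value at the right end. The integrals telescope to the
  negative of the boundary term in \<open>zhalf_LIMSEQ\<close>.\<close>

lemma zhalf_of_real_sums:
  fixes p :: real
  assumes "0 < p" "p < 1"
  shows "(\<lambda>n. (real (Suc n) powr (1 - p) - real n powr (1 - p)) / (1 - p) - real (Suc n) powr (-p)) sums (- Re (zhalf (of_real p)))"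
proof -
  define a where "a = (\<lambda>n. (real (Suc n) powr (1 - p) - real n powr (1 - p)) / (1 - p) - real (Suc n) powr (-p))"
  \<comment> \<open>The boundary power belongs to \<open>Suc M\<close> while the sum in
    \<open>zhalf_LIMSEQ\<close> stops at \<open>M\<close>; the one term left over tends to
    0.\<close>
  have part: "(\<Sum>n<Suc M. a n) = - Re ((\<Sum>n=1..M. of_nat n powr (- of_real p)) + of_nat (Suc M) powr (1 - of_real p) / (of_real p - 1)) - real (Suc M) powr (-p)" for M
  proof -
    have 1: "Re (of_nat (Suc n) powr (- of_real p)) = real (Suc n) powr (-p)" for n
    proof -
      have "of_nat (Suc n) powr (- of_real p) = (of_real (real (Suc n) powr (-p)) :: complex)"
        by (subst powr_of_real[symmetric]) (auto simp del: of_nat_Suc)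
      then show ?thesis by simp
    qed
    have 2: "Re (of_nat (Suc M) powr (1 - of_real p) / (of_real p - 1)) = real (Suc M) powr (1 - p) / (p - 1)"
    proof -
      have "of_nat (Suc M) powr (1 - of_real p) = (of_real (real (Suc M) powr (1 - p)) :: complex)"
        by (subst powr_of_real[symmetric]) (auto simp del: of_nat_Suc)
      then have "of_nat (Suc M) powr (1 - of_real p) / (of_real p - 1) = (of_real (real (Suc M) powr (1 - p) / (p - 1)) :: complex)"
        by (simp del: of_nat_Suc)
      then show ?thesis by (simp only: Re_complex_of_real)
    qed
    have psum: "(\<Sum>n<M'. a n) = real M' powr (1 - p) / (1 - p) - (\<Sum>n<M'. real (Suc n) powr (-p))" for M'
      using assms by (induction M') (auto simp: a_def diff_divide_distrib)
    show ?thesis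
    proof -
      have "Re (\<Sum>n=1..M. of_nat n powr (- complex_of_real p)) = (\<Sum>n<M. real (Suc n) powr (-p))"
        by (simp only: Re_sum sum.atLeast1_atMost_eq 1 One_nat_def)
      moreover have "real (Suc M) powr (1 - p) / (p - 1) = - (real (Suc M) powr (1 - p) / (1 - p))"
        using minus_divide_right[of "real (Suc M) powr (1 - p)" "1 - p"] by simp
      ultimately show ?thesis using psum[of "Suc M"] 2
        by (simp only: plus_complex.sel sum.lessThan_Suc)
    qed
  qed
  have "(\<lambda>M. - Re ((\<Sum>n=1..M. of_nat n powr (- of_real p)) + of_nat (Suc M) powr (1 - of_real p) / (of_real p - 1)) - real (Suc M) powr (-p))
     \<longlonglongrightarrow> - Re (zhalf (of_real p)) - 0"
    using assms
    by (intro tendsto_intros zhalf_LIMSEQ tendsto_neg_powr filterlim_compose[OF filterlim_real_sequentially filterlim_Suc]) auto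
  then have "(\<lambda>M. \<Sum>n<Suc M. a n) \<longlonglongrightarrow> - Re (zhalf (of_real p))"
    by (simp only: part) simp
  then have "a sums (- Re (zhalf (of_real p)))"
    unfolding sums_def by (rule LIMSEQ_imp_Suc)
  then show ?thesis by (simp add: a_def)
qed

lemma powr_difference_ge:
  fixes p :: real
  assumes p: "0 < p" "p < 1"
  shows "real (Suc n) powr (-p) \<le> (real (Suc n) powr (1 - p) - real n powr (1 - p)) / (1 - p)"
proof -
  \<comment> \<open>The open interval matters for \<open>n = 0\<close>: \<open>0 powr (-p)\<close>
    is 0, so the comparison fails at the end point.\<close>
  have "((\<lambda>u. real (Suc n) powr (-p)) has_integral real (Suc n) powr (-p)) {real n<..<real (Suc n)}"
    using has_integral_const_real[of "real (Suc n) powr (-p)" "real n" "real (Suc n)"] by (simp add: has_integral_Icc_iff_Ioo)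
  moreover have "((\<lambda>u. u powr (-p)) has_integral (real (Suc n) powr (1 - p) - real n powr (1 - p)) / (1 - p)) {real n<..<real (Suc n)}"
    using real_powr_integral[of "real n" "real (Suc n)" p] p by (simp add: has_integral_Icc_iff_Ioo)
  ultimately show ?thesis
    by (rule has_integral_le) (use p in \<open>auto intro!: powr_mono2'\<close>)
qed

text \<open>The sign is needed to return from \<open>ennreal\<close>, where negative values are
  truncated, to real numbers.\<close>

lemma zhalf_of_real_nonpos:
  fixes p :: real
  assumes p: "0 < p" "p < 1"
  shows "Re (zhalf (of_real p)) \<le> 0"
  using sums_le[OF _ sums_zero zhalf_of_real_sums[OF p]] powr_difference_ge[OF p] by auto

text \<open>Both representations of \<open>1/x - 1/(e^x - 1)\<close> as the difference of an integral and a sum of a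
  decreasing kernel \<open>k\<close> have this shape; the sum of the differences is monotone, so that only
  Tonelli's theorem is needed.\<close>

lemma nn_integral_kernel:
  fixes k K :: "real \<Rightarrow> real \<Rightarrow> real" and H :: "real \<Rightarrow> real" and s C p :: real
  assumes meas: "case_prod k \<in> borel_measurable (lborel \<Otimes>\<^sub>M lborel)"
    and p: "0 < p" "p < 1" and C: "0 \<le> C"
    and nonneg: "\<And>u x. 0 < u \<Longrightarrow> 0 < x \<Longrightarrow> 0 \<le> k u x"
    and antimono: "\<And>u v x. 0 < u \<Longrightarrow> u \<le> v \<Longrightarrow> 0 < x \<Longrightarrow> k v x \<le> k u x"
    and int: "\<And>u. 0 < u \<Longrightarrow> (\<integral>\<^sup>+x. ennreal (x powr (s - 1) * k u x) * indicator {0<..} x \<partial>lborel) = ennreal (C * u powr (-p))"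
    and K: "\<And>n x. 0 < x \<Longrightarrow> ((\<lambda>u. k u x) has_integral (K x (real (Suc n)) - K x (real n))) {real n..real (Suc n)}"
    and sums: "\<And>x. 0 < x \<Longrightarrow> (\<lambda>n. K x (real (Suc n)) - K x (real n) - k (real (Suc n)) x) sums H x"
  shows "(\<integral>\<^sup>+x. ennreal (x powr (s - 1) * H x) * indicator {0<..} x \<partial>lborel) = ennreal (C * - Re (zhalf (of_real p)))"
proof -
  define D where "D = (\<lambda>n x. K x (real (Suc n)) - K x (real n) - k (real (Suc n)) x)"
  define d where "d = (\<lambda>n. (real (Suc n) powr (1 - p) - real n powr (1 - p)) / (1 - p) - real (Suc n) powr (-p))"
  \<comment> \<open>Open on the left, because the first interval starts at 0 and the hypotheses on
    \<open>k\<close> speak of \<open>u > 0\<close> only.\<close>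
  define I where "I = (\<lambda>n. {real n<..<real (Suc n)})"
  have meas'[measurable]: "case_prod k \<in> borel_measurable (borel \<Otimes>\<^sub>M borel)"
    using meas by (simp add: measurable_cong_sets[OF sets_pair_measure_cong[OF sets_lborel sets_lborel] refl])
  have [measurable]: "(\<lambda>x. k u x) \<in> borel_measurable borel" for u
    using measurable_compose[OF measurable_Pair1'[of u borel borel] meas'] by simp
  have [measurable]: "(\<lambda>z. k (snd z) (fst z)) \<in> borel_measurable (borel \<Otimes>\<^sub>M borel)"
    using measurable_compose[OF measurable_pair_swap' meas'] by (simp add: case_prod_beta)
  have lb: "borel_measurable (lborel \<Otimes>\<^sub>M lborel) = (borel_measurable (borel \<Otimes>\<^sub>M borel) :: (real \<times> real \<Rightarrow> ennreal) set)"
    by (intro measurable_cong_sets sets_pair_measure_cong) auto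
  have Dint: "(\<integral>\<^sup>+u. ennreal (k u x - k (real (Suc n)) x) * indicator (I n) u \<partial>lborel) = ennreal (D n x)" if "x > 0" for n x
  proof -
    have "((\<lambda>u. k u x - k (real (Suc n)) x) has_integral D n x) {real n..real (Suc n)}"
      using has_integral_diff[OF K[OF that, of n] has_integral_const_real[of "k (real (Suc n)) x" "real n" "real (Suc n)"]]
      by (simp add: D_def)
    then have "((\<lambda>u. k u x - k (real (Suc n)) x) has_integral D n x) (I n)"
      by (simp add: has_integral_Icc_iff_Ioo I_def)
    then show ?thesis
      by (intro nn_integral_has_integral_lebesgue') (use that in \<open>auto simp: I_def intro!: antimono\<close>)
  qed
  have dint: "(\<integral>\<^sup>+u. ennreal (C * u powr (-p) - C * real (Suc n) powr (-p)) * indicator (I n) u \<partial>lborel) = ennreal (C * d n)" for n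
  proof -
    have "((\<lambda>u. u powr (-p)) has_integral (real (Suc n) powr (1 - p) - real n powr (1 - p)) / (1 - p)) {real n..real (Suc n)}"
      by (rule real_powr_integral) (use p in auto)
    from has_integral_mult_right[OF has_integral_diff[OF this has_integral_const_real[of "real (Suc n) powr (-p)" "real n" "real (Suc n)"]], of C]
    have "((\<lambda>u. C * u powr (-p) - C * real (Suc n) powr (-p)) has_integral C * d n) (I n)"
      by (simp add: has_integral_Icc_iff_Ioo I_def d_def algebra_simps)
    then show ?thesis
      by (intro nn_integral_has_integral_lebesgue')
         (use p C in \<open>auto simp: I_def intro!: mult_left_mono powr_mono2'\<close>)
  qed
  have D0: "0 \<le> D n x" if "x > 0" for n x
  proof -
    have "((\<lambda>u. k (real (Suc n)) x) has_integral k (real (Suc n)) x) {real n<..<real (Suc n)}"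
      using has_integral_const_real[of "k (real (Suc n)) x" "real n" "real (Suc n)"] by (simp add: has_integral_Icc_iff_Ioo)
    moreover have "((\<lambda>u. k u x) has_integral (K x (real (Suc n)) - K x (real n))) {real n<..<real (Suc n)}"
      using K[OF that, of n] by (simp add: has_integral_Icc_iff_Ioo)
    ultimately have "k (real (Suc n)) x \<le> K x (real (Suc n)) - K x (real n)"
      by (rule has_integral_le) (use that in \<open>auto intro!: antimono\<close>)
    then show ?thesis by (simp add: D_def)
  qed
  have d0: "0 \<le> d n" for n
    using powr_difference_ge[of p n] p by (simp add: d_def)
  have dsums: "d sums (- Re (zhalf (of_real p)))"
    unfolding d_def by (rule zhalf_of_real_sums[OF p])
  \<comment> \<open>Exchanging the integrals turns the difference of the kernels at \<open>u\<close>
    and \<open>N\<close> into the difference of their transforms; integrating this over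
    \<open>u\<close> gives \<open>d n\<close>.\<close>
  have term_eq: "(\<integral>\<^sup>+x. ennreal (x powr (s - 1) * D n x) * indicator {0<..} x \<partial>lborel) = ennreal (C * d n)" for n
  proof -
    define N where "N = real (Suc n)"
    have N: "N > 0" by (simp add: N_def)
    have "(\<integral>\<^sup>+x. ennreal (x powr (s - 1) * D n x) * indicator {0<..} x \<partial>lborel)
      = (\<integral>\<^sup>+x. (\<integral>\<^sup>+u. ennreal (x powr (s - 1) * (k u x - k N x)) * (indicator (I n) u * indicator {0<..} x) \<partial>lborel) \<partial>lborel)"
    proof (intro nn_integral_cong)
      fix x :: real
      show "ennreal (x powr (s - 1) * D n x) * indicator {0<..} x = (\<integral>\<^sup>+u. ennreal (x powr (s - 1) * (k u x - k N x)) * (indicator (I n) u * indicator {0<..} x) \<partial>lborel)"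
      proof (cases "x > 0")
        case True
        have [measurable]: "(\<lambda>u. k u x) \<in> borel_measurable borel"
          using measurable_compose[OF measurable_Pair2'[of x borel borel] meas'] by simp
        have "(\<integral>\<^sup>+u. ennreal (x powr (s - 1) * (k u x - k N x)) * (indicator (I n) u * indicator {0<..} x) \<partial>lborel)
          = (\<integral>\<^sup>+u. ennreal (x powr (s - 1)) * (ennreal (k u x - k N x) * indicator (I n) u) \<partial>lborel)"
          using True by (intro nn_integral_cong) (simp add: ennreal_mult' mult.assoc)
        also have "... = ennreal (x powr (s - 1)) * ennreal (D n x)"
          by (subst nn_integral_cmult) (use Dint[OF True, of n] in \<open>auto simp: I_def N_def\<close>)
        finally show ?thesis using True by (simp add: ennreal_mult')
      qed simp
    qed
    also have "... = (\<integral>\<^sup>+u. (\<integral>\<^sup>+x. ennreal (x powr (s - 1) * (k u x - k N x)) * (indicator (I n) u * indicator {0<..} x) \<partial>lborel) \<partial>lborel)"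
    proof (rule lborel_pair.Fubini'[symmetric])
      show "(\<lambda>(x, u). ennreal (x powr (s - 1) * (k u x - k N x)) * (indicator (I n) u * indicator {0<..} x)) \<in> borel_measurable (lborel \<Otimes>\<^sub>M lborel)"
        unfolding lb I_def case_prod_beta by measurable
    qed
    also have "... = (\<integral>\<^sup>+u. ennreal (C * u powr (-p) - C * N powr (-p)) * indicator (I n) u \<partial>lborel)"
    proof (intro nn_integral_cong)
      fix u :: real
      show "(\<integral>\<^sup>+x. ennreal (x powr (s - 1) * (k u x - k N x)) * (indicator (I n) u * indicator {0<..} x) \<partial>lborel)
        = ennreal (C * u powr (-p) - C * N powr (-p)) * indicator (I n) u"
      proof (cases "u \<in> I n")
        case True
        then have u: "0 < u" "u \<le> N" by (auto simp: I_def N_def)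
        have "(\<integral>\<^sup>+x. ennreal (x powr (s - 1) * (k u x - k N x)) * (indicator (I n) u * indicator {0<..} x) \<partial>lborel)
          = (\<integral>\<^sup>+x. ennreal (x powr (s - 1) * k u x) * indicator {0<..} x - ennreal (x powr (s - 1) * k N x) * indicator {0<..} x \<partial>lborel)"
        proof (intro nn_integral_cong)
          fix x :: real
          show "ennreal (x powr (s - 1) * (k u x - k N x)) * (indicator (I n) u * indicator {0<..} x) =
              ennreal (x powr (s - 1) * k u x) * indicator {0<..} x - ennreal (x powr (s - 1) * k N x) * indicator {0<..} x"
            using True u N nonneg[of N x] by (cases "x > 0") (auto simp: right_diff_distrib ennreal_minus)
        qed
        also have "... = ennreal (C * u powr (-p)) - ennreal (C * N powr (-p))"
        proof (subst nn_integral_diff)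
          show "AE x in lborel. ennreal (x powr (s - 1) * k N x) * indicator {0<..} x \<le> ennreal (x powr (s - 1) * k u x) * indicator {0<..} x"
            using u N antimono[of u N] by (intro AE_I2) (auto simp: indicator_def intro!: ennreal_leI mult_left_mono)
        qed (use int[of u] int[of N] u N in auto)
        also have "... = ennreal (C * u powr (-p) - C * N powr (-p))"
          using C by (intro ennreal_minus) auto
        finally show ?thesis using True by simp
      qed simp
    qed
    also have "... = ennreal (C * d n)" unfolding N_def by (rule dint)
    finally show ?thesis .
  qed
  have "(\<integral>\<^sup>+x. ennreal (x powr (s - 1) * H x) * indicator {0<..} x \<partial>lborel)
    = (\<integral>\<^sup>+x. (\<Sum>n. ennreal (x powr (s - 1) * D n x) * indicator {0<..} x) \<partial>lborel)"
  proof (intro nn_integral_cong)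
    fix x :: real
    show "ennreal (x powr (s - 1) * H x) * indicator {0<..} x = (\<Sum>n. ennreal (x powr (s - 1) * D n x) * indicator {0<..} x)"
    proof (cases "x > 0")
      case True
      have "(\<lambda>n. x powr (s - 1) * D n x) sums (x powr (s - 1) * H x)"
        using sums_mult[OF sums[OF True]] by (simp add: D_def)
      then have "(\<Sum>n. ennreal (x powr (s - 1) * D n x)) = ennreal (x powr (s - 1) * H x)"
        using D0[OF True] by (intro suminf_ennreal_eq) auto
      then show ?thesis using True by simp
    qed simp
  qed
  also have "... = (\<Sum>n. \<integral>\<^sup>+x. ennreal (x powr (s - 1) * D n x) * indicator {0<..} x \<partial>lborel)"
  proof (rule nn_integral_suminf)
    fix n
    \<comment> \<open>\<open>K\<close> is not assumed measurable in \<open>x\<close>, so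
      measurability of \<open>D n\<close> is read off from its form as a parameter integral of
      \<open>k\<close>.\<close>
    have "(\<lambda>(x, u). ennreal (k u x - k (real (Suc n)) x) * indicator (I n) u) \<in> borel_measurable (borel \<Otimes>\<^sub>M lborel)"
      unfolding measurable_cong_sets[OF sets_pair_measure_cong[OF refl sets_lborel] refl] I_def case_prod_beta by measurable
    then have [measurable]: "(\<lambda>x. (\<integral>\<^sup>+u. ennreal (k u x - k (real (Suc n)) x) * indicator (I n) u \<partial>lborel)) \<in> borel_measurable borel"
      by (rule lborel.borel_measurable_nn_integral)
    have "(\<lambda>x. ennreal (x powr (s - 1)) * (\<integral>\<^sup>+u. ennreal (k u x - k (real (Suc n)) x) * indicator (I n) u \<partial>lborel) * indicator {0<..} x) \<in> borel_measurable lborel"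
      by measurable
    also have "(\<lambda>x. ennreal (x powr (s - 1)) * (\<integral>\<^sup>+u. ennreal (k u x - k (real (Suc n)) x) * indicator (I n) u \<partial>lborel) * indicator {0<..} x)
      = (\<lambda>x. ennreal (x powr (s - 1) * D n x) * indicator {0<..} x)"
    proof
      fix x :: real
      show "ennreal (x powr (s - 1)) * (\<integral>\<^sup>+u. ennreal (k u x - k (real (Suc n)) x) * indicator (I n) u \<partial>lborel) * indicator {0<..} x
        = ennreal (x powr (s - 1) * D n x) * indicator {0<..} x"
        by (cases "x > 0") (simp_all only: Dint, simp_all add: ennreal_mult')
    qed
    finally show "(\<lambda>x. ennreal (x powr (s - 1) * D n x) * indicator {0<..} x) \<in> borel_measurable lborel" .
  qed
  also have "... = (\<Sum>n. ennreal (C * d n))" by (simp only: term_eq)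
  also have "... = ennreal (C * - Re (zhalf (of_real p)))"
    using sums_mult[OF dsums, of C] C d0 by (intro suminf_ennreal_eq) auto
  finally show "(\<integral>\<^sup>+x. ennreal (x powr (s - 1) * H x) * indicator {0<..} x \<partial>lborel) = ennreal (C * - Re (zhalf (of_real p)))" .
qed

section \<open>Partial fractions and the real functional equation\<close>

text \<open>The logarithmic derivative of the reflection formula for \<open>Gamma\<close>; it ties
  the cotangent to the series of \<open>Digamma\<close>.\<close>

lemma Digamma_reflection:
  fixes z :: complex
  assumes "z \<notin> \<int>"
  shows "Digamma z - Digamma (1 - z) = - (of_real pi * cos (of_real pi * z) / sin (of_real pi * z))"
proof -
  have z: "z \<notin> \<int>\<^sub>\<le>\<^sub>0" "1 - z \<notin> \<int>\<^sub>\<le>\<^sub>0"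
    using assms nonpos_Ints_Int Ints_diff[of 1 "1 - z"] by fastforce+
  have s: "sin (of_real pi * z) \<noteq> 0"
    using assms by (auto simp: sin_eq_0)
  have "((\<lambda>z. Gamma z * Gamma (1 - z)) has_field_derivative Gamma z * Gamma (1 - z) * (Digamma z - Digamma (1 - z))) (at z)"
    using z by (auto intro!: derivative_eq_intros simp: algebra_simps)
  moreover have "((\<lambda>z. of_real pi / sin (of_real pi * z)) has_field_derivative
      (of_real pi / sin (of_real pi * z)) * (- (of_real pi * cos (of_real pi * z) / sin (of_real pi * z)))) (at z)"
    using s by (auto intro!: derivative_eq_intros simp: field_simps)
  ultimately have "(of_real pi / sin (of_real pi * z)) * (Digamma z - Digamma (1 - z)) =
     (of_real pi / sin (of_real pi * z)) * (- (of_real pi * cos (of_real pi * z) / sin (of_real pi * z)))"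
    unfolding Gamma_reflection_complex by (rule DERIV_unique)
  moreover have "of_real pi / sin (of_real pi * z) \<noteq> 0" using s by simp
  ultimately show ?thesis unfolding mult_cancel_left by blast
qed

text \<open>The partial fractions of the cotangent at the imaginary point \<open>z\<close>, where it
  becomes a multiple of \<open>(exp x + 1) / (exp x - 1) = 1 + 2 / (exp x - 1)\<close>. This is also
  where the constant \<open>1/2\<close> comes from.\<close>

lemma inverse_exp_minus_one_sums:
  fixes x :: real
  assumes "x > 0"
  shows "(\<lambda>n. 2 * x / (x\<^sup>2 + (2 * pi * real (Suc n))\<^sup>2)) sums (1 / (exp x - 1) + 1/2 - 1 / x)"
proof -
  define y where "y = x / (2 * pi)"
  have y: "y > 0" "x = 2 * pi * y" using assms by (auto simp: y_def)
  define z where "z = \<i> * of_real y"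
  have z: "z \<notin> \<int>" "z \<noteq> 0" "1 - z \<noteq> 0"
    using y by (auto simp: z_def complex_eq_iff elim!: Ints_cases)
  define a where "a = (\<lambda>n::nat. 2 * y / ((real (Suc n))\<^sup>2 + y\<^sup>2))"
  \<comment> \<open>Term \<open>n\<close> of the first sum is paired with term \<open>n + 1\<close>
    of the second, so that \<open>(n + 1 - z) * (n + 1 + z)\<close> is real. Unpaired are
    \<open>1 / z\<close> and a last term that vanishes in the limit.\<close>
  have eq: "(\<Sum>n<m. inverse (1 - z + of_nat n)) - (\<Sum>n<m. inverse (z + of_nat n))
     = \<i> * of_real (\<Sum>n<m. a n) - 1 / z + inverse (z + of_nat m)" for m
  proof (induction m)
    case (Suc m)
    have ne: "1 - z + of_nat m \<noteq> 0" "z + of_nat (Suc m) \<noteq> 0"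
      using y by (auto simp: z_def complex_eq_iff)
    have "inverse (1 - z + of_nat m) - inverse (z + of_nat (Suc m)) = 2 * z / ((1 - z + of_nat m) * (z + of_nat (Suc m)))"
      using ne by (simp add: field_simps)
    also have "(1 - z + of_nat m) * (z + of_nat (Suc m)) = of_real ((real (Suc m))\<^sup>2 + y\<^sup>2)"
      by (simp add: z_def complex_eq_iff power2_eq_square algebra_simps)
    also have "2 * z / of_real ((real (Suc m))\<^sup>2 + y\<^sup>2) = \<i> * of_real (a m)"
      by (simp add: a_def z_def)
    finally show ?case using Suc.IH by (simp add: algebra_simps)
  qed (use z in \<open>simp add: field_simps\<close>)
  have "(\<lambda>m. (\<Sum>n<m. inverse (1 - z + of_nat n)) - (\<Sum>n<m. inverse (z + of_nat n))) \<longlonglongrightarrow> Digamma z - Digamma (1 - z)"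
    using tendsto_diff[OF Digamma_LIMSEQ[OF z(2)] Digamma_LIMSEQ[OF z(3)]] by simp
  moreover have "(\<lambda>m. inverse (z + of_nat m)) \<longlonglongrightarrow> 0"
    by (intro filterlim_compose[OF tendsto_inverse_0] tendsto_add_filterlim_at_infinity[OF tendsto_const] tendsto_of_nat)
  ultimately have "(\<lambda>m. \<i> * of_real (\<Sum>n<m. a n) - 1 / z) \<longlonglongrightarrow> Digamma z - Digamma (1 - z) - 0"
    unfolding eq using tendsto_diff by fastforce
  then have "(\<lambda>m. - \<i> * ((\<i> * of_real (\<Sum>n<m. a n) - 1 / z) + 1 / z)) \<longlonglongrightarrow> - \<i> * ((Digamma z - Digamma (1 - z) - 0) + 1 / z)"
    by (rule tendsto_mult_left[OF tendsto_add[OF _ tendsto_const]])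
  then have lim: "(\<lambda>m. complex_of_real (\<Sum>n<m. a n)) \<longlonglongrightarrow> - \<i> * (Digamma z - Digamma (1 - z) + 1 / z)"
    by simp
  have "Digamma z - Digamma (1 - z) = \<i> * of_real (pi * (exp x + 1) / (exp x - 1))"
  proof -
    define e where "e = complex_of_real (exp (x/2))"
    have e: "e \<noteq> 0" "e^2 \<noteq> 1"
      using y by (auto simp: e_def simp flip: of_real_power exp_double)
    have "\<i> * (of_real pi * z) = of_real (- (x / 2))" by (simp add: z_def y complex_eq_iff)
    then have "exp (\<i> * (of_real pi * z)) = inverse e" "exp (- (\<i> * (of_real pi * z))) = e"
      by (simp_all add: e_def exp_minus flip: exp_of_real)
    then have "cos (of_real pi * z) = (inverse e + e) / 2" "sin (of_real pi * z) = (inverse e - e) / (2 * \<i>)"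
      by (simp_all add: cos_exp_eq sin_exp_eq)
    then have "Digamma z - Digamma (1 - z) = - (of_real pi * ((inverse e + e) / 2) / ((inverse e - e) / (2 * \<i>)))"
      using Digamma_reflection[OF z(1)] by simp
    also have "... = \<i> * of_real pi * (e^2 + 1) / (e^2 - 1)"
      using e by (simp add: divide_simps power2_eq_square) (simp add: algebra_simps)
    also have "e^2 = of_real (exp x)"
      by (simp add: e_def flip: of_real_power exp_double)
    finally show ?thesis by simp
  qed
  then have D: "Digamma z - Digamma (1 - z) = \<i> * of_real (pi * (exp x + 1) / (exp x - 1))" .
  have "1 / z = - \<i> * of_real (1 / y)" using y by (simp add: z_def field_simps)
  then have "- \<i> * (Digamma z - Digamma (1 - z) + 1 / z) = of_real (pi * (exp x + 1) / (exp x - 1) - 1 / y)"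
    unfolding D by (simp only: of_real_diff) (simp add: algebra_simps)
  with lim have "a sums (pi * (exp x + 1) / (exp x - 1) - 1 / y)"
    unfolding sums_def by (simp only: tendsto_of_real_iff)
  from sums_divide[OF this, of "2 * pi"]
  have "(\<lambda>n. a n / (2 * pi)) sums ((pi * (exp x + 1) / (exp x - 1) - 1 / y) / (2 * pi))" .
  also have "(pi * (exp x + 1) / (exp x - 1) - 1 / y) / (2 * pi) = 1 / (exp x - 1) + 1/2 - 1 / x"
  proof -
    have "exp x - 1 \<noteq> 0" using assms by simp
    then show ?thesis using y by (simp add: divide_simps) (simp add: algebra_simps)
  qed
  also have "(\<lambda>n. a n / (2 * pi)) = (\<lambda>n. 2 * x / (x\<^sup>2 + (2 * pi * real (Suc n))\<^sup>2))"
  proof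
    fix n
    have "(real (Suc n))\<^sup>2 + y\<^sup>2 > 0" "(2 * pi * y)\<^sup>2 + (2 * pi * real (Suc n))\<^sup>2 > 0"
      using y by (auto intro!: add_nonneg_pos add_pos_nonneg)
    then show "a n / (2 * pi) = 2 * x / (x\<^sup>2 + (2 * pi * real (Suc n))\<^sup>2)"
      using y by (simp add: a_def power_mult_distrib divide_simps del: of_nat_Suc) (simp add: algebra_simps power2_eq_square)
  qed
  finally show ?thesis .
qed

text \<open>Both kernels produce the same \<open>H\<close>: the exponential one has total integral
  \<open>1 / x\<close> in \<open>u\<close>, the rational one has \<open>1/2\<close>, which cancels
  the \<open>1/2\<close> of \<open>inverse_exp_minus_one_sums\<close>. Their transforms scale as
  \<open>u powr (-s)\<close> and \<open>u powr (-(1 - s))\<close>, so the two evaluations involve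
  \<open>s\<close> and \<open>1 - s\<close>.\<close>

lemma zhalf_real_functional_equation:
  fixes s :: real
  assumes s: "0 < s" "s < 1"
  shows "Gamma s * Re (zhalf (of_real s)) = pi / cos (pi * s / 2) * (2 * pi) powr (s - 1) * Re (zhalf (of_real (1 - s)))"
proof -
  define H where "H = (\<lambda>x::real. 1 / x - 1 / (exp x - 1))"
  have cos_pos: "cos (pi * s / 2) > 0"
    using s by (intro cos_gt_zero_pi) (auto simp: field_simps intro: less_le_trans[of _ 0])
  have 1: "(\<integral>\<^sup>+x. ennreal (x powr (s - 1) * H x) * indicator {0<..} x \<partial>lborel) = ennreal (Gamma s * - Re (zhalf (of_real s)))"
  proof (rule nn_integral_kernel[where k = "\<lambda>u x. exp (- u * x)" and K = "\<lambda>x u. - exp (- u * x) / x"])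
    show "(\<lambda>(u, x). exp (- u * x :: real)) \<in> borel_measurable (lborel \<Otimes>\<^sub>M lborel)"
      unfolding lborel_prod case_prod_beta measurable_lborel2
      by (intro borel_measurable_continuous_onI continuous_intros)
    show "0 \<le> Gamma s" using s by (intro Gamma_real_nonneg) auto
    show "(\<integral>\<^sup>+x. ennreal (x powr (s - 1) * exp (- u * x)) * indicator {0<..} x \<partial>lborel) = ennreal (Gamma s * u powr (- s))"
      if "0 < u" for u using nn_integral_powr_exp'[OF s(1) that] .
    fix n :: nat and x :: real assume x: "0 < x"
    show "((\<lambda>u. exp (- u * x)) has_integral - exp (- real (Suc n) * x) / x - - exp (- real n * x) / x) {real n..real (Suc n)}"
      using x by (intro fundamental_theorem_of_calculus)
        (auto simp flip: has_real_derivative_iff_has_vector_derivative intro!: derivative_eq_intros)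
  next
    fix x :: real assume x: "0 < x"
    define q where "q = exp (- x)"
    have q: "0 < q" "q < 1" using x by (auto simp: q_def)
    have e: "exp (- real n * x) = q ^ n" for n by (simp add: q_def flip: exp_of_nat_mult)
    have "(\<lambda>n. q ^ n) sums (1 / (1 - q))" using q by (intro geometric_sums) auto
    from sums_mult[OF this, of "(1 - q) / x - q"]
    have "(\<lambda>n. ((1 - q) / x - q) * q ^ n) sums (((1 - q) / x - q) * (1 / (1 - q)))" .
    also have "((1 - q) / x - q) * (1 / (1 - q)) = H x"
      using q x by (simp add: H_def q_def exp_minus field_simps)
    also have "(\<lambda>n. ((1 - q) / x - q) * q ^ n) = (\<lambda>n. - exp (- real (Suc n) * x) / x - - exp (- real n * x) / x - exp (- real (Suc n) * x))"
      unfolding e using x by (simp add: field_simps)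
    finally show "(\<lambda>n. - exp (- real (Suc n) * x) / x - - exp (- real n * x) / x - exp (- real (Suc n) * x)) sums H x" .
  qed (use s in \<open>auto intro: mult_right_mono\<close>)
  define C where "C = pi / cos (pi * s / 2) * (2 * pi) powr (s - 1)"
  have 2: "(\<integral>\<^sup>+x. ennreal (x powr (s - 1) * H x) * indicator {0<..} x \<partial>lborel) = ennreal (C * - Re (zhalf (of_real (1 - s))))"
  proof (rule nn_integral_kernel[where k = "\<lambda>u x. 2 * x / (x\<^sup>2 + (2 * pi * u)\<^sup>2)" and K = "\<lambda>x u. arctan (2 * pi * u / x) / pi"])
    show "(\<lambda>(u, x). 2 * x / (x\<^sup>2 + (2 * pi * u)\<^sup>2)) \<in> borel_measurable (lborel \<Otimes>\<^sub>M lborel)" by measurable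
    show "0 \<le> C" using cos_pos by (simp add: C_def)
    show "(\<integral>\<^sup>+x. ennreal (x powr (s - 1) * (2 * x / (x\<^sup>2 + (2 * pi * u)\<^sup>2))) * indicator {0<..} x \<partial>lborel) = ennreal (C * u powr (- (1 - s)))"
      if "0 < u" for u using nn_integral_powr_div_sum_squares[OF s, of "2 * pi * u"] that
      by (simp add: C_def powr_mult mult.assoc)
    fix u v x :: real assume "0 < u" "u \<le> v" "0 < x"
    then show "2 * x / (x\<^sup>2 + (2 * pi * v)\<^sup>2) \<le> 2 * x / (x\<^sup>2 + (2 * pi * u)\<^sup>2)"
      by (intro divide_left_mono add_left_mono power_mono mult_pos_pos add_pos_pos) (auto simp: mult_left_mono)
  next
    fix n :: nat and x :: real assume x: "0 < x"
    show "((\<lambda>u. 2 * x / (x\<^sup>2 + (2 * pi * u)\<^sup>2)) has_integral arctan (2 * pi * real (Suc n) / x) / pi - arctan (2 * pi * real n / x) / pi) {real n..real (Suc n)}"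
    proof (rule fundamental_theorem_of_calculus)
      fix u :: real
      define A where "A = 1 + (2 * pi * u / x)\<^sup>2"
      have A: "A > 0" by (auto simp: A_def intro!: add_pos_nonneg)
      have e: "x\<^sup>2 + (2 * pi * u)\<^sup>2 = x\<^sup>2 * A"
        using x by (simp add: A_def power_divide distrib_left)
      have "((\<lambda>u. 2 * pi * u / x) has_real_derivative 2 * pi / x) (at u)"
        using x by (auto intro!: derivative_eq_intros)
      from DERIV_cdivide[OF DERIV_chain2[OF DERIV_arctan this], of pi]
      have "((\<lambda>u. arctan (2 * pi * u / x) / pi) has_real_derivative (2 * pi / x) / A / pi) (at u)"
        by (simp add: A_def divide_inverse mult.commute)
      also have "(2 * pi / x) / A / pi = 2 * x / (x\<^sup>2 + (2 * pi * u)\<^sup>2)"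
        using x A unfolding e by (simp add: power2_eq_square)
      finally have "((\<lambda>u. arctan (2 * pi * u / x) / pi) has_real_derivative 2 * x / (x\<^sup>2 + (2 * pi * u)\<^sup>2)) (at u)" .
      then show "((\<lambda>u. arctan (2 * pi * u / x) / pi) has_vector_derivative 2 * x / (x\<^sup>2 + (2 * pi * u)\<^sup>2)) (at u within {real n..real (Suc n)})"
        by (simp add: has_real_derivative_iff_has_vector_derivative has_vector_derivative_at_within)
    qed auto
  next
    fix x :: real assume x: "0 < x"
    have "filterlim (\<lambda>n. 2 * pi / x * real n) at_top sequentially"
      using x by (intro filterlim_tendsto_pos_mult_at_top[OF tendsto_const] filterlim_real_sequentially) auto
    then have "filterlim (\<lambda>n. 2 * pi * real n / x) at_top sequentially" by simp
    from filterlim_compose[OF tendsto_arctan_at_top this]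
    have "(\<lambda>n. arctan (2 * pi * real n / x) / pi) \<longlonglongrightarrow> (pi / 2) / pi"
      by (intro tendsto_intros) auto
    from telescope_sums[OF this]
    have "(\<lambda>n. arctan (2 * pi * real (Suc n) / x) / pi - arctan (2 * pi * real n / x) / pi) sums (1/2)" by simp
    from sums_diff[OF this inverse_exp_minus_one_sums[OF x]]
    show "(\<lambda>n. arctan (2 * pi * real (Suc n) / x) / pi - arctan (2 * pi * real n / x) / pi - 2 * x / (x\<^sup>2 + (2 * pi * real (Suc n))\<^sup>2)) sums H x"
      by (simp add: H_def)
  qed (use s in auto)
  have "Gamma s * - Re (zhalf (of_real s)) = C * - Re (zhalf (of_real (1 - s)))"
  proof -
    have "0 \<le> Gamma s * - Re (zhalf (of_real s))" "0 \<le> C * - Re (zhalf (of_real (1 - s)))"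
      using zhalf_of_real_nonpos[of s] zhalf_of_real_nonpos[of "1 - s"] s cos_pos by (auto simp: C_def Gamma_real_nonneg mult_nonneg_nonpos intro!: divide_nonpos_pos mult_nonneg_nonpos)
    then show ?thesis using 1 2 by (metis ennreal_inj)
  qed
  then show ?thesis by (simp add: C_def)
qed

section \<open>The functional equation in the critical strip\<close>

lemma not_nonpos_Ints_if_Re_pos: "0 < Re z \<Longrightarrow> z \<notin> \<int>\<^sub>\<le>\<^sub>0"
  by (auto elim!: nonpos_Ints_cases)

text \<open>Conjugation passes through the approximating sums. It shows that the values on
  \<open>(0, 1)\<close> are real, and later trades \<open>-t\<close> for \<open>t\<close>.\<close>

lemma cnj_zhalf:
  assumes "0 < Re s" "s \<noteq> 1"
  shows "zhalf (cnj s) = cnj (zhalf s)"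
proof -
  have *: "cnj (of_nat n powr w) = of_nat n powr cnj w" for n w
    using cnj_powr[of "of_nat n" w] by simp
  have "(\<lambda>M. cnj ((\<Sum>n=1..M. of_nat n powr (-s)) + of_nat (Suc M) powr (1 - s) / (s - 1))) \<longlonglongrightarrow> cnj (zhalf s)"
    by (intro tendsto_cnj zhalf_LIMSEQ assms)
  moreover have "cnj s \<noteq> 1" using assms by (metis complex_cnj_cnj complex_cnj_one)
  then have "(\<lambda>M. (\<Sum>n=1..M. of_nat n powr (-cnj s)) + of_nat (Suc M) powr (1 - cnj s) / (cnj s - 1)) \<longlonglongrightarrow> zhalf (cnj s)"
    using assms by (intro zhalf_LIMSEQ) auto
  moreover have "cnj ((\<Sum>n=1..M. of_nat n powr (-s)) + of_nat (Suc M) powr (1 - s) / (s - 1)) =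
      (\<Sum>n=1..M. of_nat n powr (-cnj s)) + of_nat (Suc M) powr (1 - cnj s) / (cnj s - 1)" for M
    by (simp add: * del: of_nat_Suc)
  ultimately show ?thesis using LIMSEQ_unique by simp
qed

text \<open>Identity theorem: both sides are holomorphic in the strip and agree on the real segment,
  which accumulates at \<open>1/2\<close>. There the real equation is solved for the value at
  \<open>1 - s\<close>.\<close>

lemma zhalf_functional_equation_strip:
  fixes s :: complex
  assumes s: "0 < Re s" "Re s < 1"
  shows "zhalf (1 - s) = 2 * of_real (2 * pi) powr (-s) * cos (of_real pi * s / 2) * Gamma s * zhalf s"
proof -
  define S where "S = {s. 0 < Re s \<and> Re s < 1}"
  have S: "S = {s. 0 < Re s} \<inter> {s. Re s < 1}" by (auto simp: S_def)
  define f where "f = (\<lambda>s. zhalf (1 - s) - 2 * of_real (2 * pi) powr (-s) * cos (of_real pi * s / 2) * Gamma s * zhalf s)"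
  have "f s = 0"
  proof (rule analytic_continuation[of f S "of_real ` {0<..<1}" "1/2"])
    have "zhalf holomorphic_on S"
      by (rule holomorphic_on_subset[OF holomorphic_zhalf]) (auto simp: S_def)
    moreover have "(zhalf \<circ> (\<lambda>s. 1 - s)) holomorphic_on S"
      by (intro holomorphic_on_compose holomorphic_on_subset[OF holomorphic_zhalf] holomorphic_intros) (auto simp: S_def)
    moreover have "Gamma holomorphic_on S"
      by (intro holomorphic_Gamma) (auto simp: S_def dest: not_nonpos_Ints_if_Re_pos)
    ultimately show "f holomorphic_on S"
      unfolding f_def o_def by (intro holomorphic_intros) (auto simp: S_def dest: not_nonpos_Ints_if_Re_pos)
    show "open S" unfolding S by (intro open_Int open_halfspace_Re_gt open_halfspace_Re_lt)
    show "connected S" unfolding S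
      by (intro convex_connected convex_Int convex_halfspace_Re_gt convex_halfspace_Re_lt)
    show "of_real ` {0<..<1} \<subseteq> S" "1/2 \<in> S" "s \<in> S" using s by (auto simp: S_def)
    have "(1/2 :: real) islimpt {0<..<1}" by (rule interior_limit_point) auto
    then have "complex_of_real (1/2) islimpt of_real ` {0<..<1}"
      by (rule islimpt_isCont_image) (simp_all add: eventually_at_filter del: of_real_divide)
    then show "(1/2 :: complex) islimpt of_real ` {0<..<1}" by simp
  next
    fix z :: complex assume "z \<in> of_real ` {0<..<1}"
    then obtain x where x: "z = of_real x" "0 < x" "x < 1" by auto
    have real: "zhalf (of_real y) = of_real (Re (zhalf (of_real y)))" if "0 < y" "y < 1" for y :: real
      using cnj_zhalf[of "of_real y"] that by (simp add: complex_eq_iff)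
    have cos_pos: "cos (pi * x / 2) > 0"
      using x by (intro cos_gt_zero_pi) (auto simp: field_simps intro: less_le_trans[of _ 0])
    have "Re (zhalf (of_real (1 - x))) = 2 * (2 * pi) powr (-x) * cos (pi * x / 2) * Gamma x * Re (zhalf (of_real x))"
    proof -
      have "2 * (2 * pi) powr (-x) * cos (pi * x / 2) * (Gamma x * Re (zhalf (of_real x)))
        = ((2 * pi) * ((2 * pi) powr (-x) * (2 * pi) powr (x - 1))) * Re (zhalf (of_real (1 - x)))"
        unfolding zhalf_real_functional_equation[OF x(2,3)] using cos_pos by simp
      also have "(2 * pi) * ((2 * pi) powr (-x) * (2 * pi) powr (x - 1)) = 1"
      proof -
        have "(2 * pi) * ((2 * pi) powr (-x) * (2 * pi) powr (x - 1)) = (2 * pi) powr (1 + (-x + (x - 1)))"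
          unfolding powr_add by simp
        then show ?thesis by simp
      qed
      finally show ?thesis by (simp add: mult.assoc)
    qed
    then have "complex_of_real (Re (zhalf (of_real (1 - x)))) = of_real (2 * (2 * pi) powr (-x) * cos (pi * x / 2) * Gamma x * Re (zhalf (of_real x)))"
      by simp
    moreover have "complex_of_real ((2 * pi) powr (-x)) = of_real (2 * pi) powr (- of_real x)"
      by (simp flip: powr_of_real)
    moreover have "complex_of_real (cos (pi * x / 2)) = cos (of_real pi * of_real x / 2)"
      by (simp flip: cos_of_real)
    ultimately show "f z = 0"
      using real[of x] real[of "1 - x"] x
      by (simp add: f_def Gamma_complex_of_real)
  qed
  then show ?thesis by (simp add: f_def)
qed

section \<open>Continuation to the left half plane\<close>

text \<open>The factor \<open>sin (\<pi> s / 2) / s\<close> of the continuation, with its removable singularity at \<open>0\<close> filled.\<close>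

definition zext :: "complex \<Rightarrow> complex" where
  "zext s = (if s \<in> {s. Re s > 0} - {1} then zhalf s
     else - 2 * of_real (2 * pi) powr (s - 1) * Gamma (1 - s) * zreg (1 - s) *
       (if s = 0 then deriv (\<lambda>s. sin (of_real pi * s / 2)) 0 else (sin (of_real pi * s / 2) - sin (of_real pi * 0 / 2)) / (s - 0)))"

text \<open>Here \<open>zhalf (1 - s) = zreg (1 - s) / (- s)\<close>, and the cosine at
  \<open>1 - s\<close> is the sine at \<open>s\<close>. Dividing the sine by \<open>s\<close> leaves
  the minus sign in \<open>zext\<close>.\<close>

lemma zext_left:
  assumes "Re s < 1" "s \<noteq> 0"
  shows "- 2 * of_real (2 * pi) powr (s - 1) * Gamma (1 - s) * zreg (1 - s) *
    ((sin (of_real pi * s / 2) - sin (of_real pi * 0 / 2)) / (s - 0))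
    = 2 * of_real (2 * pi) powr (- (1 - s)) * cos (of_real pi * (1 - s) / 2) * Gamma (1 - s) * zhalf (1 - s)"
proof -
  have "cos (of_real pi * (1 - s) / 2) = sin (of_real pi * s / 2)"
  proof -
    have "of_real pi * (1 - s) / 2 = of_real pi / 2 - of_real pi * s / 2"
      by (simp add: algebra_simps diff_divide_distrib)
    then show ?thesis by (simp only: sin_cos_eq)
  qed
  then show ?thesis using assms by (simp add: zhalf_def)
qed

text \<open>The open sets \<open>A\<close> and \<open>B\<close> cover everything but 1 and overlap
  in the strip, where the two formulas agree by the functional equation at
  \<open>1 - s\<close>.\<close>

lemma holomorphic_zext: "zext holomorphic_on - {1}"
proof -
  define A where "A = {s. Re s > 0} - {1 :: complex}"
  define B where "B = {s :: complex. Re s < 1}"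
  have "open A" "open B"
    unfolding A_def B_def by (auto intro!: open_Diff open_halfspace_Re_gt open_halfspace_Re_lt)
  define h where "h = (\<lambda>s::complex. sin (of_real pi * s / 2))"
  have "h holomorphic_on UNIV" unfolding h_def by (intro holomorphic_intros) auto
  from holomorphic_on_subset[OF pole_lemma_open[OF this open_UNIV, of 0], of B]
  have h: "(\<lambda>s. if s = 0 then deriv h 0 else (h s - h 0) / (s - 0)) holomorphic_on B" by simp
  have sub: "(\<lambda>s. 1 - s) ` B \<subseteq> {s. 0 < Re s}" by (auto simp: B_def)
  have "Gamma holomorphic_on {s. 0 < Re s}"
    by (intro holomorphic_Gamma) (auto dest: not_nonpos_Ints_if_Re_pos)
  then have "(Gamma \<circ> (\<lambda>s. 1 - s)) holomorphic_on B"
    by (intro holomorphic_on_compose[OF _ holomorphic_on_subset[OF _ sub]])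
       (auto intro: holomorphic_intros)
  moreover have "(zreg \<circ> (\<lambda>s. 1 - s)) holomorphic_on B"
    by (intro holomorphic_on_compose holomorphic_on_subset[OF holomorphic_zreg sub] holomorphic_intros)
  ultimately have "(\<lambda>s. - 2 * of_real (2 * pi) powr (s - 1) * Gamma (1 - s) * zreg (1 - s) *
       (if s = 0 then deriv h 0 else (h s - h 0) / (s - 0))) holomorphic_on B" (is "?g holomorphic_on B")
    unfolding o_def using not_nonpos_Ints_if_Re_pos[of "1 - z" for z]
    by (intro holomorphic_intros h) (auto simp: B_def)
  moreover have "zhalf holomorphic_on A" unfolding A_def by (rule holomorphic_zhalf)
  ultimately have "(\<lambda>s. if s \<in> A then zhalf s else ?g s) holomorphic_on (A \<union> B)"
  proof (intro holomorphic_on_If_Un \<open>open A\<close> \<open>open B\<close>)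
    fix s assume "s \<in> A" "s \<in> B"
    then have s: "0 < Re s" "Re s < 1" "s \<noteq> 0" by (auto simp: A_def B_def)
    have "?g s = zhalf (1 - (1 - s))"
      using zext_left[OF s(2,3)] zhalf_functional_equation_strip[of "1 - s"] s by (simp add: h_def)
    then show "zhalf s = ?g s" by simp
  qed
  moreover have "A \<union> B = - {1}" by (auto simp: A_def B_def)
  moreover have "(\<lambda>s. if s \<in> A then zhalf s else ?g s) = zext"
    by (intro ext) (simp only: zext_def A_def h_def)
  ultimately show ?thesis by simp
qed

text \<open>\<open>zext\<close> shows that the specification of \<open>zeta\<close> can be
  satisfied, so the chosen function satisfies it. Both agree for \<open>Re s > 1\<close>, hence on
  the connected set \<open>- {1}\<close>.\<close>

lemma zeta_eq_zext:
  assumes "s \<noteq> 1"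
  shows "zeta s = zext s"
proof -
  have ext: "zext s = zhalf s" if "0 < Re s" "s \<noteq> 1" for s using that by (simp add: zext_def)
  define P where "P = (\<lambda>f. f holomorphic_on - {1} \<and> (\<forall>s. Re s > 1 \<longrightarrow> (\<lambda>n. 1 / of_nat (Suc n) powr s) sums f s))"
  have "zext holomorphic_on - {1} \<and> (\<forall>s. Re s > 1 \<longrightarrow> (\<lambda>n. 1 / of_nat (Suc n) powr s) sums zext s)"
  proof (intro conjI allI impI holomorphic_zext)
    fix s :: complex assume "1 < Re s"
    moreover from this have "s \<noteq> 1" by auto
    ultimately show "(\<lambda>n. 1 / of_nat (Suc n) powr s) sums zext s"
      using zhalf_sums[of s] ext[of s] by simp
  qed
  then have "P zext" by (simp add: P_def)
  from someI[of P, OF this] have *: "zeta holomorphic_on - {1} \<and> (\<forall>s. Re s > 1 \<longrightarrow> (\<lambda>n. 1 / of_nat (Suc n) powr s) sums zeta s)"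
    unfolding P_def zeta_def .
  show ?thesis
  proof (rule analytic_continuation_open[where s = "{s. Re s > 1}" and s' = "- {1}" and f = zeta and g = zext])
    show "connected (- {1 :: complex})" by (rule connected_punctured_universe) simp
    have "2 \<in> {s. Re s > 1}" by simp
    then show "{s. Re s > 1} \<noteq> {}" by blast
    fix z assume "z \<in> {s. Re s > 1}"
    then have z: "1 < Re z" by simp
    then have "z \<noteq> 1" by auto
    have "(\<lambda>n. 1 / of_nat (Suc n) powr z) sums zeta z" using * z by blast
    moreover have "(\<lambda>n. 1 / of_nat (Suc n) powr z) sums zext z"
      using zhalf_sums[OF z] ext[of z] z \<open>z \<noteq> 1\<close> by simp
    ultimately show "zeta z = zext z" by (rule sums_unique2)
  qed (use * holomorphic_zext assms in \<open>auto intro: open_halfspace_Re_gt\<close>)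
qed

lemma zeta_eq_zhalf: "0 < Re s \<Longrightarrow> s \<noteq> 1 \<Longrightarrow> zeta s = zhalf s"
  by (simp add: zeta_eq_zext zext_def)

text \<open>For \<open>Re s \<ge> 1\<close> the point \<open>1 - s\<close> lies where
  \<open>zext\<close> was defined by this very formula.\<close>

theorem zeta_functional_equation:
  assumes "0 < Re s" "s \<noteq> 1"
  shows "zeta (1 - s) = 2 * of_real (2 * pi) powr (-s) * cos (of_real pi * s / 2) * Gamma s * zeta s"
proof (cases "Re s < 1")
  case True
  then have "1 - s \<noteq> 1" "0 < Re (1 - s)" using assms by auto
  then show ?thesis
    using True zhalf_functional_equation_strip[of s] assms by (simp add: zeta_eq_zhalf)
next
  case False
  have "1 - s \<noteq> 1" "1 - s \<noteq> 0" using assms by auto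
  then have "zeta (1 - s) = 2 * of_real (2 * pi) powr (- (1 - (1 - s))) * cos (of_real pi * (1 - (1 - s)) / 2) * Gamma (1 - (1 - s)) * zhalf (1 - (1 - s))"
    using False assms by (subst zext_left[symmetric]) (auto simp: zeta_eq_zext zext_def)
  then show ?thesis using assms by (simp add: zeta_eq_zhalf)
qed

lemma holomorphic_zeta: "zeta holomorphic_on - {1}"
  using holomorphic_zext by (rule holomorphic_transform) (simp add: zeta_eq_zext)

lemma zeta_LIMSEQ:
  assumes "0 < Re s" "s \<noteq> 1"
  shows "(\<lambda>M. (\<Sum>n=1..M. of_nat n powr (-s)) + of_nat (Suc M) powr (1 - s) / (s - 1)) \<longlonglongrightarrow> zeta s"
  using zhalf_LIMSEQ[OF assms] zeta_eq_zhalf[OF assms] by simp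

lemma cnj_zeta: "0 < Re s \<Longrightarrow> s \<noteq> 1 \<Longrightarrow> zeta (cnj s) = cnj (zeta s)"
  using cnj_zhalf[of s] zeta_eq_zhalf[of s] zeta_eq_zhalf[of "cnj s"]
  by (metis complex_cnj_cnj complex_cnj_one cnj.sel(1))

lemma zeta_of_real_sums:
  assumes "1 < x"
  shows "(\<lambda>n. real (Suc n) powr (-x)) sums Re (zeta (of_real x))"
proof -
  have "(\<lambda>n. 1 / of_nat (Suc n) powr (complex_of_real x)) sums zeta (of_real x)"
    using zhalf_sums[of "of_real x"] assms zeta_eq_zhalf[of "of_real x"] by simp
  moreover have "1 / of_nat (Suc n) powr (complex_of_real x) = of_real (real (Suc n) powr (-x))" for n
  proof -
    have "of_nat (Suc n) powr (complex_of_real x) = of_real (real (Suc n) powr x)"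
      by (subst powr_of_real[symmetric]) (auto simp del: of_nat_Suc)
    then show ?thesis by (simp add: powr_minus_divide del: of_nat_Suc)
  qed
  ultimately have "(\<lambda>n. complex_of_real (real (Suc n) powr (-x))) sums zeta (of_real x)" by simp
  from sums_Re[OF this] show ?thesis by simp
qed

section \<open>The gamma factor\<close>

text \<open>\<open>f\<close> is the derivative of \<open>F\<close>. It increases up to
  \<open>u = t\<close>, has the maximum \<open>1 / (2 * t)\<close> there and decreases afterwards;
  the mean value theorem turns this into the three estimates.\<close>

lemma half_ln_increment_le:
  fixes t u :: real
  assumes "t > 0" "u > 0"
  defines "f \<equiv> \<lambda>u. u / (u\<^sup>2 + t\<^sup>2)" and "F \<equiv> \<lambda>u. ln (u\<^sup>2 + t\<^sup>2) / 2"
  shows "F (u + 1) - F u \<le> 1 / (2 * t)"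
    and "u + 1 \<le> t \<Longrightarrow> F (u + 1) - F u \<le> f (u + 1)"
    and "t \<le> u \<Longrightarrow> F (u + 1) - F u \<le> f u"
proof -
  have pos: "v\<^sup>2 + t\<^sup>2 > 0" for v using assms by (simp add: add_nonneg_pos)
  have der: "(F has_real_derivative f v) (at v)" for v
  proof -
    have "((\<lambda>u. ln (u\<^sup>2 + t\<^sup>2)) has_real_derivative (2 * v) / (v\<^sup>2 + t\<^sup>2)) (at v)"
      using pos[of v] by (auto intro!: derivative_eq_intros simp: divide_inverse mult.commute)
    moreover have "2 * v / A / 2 = v / A" for A :: real by simp
    ultimately show ?thesis unfolding F_def f_def by (metis DERIV_cdivide)
  qed
  obtain v where v: "u < v" "v < u + 1" "F (u + 1) - F u = f v"
    using MVT2[of u "u + 1" F f] der by auto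
  have "f v \<le> 1 / (2 * t)"
  proof -
    have "2 * t * v \<le> v\<^sup>2 + t\<^sup>2" using sum_squares_bound[of v t] by (simp add: mult_ac)
    then show ?thesis using assms pos[of v] by (simp add: f_def field_simps)
  qed
  then show "F (u + 1) - F u \<le> 1 / (2 * t)" using v by simp
  show "F (u + 1) - F u \<le> f (u + 1)" if "u + 1 \<le> t"
  proof -
    have "v * (u + 1) * ((u + 1) - v) \<le> t * t * ((u + 1) - v)"
      using that v assms by (intro mult_right_mono mult_mono) auto
    then have "v * ((u + 1)\<^sup>2 + t\<^sup>2) \<le> (u + 1) * (v\<^sup>2 + t\<^sup>2)"
      by (simp add: power2_eq_square algebra_simps)
    then show ?thesis unfolding v(3) f_def using pos[of v] pos[of "u + 1"] by (simp add: pos_divide_le_eq pos_le_divide_eq mult.commute)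
  qed
  show "F (u + 1) - F u \<le> f u" if "t \<le> u"
  proof -
    have "t * t * (v - u) \<le> v * u * (v - u)"
      using that v assms by (intro mult_right_mono mult_mono) auto
    then have "v * (u\<^sup>2 + t\<^sup>2) \<le> u * (v\<^sup>2 + t\<^sup>2)"
      by (simp add: power2_eq_square algebra_simps)
    then show ?thesis unfolding v(3) f_def using pos[of v] pos[of u] by (simp add: pos_divide_le_eq pos_le_divide_eq mult.commute)
  qed
qed

text \<open>Compares the series of \<open>f (x + n)\<close> with its integral. As \<open>f\<close>
  has a single peak, the loss is at most the maximum \<open>1 / (2 * t)\<close>, whatever the number
  of terms.\<close>

lemma Re_Digamma_le:
  fixes x t :: real
  assumes x: "0 < x" "x \<le> 1" and t: "t > 0"
  shows "Re (Digamma (Complex x t)) \<le> ln (1 + t\<^sup>2) / 2 + 1 / (2 * t)"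
proof -
  define f where "f = (\<lambda>u. u / (u\<^sup>2 + t\<^sup>2))"
  define F where "F = (\<lambda>u. ln (u\<^sup>2 + t\<^sup>2) / 2)"
  have pos: "v\<^sup>2 + t\<^sup>2 > 0" for v using t by (simp add: add_nonneg_pos)
  \<comment> \<open>Below the peak each increment is compared with the right end point, so the sum
    is off by \<open>f (x + m)\<close>. The step across the peak turns this into
    \<open>1 / (2 * t)\<close>; beyond it left end points dominate without further loss.\<close>
  have A: "F (x + m) - F x - (if x + m \<le> t then f (x + m) else 1 / (2 * t)) \<le> (\<Sum>n<m. f (x + n))" for m :: nat
  proof (induction m)
    case 0
    then show ?case using x t by (auto simp: f_def)
  next
    case (Suc m)
    define u where "u = x + m"
    have u: "u > 0" "x + real (Suc m) = u + 1" "x + real m = u" using x by (auto simp: u_def)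
    have inc: "F (u + 1) - F u \<le> 1 / (2 * t)" "u + 1 \<le> t \<Longrightarrow> F (u + 1) - F u \<le> f (u + 1)" "t \<le> u \<Longrightarrow> F (u + 1) - F u \<le> f u"
      unfolding F_def f_def by (fact half_ln_increment_le[OF t u(1)])+
    consider "u + 1 \<le> t" | "u \<le> t" "t < u + 1" | "t < u" by linarith
    then show ?case using Suc.IH inc unfolding sum.lessThan_Suc u by cases auto
  qed
  have fle: "f u \<le> 1 / (2 * t)" for u
    using sum_squares_bound[of u t] t pos[of u] by (simp add: f_def field_simps)
  have "(\<lambda>m. of_real (ln (real m)) - (\<Sum>n<m. inverse (Complex x t + of_nat n))) \<longlonglongrightarrow> Digamma (Complex x t)"
    by (rule Digamma_LIMSEQ) (use x in \<open>auto simp: complex_eq_iff\<close>)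
  from tendsto_Re[OF this]
  have lim: "(\<lambda>m. ln (real m) - (\<Sum>n<m. f (x + n))) \<longlonglongrightarrow> Re (Digamma (Complex x t))"
    by (simp add: f_def)
  show ?thesis
  proof (rule LIMSEQ_le_const2[OF lim], intro exI[of _ 1] allI impI)
    fix m :: nat assume m: "1 \<le> m"
    have "ln (real m) = ln ((real m)\<^sup>2) / 2" using m by (simp add: ln_realpow)
    also have "... \<le> F (x + m)"
      unfolding F_def using m x t pos[of "x+m"] by (intro divide_right_mono) (auto simp: add_increasing2 power_mono)
    finally have "ln (real m) \<le> F (x + m)" .
    moreover have "F x \<le> ln (1 + t\<^sup>2) / 2"
      unfolding F_def using x pos[of x] by (auto simp: power_le_one add_pos_nonneg)
    ultimately show "ln (real m) - (\<Sum>n<m. f (x + n)) \<le> ln (1 + t\<^sup>2) / 2 + 1 / (2 * t)"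
      using A[of m] fle[of "x + m"] by (auto split: if_splits)
  qed
qed

text \<open>On this line \<open>1 - z\<close> is the conjugate of \<open>z\<close>, so the
  reflection formula gives the squared modulus.\<close>

lemma norm_Gamma_half_line: "(cmod (Gamma (Complex (1/2) t)))\<^sup>2 = pi / cosh (pi * t)"
proof -
  define z where "z = Complex (1/2) t"
  have "1 - z = cnj z" by (simp add: z_def complex_eq_iff)
  then have "of_real ((cmod (Gamma z))\<^sup>2) = Gamma z * Gamma (1 - z)"
    by (simp only: complex_norm_square cnj_Gamma)
  also have "... = of_real pi / sin (of_real pi * z)" by (rule Gamma_reflection_complex)
  also have "sin (of_real pi * z) = of_real (cosh (pi * t))"
  proof -
    have "of_real pi * z = of_real pi / 2 - - (\<i> * of_real (pi * t))"
      by (simp add: z_def complex_eq_iff)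
    then have "sin (of_real pi * z) = cos (\<i> * of_real (pi * t))"
      by (simp only: sin_cos_eq) (simp add: algebra_simps)
    also have "... = of_real (cosh (pi * t))"
    proof -
      have "exp (complex_of_real pi * of_real t) = of_real (exp (pi * t))" "exp (- (complex_of_real pi * of_real t)) = of_real (exp (- (pi * t)))"
        by (simp_all flip: exp_of_real)
      then show ?thesis by (simp add: cos_exp_eq cosh_def scaleR_conv_of_real add.commute flip: mult.assoc)
    qed
    finally show ?thesis .
  qed
  finally have "complex_of_real ((cmod (Gamma z))\<^sup>2) = of_real (pi / cosh (pi * t))" by simp
  then show ?thesis unfolding of_real_eq_iff z_def .
qed

text \<open>In the real direction the logarithmic derivative of the squared modulus of
  \<open>Gamma\<close> is \<open>2 * Re Digamma\<close>, at most \<open>2 * B\<close>. So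
  \<open>h\<close> does not increase from \<open>u = 1/2\<close> on, where the modulus is known
  exactly.\<close>

lemma norm_Gamma_strip_le:
  fixes x t :: real
  assumes x: "1/2 \<le> x" "x \<le> 1" and t: "t > 0"
  shows "(cmod (Gamma (Complex x t)))\<^sup>2 \<le> pi / cosh (pi * t) * exp ((2 * x - 1) * (ln (1 + t\<^sup>2) / 2 + 1 / (2 * t)))"
proof -
  define B where "B = ln (1 + t\<^sup>2) / 2 + 1 / (2 * t)"
  define G where "G = (\<lambda>u. Gamma (Complex u t))"
  define r where "r = (\<lambda>u. Re (G u))"
  define i where "i = (\<lambda>u. Im (G u))"
  define h where "h = (\<lambda>u. ((Re (G u))\<^sup>2 + (Im (G u))\<^sup>2) * exp (- 2 * B * u))"
  have "h x \<le> h (1/2)"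
  proof (rule DERIV_nonpos_imp_nonincreasing[OF x(1)])
    fix u :: real assume u: "1/2 \<le> u" "u \<le> x"
    define D where "D = Digamma (Complex u t)"
    have "Complex u t \<notin> \<int>\<^sub>\<le>\<^sub>0" using u by (intro not_nonpos_Ints_if_Re_pos) auto
    then have "(Gamma has_field_derivative G u * D) (at (Complex u t))"
      unfolding G_def D_def by (rule has_field_derivative_Gamma)
    moreover have "((\<lambda>u. Complex u t) has_vector_derivative 1) (at u)"
      unfolding Complex_eq by (auto intro!: derivative_eq_intros)
    ultimately have "(G has_vector_derivative (1 * (G u * D))) (at u)"
      unfolding G_def using field_vector_diff_chain_at[of "\<lambda>u. Complex u t" 1 u Gamma "Gamma (Complex u t) * D"] by (simp add: o_def)
    then have G': "(G has_vector_derivative (G u * D)) (at u)" by simp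
    have "((\<lambda>u. Re (G u)) has_real_derivative Re (G u * D)) (at u)" "((\<lambda>u. Im (G u)) has_real_derivative Im (G u * D)) (at u)"
      using bounded_linear.has_vector_derivative[OF bounded_linear_Re G'] bounded_linear.has_vector_derivative[OF bounded_linear_Im G'] by (simp_all add: has_real_derivative_iff_has_vector_derivative)
    then have "((\<lambda>u. (r u)\<^sup>2) has_real_derivative 2 * r u * Re (G u * D)) (at u)" "((\<lambda>u. (i u)\<^sup>2) has_real_derivative 2 * i u * Im (G u * D)) (at u)"
      unfolding r_def[symmetric] i_def[symmetric] by (auto intro!: derivative_eq_intros)
    moreover have "((\<lambda>u. exp (- 2 * B * u)) has_real_derivative - 2 * B * exp (- 2 * B * u)) (at u)"
      by (auto intro!: derivative_eq_intros)
    ultimately have "((\<lambda>u. ((r u)\<^sup>2 + (i u)\<^sup>2) * exp (- 2 * B * u)) has_real_derivative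
        (2 * r u * Re (G u * D) + 2 * i u * Im (G u * D)) * exp (- 2 * B * u) + (- 2 * B * exp (- 2 * B * u)) * ((r u)\<^sup>2 + (i u)\<^sup>2)) (at u)"
      by (intro DERIV_mult DERIV_add)
    then have "(h has_real_derivative (2 * (Re (G u) * Re (G u * D) + Im (G u) * Im (G u * D)) * exp (- 2 * B * u)
       - 2 * B * ((Re (G u))\<^sup>2 + (Im (G u))\<^sup>2) * exp (- 2 * B * u))) (at u)"
      by (simp add: h_def r_def i_def algebra_simps)
    also have "2 * (Re (G u) * Re (G u * D) + Im (G u) * Im (G u * D)) * exp (- 2 * B * u)
       - 2 * B * ((Re (G u))\<^sup>2 + (Im (G u))\<^sup>2) * exp (- 2 * B * u) = 2 * (Re D - B) * h u"
      by (simp add: h_def power2_eq_square algebra_simps)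
    finally have "(h has_real_derivative 2 * (Re D - B) * h u) (at u)" .
    moreover have "Re D \<le> B" unfolding D_def B_def using u x t by (intro Re_Digamma_le) auto
    then have "2 * (Re D - B) * h u \<le> 0" by (intro mult_nonpos_nonneg[of "2 * (Re D - B)" "h u"]) (simp_all add: h_def)
    ultimately show "\<exists>y. (h has_real_derivative y) (at u) \<and> y \<le> 0" by blast
  qed
  then have "(cmod (G x))\<^sup>2 * exp (- 2 * B * x) \<le> (cmod (G (1/2)))\<^sup>2 * exp (- B)"
    by (simp add: h_def cmod_power2)
  then have "(cmod (G x))\<^sup>2 * exp (- 2 * B * x) * exp (2 * B * x) \<le> pi / cosh (pi * t) * exp (- B) * exp (2 * B * x)"
    unfolding G_def norm_Gamma_half_line by (rule mult_right_mono) auto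
  then show ?thesis
  proof -
    have "exp (- 2 * B * x) * exp (2 * B * x) = 1" by (simp flip: exp_add)
    moreover have "exp (- B) * exp (2 * B * x) = exp ((2 * x - 1) * B)" by (simp add: algebra_simps flip: exp_add)
    ultimately show ?thesis
      using \<open>_ \<le> pi / cosh (pi * t) * exp (- B) * exp (2 * B * x)\<close>
      unfolding mult.assoc B_def[symmetric] G_def by simp
  qed
qed

lemma exp_half_ln_le:
  fixes t :: real
  assumes "t \<ge> 1"
  shows "exp (ln (1 + t\<^sup>2) / 2 + 1 / (2 * t)) \<le> t + 2"
proof -
  have "exp (ln (1 + t\<^sup>2) / 2) = sqrt (1 + t\<^sup>2)"
    using assms by (simp add: ln_sqrt[symmetric] add_pos_nonneg)
  also have "... \<le> t + 1 / (2 * t)"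
    using assms by (intro real_le_lsqrt) (auto simp: power2_eq_square field_simps)
  finally have 1: "exp (ln (1 + t\<^sup>2) / 2) \<le> t + 1 / (2 * t)" .
  have 2: "exp (1 / (2 * t)) \<le> 1 + 1 / (2 * t) + (1 / (2 * t))\<^sup>2"
    using assms by (intro exp_bound) auto
  have "exp (ln (1 + t\<^sup>2) / 2 + 1 / (2 * t)) \<le> (t + 1 / (2 * t)) * (1 + 1 / (2 * t) + (1 / (2 * t))\<^sup>2)"
    unfolding exp_add using assms by (intro mult_mono 1 2) auto
  also have "... = t + 1/2 + 3/4 * (1 / t) + 1/4 * (1/t)^2 + 1/8 * (1/t)^3"
    using assms by (simp add: field_simps power2_eq_square power3_eq_cube)
  also have "... \<le> t + 1/2 + 3/4 * 1 + 1/4 * 1 + 1/8 * 1"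
    using assms by (intro add_mono mult_left_mono power_le_one) auto
  finally show ?thesis by simp
qed

abbreviation (input) zeta_sq :: "real \<Rightarrow> real \<Rightarrow> real" where
  "zeta_sq \<sigma> t \<equiv> (cmod (zeta (Complex \<sigma> t)))\<^sup>2"

text \<open>The functional equation is used at \<open>s = Complex x (- t)\<close>. The squared
  cosine, at most \<open>cosh (pi * t) / 2\<close>, cancels the decay of \<open>Gamma\<close>, and
  only \<open>E powr (2 * x - 1)\<close> and powers of \<open>2 * pi\<close> are left.\<close>

theorem norm_zeta_reflection_le:
  fixes x t :: real
  assumes x: "1/2 \<le> x" "x \<le> 1" and t: "t \<ge> 1"
  shows "zeta_sq (1 - x) t \<le> ((t + 2) / (2 * pi)) powr (2 * x - 1) * zeta_sq x t"
proof -
  define s where "s = Complex x (-t)"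
  have s: "0 < Re s" "s \<noteq> 1" using x t by (auto simp: s_def complex_eq_iff)
  have s_cnj: "s = cnj (Complex x t)" by (simp add: s_def complex_eq_iff)
  have z: "zeta s = cnj (zeta (Complex x t))"
    unfolding s_cnj by (rule cnj_zeta) (use x t in \<open>auto simp: complex_eq_iff\<close>)
  define E where "E = exp (ln (1 + t\<^sup>2) / 2 + 1 / (2 * t))"
  have E: "0 < E" "E \<le> t + 2" using exp_half_ln_le[OF t] by (auto simp: E_def)
  have "Complex (1 - x) t = 1 - s" by (simp add: s_def complex_eq_iff)
  then have "cmod (zeta (Complex (1 - x) t)) = 2 * (2 * pi) powr (-x) * cmod (cos (of_real pi * s / 2)) * cmod (Gamma s) * cmod (zeta s)"
    using zeta_functional_equation[OF s] by (simp add: norm_mult norm_powr_real_powr s_def)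
  then have "zeta_sq (1 - x) t = 4 * ((2 * pi) powr (-x))\<^sup>2 * (cmod (cos (of_real pi * s / 2)))\<^sup>2 * (cmod (Gamma s))\<^sup>2 * zeta_sq x t"
    by (simp add: power_mult_distrib z)
  also have "(cmod (Gamma s))\<^sup>2 = (cmod (Gamma (Complex x t)))\<^sup>2"
    unfolding s_cnj by (simp flip: cnj_Gamma)
  also have "4 * ((2 * pi) powr (-x))\<^sup>2 * (cmod (cos (of_real pi * s / 2)))\<^sup>2 * (cmod (Gamma (Complex x t)))\<^sup>2 * zeta_sq x t
     \<le> 4 * ((2 * pi) powr (-x))\<^sup>2 * (cosh (pi * t) / 2) * (pi / cosh (pi * t) * exp ((2 * x - 1) * (ln (1 + t\<^sup>2) / 2 + 1 / (2 * t)))) * zeta_sq x t"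
  proof (intro mult_right_mono mult_mono mult_left_mono norm_Gamma_strip_le x)
    have "(cmod (cos (of_real pi * s / 2)))\<^sup>2 = (cos (pi * x / 2))\<^sup>2 + (exp (- (pi * t / 2)) - exp (pi * t / 2))\<^sup>2 / 4"
      by (simp add: norm_cos_squared s_def exp_minus)
    also have "(exp (- (pi * t / 2)) - exp (pi * t / 2))\<^sup>2 / 4 = (cosh (pi * t) - 1) / 2"
    proof -
      have "exp (pi * t) = (exp (pi * t / 2))\<^sup>2" by (simp flip: exp_double)
      then show ?thesis by (simp add: power2_diff cosh_def exp_minus field_simps power2_eq_square)
    qed
    also have "(cos (pi * x / 2))\<^sup>2 = (1 + cos (pi * x)) / 2"
      using cos_double_cos[of "pi * x / 2"] by simp
    \<comment> \<open>Here \<open>1/2 \<le> x\<close> enters: twice the squared modulus of the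
      cosine is \<open>cosh (pi * t) + cos (pi * x)\<close>.\<close>
    also have "cos (pi * x) \<le> 0"
    proof -
      have "0 \<le> cos (pi - pi * x)" using x by (intro cos_ge_zero) (auto simp: field_simps)
      then show ?thesis by simp
    qed
    finally show "(cmod (cos (of_real pi * s / 2)))\<^sup>2 \<le> cosh (pi * t) / 2" by (simp add: field_simps)
  qed (use t in auto)
  also have "4 * ((2 * pi) powr (-x))\<^sup>2 * (cosh (pi * t) / 2) * (pi / cosh (pi * t) * exp ((2 * x - 1) * (ln (1 + t\<^sup>2) / 2 + 1 / (2 * t))))
     = (E / (2 * pi)) powr (2 * x - 1)"
  proof -
    have e: "exp ((2 * x - 1) * (ln (1 + t\<^sup>2) / 2 + 1 / (2 * t))) = E powr (2 * x - 1)"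
      by (simp add: E_def powr_def)
    have "cosh (pi * t) > 0" by (rule cosh_real_pos)
    then have "4 * ((2 * pi) powr (-x))\<^sup>2 * (cosh (pi * t) / 2) * (pi / cosh (pi * t) * exp ((2 * x - 1) * (ln (1 + t\<^sup>2) / 2 + 1 / (2 * t))))
      = (2 * pi) * ((2 * pi) powr (-x) * (2 * pi) powr (-x)) * exp ((2 * x - 1) * (ln (1 + t\<^sup>2) / 2 + 1 / (2 * t)))"
      by (simp add: power2_eq_square)
    also note e
    also have "(2 * pi) * ((2 * pi) powr (-x) * (2 * pi) powr (-x)) = (2 * pi) powr (1 + ((-x) + (-x)))"
      unfolding powr_add by simp
    also have "... = (2 * pi) powr (- (2 * x - 1))" by (simp add: algebra_simps)
    also have "(2 * pi) powr (- (2 * x - 1)) * E powr (2 * x - 1) = (E / (2 * pi)) powr (2 * x - 1)"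
      unfolding powr_minus_divide using E by (simp add: powr_divide)
    finally show ?thesis unfolding e .
  qed
  also have "(E / (2 * pi)) powr (2 * x - 1) \<le> ((t + 2) / (2 * pi)) powr (2 * x - 1)"
    using E x by (intro powr_mono2 divide_right_mono) auto
  finally show ?thesis by (simp add: mult_right_mono)
qed

section \<open>Approximation by Dirichlet polynomials\<close>

lemma two_ln_le:
  fixes u :: real
  assumes "1 \<le> u"
  shows "2 * ln u \<le> u - 1 / u"
proof -
  have "(1::real) - 1 / 1 - 2 * ln 1 \<le> u - 1 / u - 2 * ln u"
  proof (rule DERIV_nonneg_imp_nondecreasing[OF assms])
    fix x :: real assume x: "1 \<le> x" "x \<le> u"
    have "((\<lambda>u. u - 1 / u - 2 * ln u) has_real_derivative (1 - 1 / x)\<^sup>2) (at x)"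
      using x by (auto intro!: derivative_eq_intros simp: power2_eq_square field_simps)
    then show "\<exists>y. ((\<lambda>u. u - 1 / u - 2 * ln u) has_real_derivative y) (at x) \<and> 0 \<le> y"
      using zero_le_power2 by blast
  qed
  then show ?thesis by simp
qed

definition lstep :: "real \<Rightarrow> real" where "lstep x = ln (1 + 1 / x)"

lemma lstep_pos: "0 < x \<Longrightarrow> 0 < lstep x"
  by (auto simp: lstep_def intro!: ln_gt_zero)

text \<open>With \<open>u = sqrt (1 + 1 / x)\<close> this is
  \<open>2 * ln u \<le> u - 1 / u\<close>, whose right-hand side is exactly the reciprocal of the
  geometric mean.\<close>

lemma lstep_le:
  assumes "0 < x"
  shows "lstep x \<le> 1 / sqrt (x * (x + 1))"
proof -
  define u where "u = sqrt (1 + 1 / x)"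
  have u: "1 \<le> u" "u * u = 1 + 1 / x" using assms by (auto simp: u_def)
  have "lstep x = ln (u * u)" by (simp add: lstep_def u)
  also have "... = 2 * ln u" using u(1) by (simp add: ln_mult)
  also have "... \<le> u - 1 / u" by (rule two_ln_le[OF u(1)])
  also have "u - 1 / u = (u * u - 1) / u" using u(1) by (simp add: field_simps)
  also have "... = (1 / x) / u" by (simp add: u)
  also have "... = 1 / (x * u)" by simp
  also have "x * u = sqrt (x * (x + 1))"
    using assms by (intro real_sqrt_unique[symmetric]) (auto simp: power_mult_distrib power2_eq_square u mult.assoc field_simps u_def)
  finally show ?thesis .
qed

lemma lstep_ge:
  assumes "0 < x"
  shows "2 / (2 * x + 1) \<le> lstep x"
proof -
  have "ln (1 + 0) - 2 * 0 / (2 + 0) \<le> ln (1 + 1 / x) - 2 * (1 / x) / (2 + 1 / x)"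
  proof (rule DERIV_nonneg_imp_nondecreasing[of 0 "1 / x" "\<lambda>y. ln (1 + y) - 2 * y / (2 + y)"])
    fix y :: real assume y: "0 \<le> y" "y \<le> 1 / x"
    have "((\<lambda>y. ln (1 + y) - 2 * y / (2 + y)) has_real_derivative 1 / (1 + y) - 4 / (2 + y)\<^sup>2) (at y)"
    proof (rule DERIV_diff)
      show "((\<lambda>y. ln (1 + y)) has_real_derivative 1 / (1 + y)) (at y)"
        using y by (auto intro!: derivative_eq_intros)
      show "((\<lambda>y. 2 * y / (2 + y)) has_real_derivative 4 / (2 + y)\<^sup>2) (at y)"
        using y by (auto intro!: derivative_eq_intros simp: power2_eq_square algebra_simps)
    qed
    moreover have "1 / (1 + y) - 4 / (2 + y)\<^sup>2 = y\<^sup>2 / ((1 + y) * (2 + y)\<^sup>2)"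
    proof -
      have "1 + y \<noteq> 0" "(2 + y)\<^sup>2 \<noteq> 0" using y by auto
      then have "1 / (1 + y) - 4 / (2 + y)\<^sup>2 = ((2 + y)\<^sup>2 - 4 * (1 + y)) / ((1 + y) * (2 + y)\<^sup>2)"
        by (simp add: diff_frac_eq)
      then show ?thesis by (simp add: power2_eq_square algebra_simps)
    qed
    moreover have "0 \<le> y\<^sup>2 / ((1 + y) * (2 + y)\<^sup>2)" using y by auto
    ultimately show "\<exists>d. ((\<lambda>y. ln (1 + y) - 2 * y / (2 + y)) has_real_derivative d) (at y) \<and> 0 \<le> d"
      by (metis (no_types, lifting))
  qed (use assms in auto)
  moreover have "2 * (1 / x) / (2 + 1 / x) = 2 / (2 * x + 1)" using assms by (simp add: field_simps)
  ultimately show ?thesis by (simp add: lstep_def)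
qed

text \<open>The second term in the expansion of \<open>1 / ln (1 + 1 / x)\<close> for large
  \<open>x\<close>; it increases towards \<open>1/2\<close>.\<close>

definition lgap :: "real \<Rightarrow> real" where "lgap x = 1 / lstep x - x"

lemma lgap_le_half: "0 < x \<Longrightarrow> lgap x \<le> 1 / 2"
  using lstep_ge[of x] lstep_pos[of x] by (simp add: lgap_def field_simps)

lemma lgap_ge:
  assumes "5 \<le> x"
  shows "9 / 20 \<le> lgap x"
proof -
  have "x + 9/20 \<le> sqrt (x * (x + 1))"
    using assms by (intro real_le_rsqrt) (auto simp: power2_eq_square algebra_simps)
  also have "... \<le> 1 / lstep x"
  proof -
    have "sqrt (x * (x + 1)) > 0" using assms by simp
    then have "lstep x * sqrt (x * (x + 1)) \<le> 1"
      using lstep_le[of x] assms pos_le_divide_eq[of "sqrt (x * (x + 1))" "lstep x" 1] by simp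
    then show ?thesis
      using lstep_pos[of x] assms pos_le_divide_eq[of "lstep x" "sqrt (x * (x + 1))" 1] by (simp only: mult.commute)
  qed
  finally show ?thesis by (simp add: lgap_def)
qed

text \<open>The derivative is \<open>1 / (z * (z + 1) * (lstep z)\<^sup>2) - 1\<close>; the
  geometric mean in \<open>lstep_le\<close> makes it nonnegative.\<close>

lemma lgap_mono:
  assumes "0 < x" "x \<le> y"
  shows "lgap x \<le> lgap y"
proof (rule DERIV_nonneg_imp_nondecreasing[OF assms(2)])
  fix z assume z: "x \<le> z" "z \<le> y"
  then have zpos: "0 < z" using assms by simp
  have "(lstep has_real_derivative - (1 / (z * (z + 1)))) (at z)"
    unfolding lstep_def using zpos by (auto intro!: derivative_eq_intros simp: power2_eq_square field_simps add_pos_pos)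
  then have "(lgap has_real_derivative 1 / (z * (z + 1)) / (lstep z)\<^sup>2 - 1) (at z)"
    unfolding lgap_def using lstep_pos[OF zpos]
    by (auto intro!: derivative_eq_intros simp: power2_eq_square)
  moreover have "(lstep z)\<^sup>2 \<le> 1 / (z * (z + 1))"
  proof -
    have "(lstep z)\<^sup>2 \<le> (1 / sqrt (z * (z + 1)))\<^sup>2"
      using lstep_le[OF zpos] lstep_pos[OF zpos] by (intro power_mono) auto
    then show ?thesis using zpos by (simp add: power_divide)
  qed
  then have "0 \<le> 1 / (z * (z + 1)) / (lstep z)\<^sup>2 - 1"
    using lstep_pos[OF zpos] pos_le_divide_eq[of "(lstep z)\<^sup>2" 1 "1 / (z * (z + 1))"] by simp
  ultimately show "\<exists>d. (lgap has_real_derivative d) (at z) \<and> 0 \<le> d" by blast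
qed

section \<open>The regular part of \<open>1 / (1 - exp (- w))\<close> at 0\<close>

text \<open>The generating function \<open>w / (1 - exp (- w))\<close> of the Bernoulli numbers
  without its constant term, divided by \<open>w\<close>. Its limit at 0 is
  \<open>1/2\<close>.\<close>

definition expgap :: "complex \<Rightarrow> complex" where "expgap w = 1 / (1 - exp (- w)) - 1 / w"

lemma norm_cosh_remainder_le:
  fixes w :: complex
  assumes "cmod w \<le> 1"
  shows "cmod (exp w + exp (- w) - 2 - w\<^sup>2) \<le> cmod w ^ 4 / 11"
proof -
  have T: "cmod (exp z - (\<Sum>k\<le>7. z ^ k / fact k)) \<le> 3 * cmod w ^ 8 / fact 7" if "cmod z = cmod w" for z
  proof -
    have "cmod (exp z - (\<Sum>k\<le>7. z ^ k / fact k)) \<le> exp \<bar>Re z\<bar> * cmod z ^ Suc 7 / fact 7"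
      by (rule Taylor_exp)
    also have "exp \<bar>Re z\<bar> \<le> exp 1" using abs_Re_le_cmod[of z] that assms by simp
    also have "exp (1 :: real) \<le> 3" by (rule exp_le)
    finally show ?thesis using that by (simp add: mult_right_mono divide_right_mono)
  qed
  have sum: "(\<Sum>k\<le>7. z ^ k / fact k) = 1 + z + z^2/2 + z^3/6 + z^4/24 + z^5/120 + z^6/720 + z^7/5040" for z :: complex
    by (simp add: eval_nat_numeral fact_numeral)
  define r1 where "r1 = exp w - (\<Sum>k\<le>7. w ^ k / fact k)"
  define r2 where "r2 = exp (- w) - (\<Sum>k\<le>7. (- w) ^ k / fact k)"
  have r: "cmod r1 \<le> 3 * cmod w ^ 8 / 5040" "cmod r2 \<le> 3 * cmod w ^ 8 / 5040"
    using T[of w] T[of "- w"] by (simp_all add: r1_def r2_def fact_numeral)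
  have "exp w + exp (- w) - 2 - w\<^sup>2 = w^4/12 + (w^6/360 + (r1 + r2))"
    unfolding r1_def r2_def sum by (simp add: field_simps)
  also have "cmod ... \<le> cmod w^4/12 + (cmod w^6/360 + (3 * cmod w ^ 8 / 5040 + 3 * cmod w ^ 8 / 5040))"
    by (intro norm_triangle_le add_mono r) (simp_all add: norm_divide norm_power)
  also have "... \<le> cmod w^4/12 + (cmod w^4/360 + (3 * cmod w ^ 4 / 5040 + 3 * cmod w ^ 4 / 5040))"
    using assms by (intro add_mono divide_right_mono mult_left_mono power_decreasing) auto
  also have "... \<le> cmod w ^ 4 / 11" by (simp add: field_simps)
  finally show ?thesis .
qed

text \<open>The derivative is \<open>1 / z\<^sup>2 - 1 / A\<close>. Since \<open>A\<close> is
  \<open>z\<^sup>2\<close> up to terms of fourth order, the double poles cancel, and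
  \<open>(1/11) / (10/11) = 1/10\<close> bounds the rest.\<close>

lemma expgap_lipschitz:
  assumes w: "0 < Re w" "cmod w \<le> 1" and w': "0 < Re w'" "cmod w' \<le> 1"
  shows "cmod (expgap w - expgap w') \<le> cmod (w - w') / 10"
proof -
  define S where "S = cball 0 1 \<inter> {w. 0 < Re w}"
  define g where "g = (\<lambda>w. 1 / w\<^sup>2 - 1 / (exp w + exp (- w) - 2 :: complex))"
  have "cmod (expgap w - expgap w') \<le> 1 / 10 * cmod (w - w')"
  proof (rule field_differentiable_bound[of S expgap g])
    show "convex S" unfolding S_def by (intro convex_Int convex_cball convex_halfspace_Re_gt)
    fix z assume "z \<in> S"
    then have z: "cmod z \<le> 1" "0 < Re z" "z \<noteq> 0" by (auto simp: S_def)
    define A where "A = exp z + exp (- z) - 2"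
    have rem: "cmod (A - z\<^sup>2) \<le> cmod z ^ 4 / 11"
      using norm_cosh_remainder_le[OF z(1)] by (simp add: A_def)
    have "cmod (z\<^sup>2) - cmod (A - z\<^sup>2) \<le> cmod A"
      using norm_triangle_ineq2[of "z\<^sup>2" "z\<^sup>2 - A"] by (simp add: norm_minus_commute)
    moreover have "cmod z ^ 4 \<le> cmod z ^ 2" using z by (intro power_decreasing) auto
    ultimately have A: "10 / 11 * (cmod z)\<^sup>2 \<le> cmod A" using rem by (simp add: norm_power)
    then have A0: "A \<noteq> 0" using z by auto
    have Aeq: "A = (1 - exp (- z))\<^sup>2 / exp (- z)"
      by (simp add: A_def power2_eq_square field_simps flip: exp_add)
    then have ne: "1 - exp (- z) \<noteq> 0" using A0 by auto
    have "(expgap has_field_derivative - (exp (- z) / (1 - exp (- z))\<^sup>2) + 1 / z\<^sup>2) (at z within S)"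
      unfolding expgap_def using ne z
      by (auto intro!: derivative_eq_intros simp: power2_eq_square)
    also have "- (exp (- z) / (1 - exp (- z))\<^sup>2) + 1 / z\<^sup>2 = g z"
      using Aeq by (simp add: g_def A_def[symmetric])
    finally show "(expgap has_field_derivative g z) (at z within S)" .
    have "g z = (A - z\<^sup>2) / (z\<^sup>2 * A)"
      using A0 z by (simp add: g_def A_def[symmetric] diff_frac_eq)
    then have "cmod (g z) = cmod (A - z\<^sup>2) / ((cmod z)\<^sup>2 * cmod A)"
      by (simp add: norm_divide norm_mult norm_power)
    also have "... \<le> (cmod z ^ 4 / 11) / ((cmod z)\<^sup>2 * (10 / 11 * (cmod z)\<^sup>2))"
      using rem A z by (intro frac_le mult_left_mono mult_pos_pos) auto
    also have "... = 1 / 10" using z by (simp add: power2_eq_square power4_eq_xxxx)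
    finally show "norm (g z) \<le> 1 / 10" .
  qed (use w w' in \<open>auto simp: S_def\<close>)
  then show ?thesis by simp
qed

text \<open>Only the limit at 0 is used later, so the constant 10 is crude.\<close>

lemma expgap_near_half:
  assumes w: "w \<noteq> 0" "cmod w \<le> 1 / 6"
  shows "cmod (expgap w - 1 / 2) \<le> 10 * cmod w"
proof -
  define r where "r = exp (- w) - (1 - w + w\<^sup>2 / 2)"
  have e3: "exp \<bar>Re (-w)\<bar> \<le> 3" 
  proof -
    have "exp \<bar>Re (-w)\<bar> \<le> exp 1" using abs_Re_le_cmod[of "-w"] w by simp
    then show ?thesis using exp_le by linarith
  qed
  have "cmod (exp (- w) - (\<Sum>k\<le>2. (- w) ^ k / fact k)) \<le> exp \<bar>Re (- w)\<bar> * cmod (- w) ^ Suc 2 / fact 2"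
    by (rule Taylor_exp)
  also have "... \<le> 3 * cmod (- w) ^ Suc 2 / fact 2"
    using e3 by (intro divide_right_mono mult_right_mono) auto
  finally have r: "cmod r \<le> 3 / 2 * cmod w ^ 3"
    by (simp add: r_def eval_nat_numeral)
  have "cmod (exp (- w) - (\<Sum>k\<le>1. (- w) ^ k / fact k)) \<le> exp \<bar>Re (- w)\<bar> * cmod (- w) ^ Suc 1 / fact 1"
    by (rule Taylor_exp)
  also have "... \<le> 3 * cmod (- w) ^ Suc 1 / fact 1"
    using e3 by (intro divide_right_mono mult_right_mono) auto
  finally have "cmod (w - (1 - exp (- w))) \<le> 3 * (cmod w)\<^sup>2"
    by (simp add: power2_eq_square algebra_simps)
  moreover have "cmod w - cmod (w - (1 - exp (- w))) \<le> cmod (1 - exp (- w))"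
    using norm_triangle_ineq2[of w "w - (1 - exp (- w))"] by simp
  moreover have "(cmod w)\<^sup>2 \<le> cmod w * (1 / 6)"
    unfolding power2_eq_square using w by (intro mult_left_mono) auto
  ultimately have d: "cmod w / 2 \<le> cmod (1 - exp (- w))" by simp
  have wpos: "cmod w > 0" using w by simp
  then have ne: "1 - exp (- w) \<noteq> 0" using d by auto
  have "expgap w - 1 / 2 = (2 * w - 2 * (1 - exp (- w)) - w * (1 - exp (- w))) / (2 * w * (1 - exp (- w)))"
    using ne w by (simp add: expgap_def divide_simps)
  also have "2 * w - 2 * (1 - exp (- w)) - w * (1 - exp (- w)) = w ^ 3 / 2 + (2 + w) * r"
    by (simp add: r_def power2_eq_square power3_eq_cube algebra_simps)
  finally have "cmod (expgap w - 1 / 2) = cmod (w ^ 3 / 2 + (2 + w) * r) / (2 * cmod w * cmod (1 - exp (- w)))"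
    by (simp add: norm_divide norm_mult)
  also have "... \<le> (10 * cmod w ^ 3) / (2 * cmod w * (cmod w / 2))"
  proof (intro frac_le)
    have "cmod (w ^ 3 / 2 + (2 + w) * r) \<le> cmod w ^ 3 / 2 + (2 + cmod w) * (3 / 2 * cmod w ^ 3)"
    proof (intro norm_triangle_le add_mono)
      show "cmod ((2 + w) * r) \<le> (2 + cmod w) * (3 / 2 * cmod w ^ 3)"
        unfolding norm_mult using r norm_triangle_ineq[of 2 w] by (intro mult_mono) auto
    qed (simp add: norm_power norm_divide)
    also have "... \<le> cmod w ^ 3 / 2 + (2 + 1) * (3 / 2 * cmod w ^ 3)"
      using w by (intro add_mono mult_right_mono) auto
    also have "... \<le> 10 * cmod w ^ 3" by (simp)
    finally show "cmod (w ^ 3 / 2 + (2 + w) * r) \<le> 10 * cmod w ^ 3" .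
  qed (use d wpos in auto)
  also have "... = 10 * cmod w" using wpos by (simp add: power3_eq_cube)
  finally show ?thesis .
qed

text \<open>The limit \<open>1/2\<close> at 0 plus the Lipschitz constant \<open>1/10\<close>, with
  \<open>w\<close> moved towards 0 along its ray, since 0 itself is outside the half plane.\<close>

lemma norm_expgap_le:
  assumes w: "0 < Re w" "cmod w \<le> 1"
  shows "cmod (expgap w) \<le> 3 / 5"
proof -
  \<comment> \<open>The shift 6 brings the points into the disc of radius \<open>1/6\<close>
    required by \<open>expgap_near_half\<close>.\<close>
  define v where "v = (\<lambda>n. of_real (1 / real (n + 6)) * w)"
  have w0: "w \<noteq> 0" using w by auto
  have v0: "v \<longlonglongrightarrow> 0"
  proof -
    have "(\<lambda>n. 1 / real (n + 6)) \<longlonglongrightarrow> 0"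
      by (rule LIMSEQ_ignore_initial_segment[OF lim_1_over_n, of 6])
    from tendsto_mult_left_zero[OF tendsto_of_real[OF this, where 'a = complex, simplified], of w]
    show ?thesis by (simp add: v_def)
  qed
  have "(\<lambda>n. expgap (v n) - 1 / 2) \<longlonglongrightarrow> 0"
  proof (rule Lim_null_comparison)
    show "\<forall>\<^sub>F n in sequentially. cmod (expgap (v n) - 1 / 2) \<le> 10 * cmod (v n)"
    proof (intro always_eventually allI expgap_near_half)
      fix n
      show "v n \<noteq> 0" unfolding v_def mult_eq_0_iff of_real_eq_0_iff using w0 by simp
      have "cmod (v n) = 1 / real (n + 6) * cmod w" unfolding v_def norm_mult norm_of_real by simp
      also have "... \<le> 1 / 6 * 1" using w by (intro mult_mono) (auto simp: field_simps)
      finally show "cmod (v n) \<le> 1 / 6" by simp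
    qed
    show "(\<lambda>n. 10 * cmod (v n)) \<longlonglongrightarrow> 0"
      using tendsto_mult_right_zero[OF tendsto_norm_zero[OF v0]] .
  qed
  then have lim: "(\<lambda>n. expgap (v n)) \<longlonglongrightarrow> 1 / 2" by (simp add: LIM_zero_iff)
  have "cmod (expgap w - 1 / 2) \<le> 1 / 10 * 1"
  proof (rule LIMSEQ_le_const2[OF tendsto_norm[OF tendsto_diff[OF tendsto_const lim]]], intro exI[of _ 0] allI impI)
    fix n :: nat
    have c: "0 < 1 / real (n + 6)" "1 / real (n + 6) \<le> 1" by auto
    have "w - v n = of_real (1 - 1 / real (n + 6)) * w" by (simp add: v_def algebra_simps)
    then have "cmod (w - v n) = (1 - 1 / real (n + 6)) * cmod w" using c by (simp only: norm_mult norm_of_real)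
    also have "... \<le> 1 * 1" using c w by (intro mult_mono) auto
    finally have 1: "cmod (w - v n) \<le> 1" by simp
    have "cmod (v n) = 1 / real (n + 6) * cmod w" unfolding v_def norm_mult norm_of_real by simp
    also have "... \<le> 1 * 1" using c w by (intro mult_mono) auto
    finally have "cmod (expgap w - expgap (v n)) \<le> cmod (w - v n) / 10"
      using w c by (intro expgap_lipschitz) (auto simp: v_def)
    then show "cmod (expgap w - expgap (v n)) \<le> 1 / 10 * 1" using 1 by simp
  qed
  then show ?thesis using norm_triangle_sub[of "expgap w" "1 / 2"] by (simp add: norm_divide)
qed


text \<open>Summation by parts: for \<open>h n = n powr (-s)\<close> and \<open>k n = 1 / (1 - h (n + 1) / h n)\<close> we have
  \<open>h n = h n * k n - h (n + 1) * k n\<close>, and \<open>k (n + 1) - k n\<close> is \<open>1 / s\<close> up to an error of size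
  \<open>\<bar>s\<bar> / n\<^sup>2\<close>. So \<open>1 - 1 / s\<close> times a tail of the series is a boundary term up to \<open>O(N powr (-Re s))\<close>.\<close>

theorem zeta_approx:
  fixes s :: complex and N :: nat
  assumes s: "0 < Re s" "Re s \<le> 1" "1 \<le> Im s" and N: "5 \<le> N" "Im s \<le> real N"
  shows "cmod (zeta s - (\<Sum>n=1..<N. of_nat n powr (-s)) - of_nat N powr (1 - s) / (s - 1)) \<le> 8/5 * real N powr (- Re s)"
proof -
  define h where "h = (\<lambda>n::nat. (of_nat n :: complex) powr (-s))"
  define w where "w = (\<lambda>n::nat. s * of_real (lstep (real n)))"
  define k where "k = (\<lambda>n::nat. 1 / (1 - exp (- w n)))"
  define e where "e = (\<lambda>n. k (Suc n) - k n - 1 / s)"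
  define S where "S = (\<lambda>m. \<Sum>n<m. h (N + n))"
  define E where "E = (\<lambda>m. \<Sum>n<m. h (Suc (N + n)) * e (N + n))"
  have s0: "s \<noteq> 0" "s \<noteq> 1" "1 \<le> cmod s" "1 \<le> cmod (s - 1)"
    using s abs_Im_le_cmod[of s] abs_Im_le_cmod[of "s - 1"] by auto
  \<comment> \<open>Here \<open>Im s \<le> N\<close> is used: the square of \<open>cmod s\<close> is
    at most \<open>1 + N\<^sup>2 \<le> n * (n + 1)\<close>, which matches the geometric mean in
    \<open>lstep_le\<close>.\<close>
  have wprop: "0 < Re (w n)" "cmod (w n) \<le> 1" if "n \<ge> N" for n
  proof -
    have n: "0 < real n" using that N by simp
    show "0 < Re (w n)" using lstep_pos[OF n] s by (simp add: w_def)
    have "(cmod s)\<^sup>2 \<le> 1 + (real N)\<^sup>2"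
      unfolding cmod_power2 using s N by (intro add_mono power_mono power_le_one) auto
    also have "... \<le> real n * (real n + 1)"
    proof -
      have "real N * real N \<le> real n * real n" "1 \<le> real n" using that N by (auto intro: mult_mono)
      then show ?thesis by (simp add: power2_eq_square algebra_simps)
    qed
    finally have "cmod s \<le> sqrt (real n * (real n + 1))" by (rule real_le_rsqrt)
    then have "cmod s * lstep (real n) \<le> sqrt (real n * (real n + 1)) * (1 / sqrt (real n * (real n + 1)))"
      using lstep_le[OF n] lstep_pos[OF n] by (intro mult_mono) auto
    then show "cmod (w n) \<le> 1" using n lstep_pos[OF n] by (simp add: w_def norm_mult)
  qed
  have k_eq: "k n = (of_nat n + of_real (lgap (real n))) / s + expgap (w n)" if "n \<ge> N" for n
  proof -
    have "lstep (real n) > 0" using that N by (intro lstep_pos) auto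
    then have "1 / w n = of_real (1 / lstep (real n)) / s" by (simp add: w_def)
    also have "1 / lstep (real n) = real n + lgap (real n)" by (simp add: lgap_def)
    finally show ?thesis by (simp add: k_def expgap_def)
  qed
  have h_Suc: "h (Suc n) = h n * exp (- w n)" if "n \<ge> N" for n
  proof -
    have n: "n > 0" using that N by simp
    have "lstep (real n) = ln (real (Suc n)) - ln (real n)"
    proof -
      have "1 + 1 / real n = real (Suc n) / real n" using n by (simp add: field_simps)
      then show ?thesis using n by (simp only: lstep_def ln_div) simp
    qed
    then have "ln (real (Suc n)) = ln (real n) + lstep (real n)" by simp
    then have "- s * of_real (ln (real (Suc n))) = - s * of_real (ln (real n)) + - w n"
      by (simp only: w_def of_real_add) (simp add: algebra_simps)
    then have "exp (- s * of_real (ln (real (Suc n)))) = exp (- s * of_real (ln (real n))) * exp (- w n)"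
      by (simp only: exp_add)
    moreover have "h m = exp (- s * of_real (ln (real m)))" if "m > 0" for m
      using that by (simp add: h_def powr_def Ln_of_nat)
    ultimately show ?thesis using n by simp
  qed
  have h_tele: "h n = h n * k n - h (Suc n) * k n" if "n \<ge> N" for n
  proof -
    have "1 - exp (- w n) \<noteq> 0"
    proof
      assume "1 - exp (- w n) = 0"
      then have "cmod (exp (- w n)) = 1" by simp
      then show False using wprop(1)[OF that] by simp
    qed
    then have "h n * k n * (1 - exp (- w n)) = h n" by (simp add: k_def)
    then show ?thesis unfolding h_Suc[OF that] by (simp add: algebra_simps)
  qed
  \<comment> \<open>The part \<open>1 / s\<close> of \<open>k (n + 1) - k n\<close> moves to the
    left and produces the factor \<open>1 - 1 / s\<close>; only the small \<open>e\<close> stays in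
    \<open>E\<close>.\<close>
  have sum_eq: "(1 - 1 / s) * S m = h N * k N - h (N + m) * k (N + m) + (h (N + m) - h N) / s + E m" for m
  proof (induction m)
    case (Suc m)
    have "(1 - 1 / s) * S (Suc m) = (1 - 1 / s) * S m + (h (N + m) - h (N + m) / s)"
      by (simp add: S_def algebra_simps)
    also have "... = h N * k N + E m - h N / s + (h (N + m) - h (N + m) * k (N + m))"
      unfolding Suc.IH by (simp add: algebra_simps diff_divide_distrib)
    also have "h (N + m) - h (N + m) * k (N + m) = - (h (Suc (N + m)) * k (N + m))"
      using h_tele[of "N + m"] by (simp add: algebra_simps)
    also have "E m = E (Suc m) - h (Suc (N + m)) * e (N + m)" by (simp add: E_def)
    finally show ?case by (simp add: e_def algebra_simps diff_divide_distrib)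
  qed (simp add: S_def E_def)
  have norm_h: "cmod (h n) = real n powr (- Re s)" if "n > 0" for n
    using that by (simp add: h_def norm_powr_real_powr)
  define q where "q = lgap (real N)"
  have norm_e: "cmod (e n) \<le> (lgap (real (Suc n)) - lgap (real n)) / cmod s + cmod s * (lstep (real n) - lstep (real (Suc n))) / 10" if "n \<ge> N" for n
  proof -
    have n: "0 < real n" using that N by simp
    have "e n = of_real (lgap (real (Suc n)) - lgap (real n)) / s + (expgap (w (Suc n)) - expgap (w n))"
      using that s0 by (simp add: e_def k_eq field_simps)
    also have "cmod ... \<le> cmod (of_real (lgap (real (Suc n)) - lgap (real n)) / s) + cmod (expgap (w (Suc n)) - expgap (w n))"
      by (rule norm_triangle_ineq)
    also have "cmod (of_real (lgap (real (Suc n)) - lgap (real n)) / s) = (lgap (real (Suc n)) - lgap (real n)) / cmod s"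
      unfolding norm_divide norm_of_real using lgap_mono[of "real n" "real (Suc n)"] n by simp
    also have "cmod (expgap (w (Suc n)) - expgap (w n)) \<le> cmod (w (Suc n) - w n) / 10"
      using that by (intro expgap_lipschitz wprop) auto
    also have "cmod (w (Suc n) - w n) = cmod s * (lstep (real n) - lstep (real (Suc n)))"
    proof -
      have "w (Suc n) - w n = s * of_real (lstep (real (Suc n)) - lstep (real n))"
        by (simp add: w_def algebra_simps)
      moreover have "lstep (real (Suc n)) \<le> lstep (real n)"
      proof -
        have "1 / real (Suc n) \<le> 1 / real n" using n by (intro divide_left_mono) auto
        then have "ln (1 + 1 / real (Suc n)) \<le> ln (1 + 1 / real n)" by (intro ln_mono) (auto intro: add_pos_nonneg)
        then show ?thesis by (simp only: lstep_def)
      qed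
      ultimately show ?thesis by (simp only: norm_mult norm_of_real) simp
    qed
    finally show ?thesis by simp
  qed
  \<comment> \<open>Both parts of \<open>norm_e\<close> telescope: \<open>lgap\<close> has at most
    \<open>1/2 - q\<close> left to climb, and \<open>cmod s * lstep N\<close> is at most 1.\<close>
  have norm_E: "cmod (E m) \<le> real N powr (- Re s) * ((1/2 - q) / cmod s + 1 / 10)" for m
  proof -
    have "cmod (E m) \<le> (\<Sum>n<m. real N powr (- Re s) * ((lgap (real (N + Suc n)) - lgap (real (N + n))) / cmod s + cmod s * (lstep (real (N + n)) - lstep (real (N + Suc n))) / 10))"
      unfolding E_def
    proof (rule sum_norm_le)
      fix n
      have "cmod (h (Suc (N + n))) \<le> real N powr (- Re s)"
        using s N by (subst norm_h) (auto intro!: powr_mono2')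
      then show "cmod (h (Suc (N + n)) * e (N + n)) \<le> real N powr (- Re s) * ((lgap (real (N + Suc n)) - lgap (real (N + n))) / cmod s + cmod s * (lstep (real (N + n)) - lstep (real (N + Suc n))) / 10)"
        unfolding norm_mult using norm_e[of "N + n"] by (intro mult_mono) auto
    qed
    also have "... = real N powr (- Re s) * ((\<Sum>n<m. lgap (real (N + Suc n)) - lgap (real (N + n))) / cmod s + cmod s * (\<Sum>n<m. lstep (real (N + n)) - lstep (real (N + Suc n))) / 10)"
      by (simp only: sum_distrib_left[symmetric] sum.distrib sum_divide_distrib[symmetric])
    also have "(\<Sum>n<m. lgap (real (N + Suc n)) - lgap (real (N + n))) = lgap (real (N + m)) - q"
      using sum_lessThan_telescope[of "\<lambda>n. lgap (real (N + n))" m] by (simp add: q_def)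
    also have "(\<Sum>n<m. lstep (real (N + n)) - lstep (real (N + Suc n))) = lstep (real N) - lstep (real (N + m))"
      using sum_lessThan_telescope'[of "\<lambda>n. lstep (real (N + n))" m] by simp
    also have "real N powr (- Re s) * ((lgap (real (N + m)) - q) / cmod s + cmod s * (lstep (real N) - lstep (real (N + m))) / 10)
      \<le> real N powr (- Re s) * ((1/2 - q) / cmod s + 1 / 10)"
    proof (intro mult_left_mono add_mono divide_right_mono)
      show "lgap (real (N + m)) - q \<le> 1 / 2 - q" using lgap_le_half[of "real (N + m)"] N by simp
      have "cmod s * (lstep (real N) - lstep (real (N + m))) \<le> cmod s * lstep (real N)"
        using lstep_pos[of "real (N + m)"] N by (intro mult_left_mono) auto
      also have "... = cmod (w N)" using lstep_pos[of "real N"] N by (simp add: w_def norm_mult)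
      also have "... \<le> 1" by (rule wprop) simp
      finally show "cmod s * (lstep (real N) - lstep (real (N + m))) \<le> 1" .
    qed auto
    finally show ?thesis .
  qed
  have shift: "of_nat n powr (1 - s) = of_nat n * h n" if "n > 0" for n
    using that by (simp add: h_def powr_diff powr_minus field_simps)
  define X where "X = (\<lambda>m. S m + of_nat (N + m) powr (1 - s) / (s - 1) - of_nat N powr (1 - s) / (s - 1))"
  define Y where "Y = zeta s - (\<Sum>n=1..<N. of_nat n powr (-s)) - of_nat N powr (1 - s) / (s - 1)"
  have limX: "X \<longlonglongrightarrow> Y"
  proof -
    have "(\<lambda>m. (\<Sum>n=1..m + (N - 1). of_nat n powr (-s)) + of_nat (Suc (m + (N - 1))) powr (1 - s) / (s - 1)) \<longlonglongrightarrow> zeta s"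
      using zeta_LIMSEQ[of s] s s0 by (intro LIMSEQ_ignore_initial_segment[of "\<lambda>M. (\<Sum>n=1..M. of_nat n powr (-s)) + of_nat (Suc M) powr (1 - s) / (s - 1)"]) auto
    then have "(\<lambda>m. (\<Sum>n=1..m + (N - 1). of_nat n powr (-s)) + of_nat (Suc (m + (N - 1))) powr (1 - s) / (s - 1)
       - (\<Sum>n=1..<N. of_nat n powr (-s)) - of_nat N powr (1 - s) / (s - 1)) \<longlonglongrightarrow> Y"
      unfolding Y_def by (intro tendsto_intros)
    moreover have "(\<Sum>n=1..m + (N - 1). of_nat n powr (-s)) = (\<Sum>n=1..<N. of_nat n powr (-s)) + S m" for m
    proof -
      have "{1..m + (N - 1)} = {1..<N} \<union> {N..<N + m}" using N by auto
      then have "(\<Sum>n=1..m + (N - 1). of_nat n powr (-s)) = (\<Sum>n=1..<N. of_nat n powr (-s)) + (\<Sum>n=N..<N+m. of_nat n powr (-s) :: complex)"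
        by (simp add: sum.union_disjoint)
      also have "(\<Sum>n=N..<N+m. of_nat n powr (-s)) = S m"
        unfolding S_def h_def by (rule sum.reindex_bij_witness[of _ "\<lambda>n. N + n" "\<lambda>n. n - N"]) auto
      finally show ?thesis .
    qed
    moreover have "Suc (m + (N - 1)) = N + m" for m using N by simp
    ultimately show ?thesis unfolding X_def by (simp add: algebra_simps)
  qed
  \<comment> \<open>The large terms \<open>n * h n / s\<close> from \<open>k_eq\<close> cancel
    against the powers \<open>n powr (1 - s)\<close>, so what remains has size
    \<open>n powr (- Re s)\<close>.\<close>
  have Xeq: "(1 - 1 / s) * X m = h N * ((of_real q - 1) / s + expgap (w N)) + E m + h (N + m) * ((1 - of_real (lgap (real (N + m)))) / s - expgap (w (N + m)))" for m
  proof -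
    have c: "(1 - 1 / s) * (x / (s - 1)) = x / s" for x
      using s0 by (simp add: field_simps)
    have "(1 - 1 / s) * X m = (1 - 1 / s) * S m + of_nat (N + m) * h (N + m) / s - of_nat N * h N / s"
    proof -
      have "0 < N + m" "0 < N" using N by auto
      from shift[OF this(1)] shift[OF this(2)] show ?thesis
        unfolding X_def right_diff_distrib distrib_left by (simp only: c)
    qed
    then show ?thesis unfolding sum_eq k_eq[OF order.refl] k_eq[OF le_add1] q_def[symmetric]
      by (simp add: algebra_simps add_divide_distrib diff_divide_distrib)
  qed
  have q: "9/20 \<le> q" "q \<le> 1/2" using lgap_ge[of "real N"] lgap_le_half[of "real N"] N by (auto simp: q_def)
  \<comment> \<open>Boundary and tail give \<open>(1 - q) + (1/2 - q)\<close> over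
    \<open>cmod s\<close>, at most \<open>3/5\<close> because \<open>q \<ge> 9/20\<close>, and
    \<open>3/5 + 1/10 = 7/10\<close> besides. The last summand vanishes as \<open>m\<close>
    grows.\<close>
  have bound: "cmod ((1 - 1 / s) * X m) \<le> real N powr (- Re s) * ((3/5) / cmod s + 7/10) + real (N + m) powr (- Re s) * 2" for m
  proof -
    have "cmod ((1 - 1 / s) * X m) \<le> cmod (h N * ((of_real q - 1) / s + expgap (w N))) + cmod (E m) + cmod (h (N + m) * ((1 - of_real (lgap (real (N + m)))) / s - expgap (w (N + m))))"
      unfolding Xeq by (intro order.trans[OF norm_triangle_ineq] add_right_mono norm_triangle_ineq)
    also have "cmod (h N * ((of_real q - 1) / s + expgap (w N))) \<le> real N powr (- Re s) * ((1 - q) / cmod s + 3/5)"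
    proof -
      have "cmod ((of_real q - 1) / s) = (1 - q) / cmod s"
        using q norm_of_real[of "q - 1", where 'a = complex] by (simp add: norm_divide)
      then show ?thesis
        unfolding norm_mult using N norm_expgap_le[OF wprop[OF order.refl]]
        by (subst norm_h) (auto intro!: mult_left_mono norm_triangle_le)
    qed
    also have "cmod (E m) \<le> real N powr (- Re s) * ((1/2 - q) / cmod s + 1 / 10)" by (rule norm_E)
    also have "cmod (h (N + m) * ((1 - of_real (lgap (real (N + m)))) / s - expgap (w (N + m)))) \<le> real (N + m) powr (- Re s) * 2"
    proof -
      have g: "0 \<le> lgap (real (N + m))" "lgap (real (N + m)) \<le> 1/2"
        using lgap_ge[of "real (N + m)"] lgap_le_half[of "real (N + m)"] N by auto
      have "cmod (1 - of_real (lgap (real (N + m)))) \<le> 1"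
        using g norm_of_real[of "1 - lgap (real (N + m))", where 'a = complex] by simp
      then have "cmod ((1 - of_real (lgap (real (N + m)))) / s) \<le> 1"
        using s0 by (simp add: norm_divide divide_le_eq)
      then have "cmod ((1 - of_real (lgap (real (N + m)))) / s - expgap (w (N + m))) \<le> 2"
        using norm_expgap_le[OF wprop[of "N + m"]] norm_triangle_ineq4[of "(1 - of_real (lgap (real (N + m)))) / s" "expgap (w (N + m))"] by simp
      then show ?thesis unfolding norm_mult using N by (subst norm_h) (auto intro!: mult_left_mono)
    qed
    also have "real N powr (- Re s) * ((1 - q) / cmod s + 3/5) + real N powr (- Re s) * ((1/2 - q) / cmod s + 1 / 10)
      = real N powr (- Re s) * ((3/2 - 2 * q) / cmod s + 7/10)"
      by (simp add: algebra_simps diff_divide_distrib add_divide_distrib)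
    also have "... \<le> real N powr (- Re s) * ((3/5) / cmod s + 7/10)"
      using q by (intro mult_left_mono add_right_mono divide_right_mono) auto
    finally show ?thesis by simp
  qed
  have "cmod ((1 - 1 / s) * Y) \<le> real N powr (- Re s) * ((3/5) / cmod s + 7/10) + 0 * 2"
  proof (rule tendsto_le[OF sequentially_bot])
    show "(\<lambda>m. cmod ((1 - 1 / s) * X m)) \<longlonglongrightarrow> cmod ((1 - 1 / s) * Y)"
      by (intro tendsto_intros limX)
    have "(\<lambda>m. real (m + N) powr (- Re s)) \<longlonglongrightarrow> 0"
      using s by (intro LIMSEQ_ignore_initial_segment[of "\<lambda>m. real m powr (- Re s)"] tendsto_neg_powr filterlim_real_sequentially) auto
    then have "(\<lambda>m. real (N + m) powr (- Re s)) \<longlonglongrightarrow> 0" by (simp add: add.commute)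
    then show "(\<lambda>m. real N powr (- Re s) * ((3/5) / cmod s + 7/10) + real (N + m) powr (- Re s) * 2) \<longlonglongrightarrow> real N powr (- Re s) * ((3/5) / cmod s + 7/10) + 0 * 2"
      by (intro tendsto_intros)
  qed (use bound in auto)
  then have "cmod s * cmod ((1 - 1 / s) * Y) \<le> cmod s * (real N powr (- Re s) * ((3/5) / cmod s + 7/10))"
    by (intro mult_left_mono) auto
  also have "cmod s * cmod ((1 - 1 / s) * Y) = cmod (s - 1) * cmod Y"
  proof -
    have "s * ((1 - 1 / s) * Y) = (s - 1) * Y" using s0 by (simp add: field_simps)
    then show ?thesis by (metis norm_mult)
  qed
  also have "cmod s * (real N powr (- Re s) * ((3/5) / cmod s + 7/10)) = real N powr (- Re s) * (3/5 + 7/10 * cmod s)"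
  proof -
    have "cmod s \<noteq> 0" using s0(1) by simp
    then have "cmod s * ((3/5) / cmod s + 7/10) = 3/5 + 7/10 * cmod s" by (simp add: distrib_left)
    then show ?thesis by (simp only: mult.left_commute[of "cmod s"])
  qed
  \<comment> \<open>Since \<open>cmod s\<close> is at most \<open>10/7\<close> times
    \<open>cmod (s - 1)\<close>, and the latter is at least 1, the constant is
    \<open>3/5 + 1 = 8/5\<close>.\<close>
  also have "... \<le> real N powr (- Re s) * (8/5 * cmod (s - 1))"
  proof (intro mult_left_mono)
    have "(cmod s)\<^sup>2 \<le> (10/7 * cmod (s - 1))\<^sup>2"
    proof -
      have "(Re s)\<^sup>2 \<le> 1" using s by (intro power_le_one) auto
      moreover have "1 \<le> (Im s)\<^sup>2" using s by simp
      moreover have "p + i \<le> 100/49 * (r + i)" if "p \<le> 1" "1 \<le> i" "0 \<le> r" for p i r :: real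
        using that by simp
      ultimately have "(Re s)\<^sup>2 + (Im s)\<^sup>2 \<le> 100/49 * ((Re s - 1)\<^sup>2 + (Im s)\<^sup>2)" using zero_le_power2 by blast
      then show ?thesis unfolding power_mult_distrib cmod_power2 by (simp add: power2_eq_square)
    qed
    then have "cmod s \<le> 10/7 * cmod (s - 1)" by (rule power2_le_imp_le) simp
    then show "3/5 + 7/10 * cmod s \<le> 8/5 * cmod (s - 1)" using s0(4) by simp
  qed auto
  finally have "cmod (s - 1) * cmod Y \<le> cmod (s - 1) * (8/5 * real N powr (- Re s))"
    by (simp add: mult_ac)
  then have "cmod Y \<le> 8/5 * real N powr (- Re s)"
    using s0 by (subst (asm) mult_le_cancel_left_pos) auto
  then show ?thesis unfolding Y_def .
qed

section \<open>Mean squares of Dirichlet polynomials\<close>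

definition csch_gap :: "real \<Rightarrow> real" where
  "csch_gap u = 1 / u - 1 / (2 * sinh (u / 2))"

lemma csch_gap_minus: "csch_gap (- u) = - csch_gap u"
  by (simp add: csch_gap_def)

text \<open>With \<open>x = u / 2\<close> the gap is \<open>(sinh x - x) / (2 * x * sinh x)\<close>,
  and \<open>u / 24\<close> is its first term at 0. That bound amounts to \<open>f \<ge> 0\<close>,
  proved by differentiating twice.\<close>

lemma csch_gap_bounds_pos:
  assumes "0 < u"
  shows "0 \<le> csch_gap u" "csch_gap u \<le> u / 24" "csch_gap u \<le> 1 / u"
proof -
  define x where "x = u / 2"
  have x: "0 < x" "u = 2 * x" using assms by (auto simp: x_def)
  have sx: "0 < sinh x" using x by simp
  have "sinh 0 - 0 \<le> sinh x - x"
    using x cosh_real_ge_1 by (intro DERIV_nonneg_imp_nondecreasing[of 0 x "\<lambda>x. sinh x - x"])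
      (auto intro!: exI derivative_eq_intros)
  then have "x \<le> sinh x" by simp
  then show "0 \<le> csch_gap u" using x by (simp add: csch_gap_def frac_le)
  show "csch_gap u \<le> 1 / u" using x sx by (simp add: csch_gap_def)
  define f where "f = (\<lambda>x::real. x\<^sup>2 * sinh x / 6 - sinh x + x)"
  define f1 where "f1 = (\<lambda>x::real. x * sinh x / 3 + x\<^sup>2 * cosh x / 6 - cosh x + 1)"
  have d1: "(f1 has_real_derivative (2/3 * (y * cosh y - sinh y) + y\<^sup>2 * sinh y / 6)) (at y)" for y
    unfolding f1_def by (auto intro!: derivative_eq_intros simp: field_simps power2_eq_square)
  have d: "(f has_real_derivative f1 y) (at y)" for y
    unfolding f_def f1_def by (auto intro!: derivative_eq_intros simp: field_simps power2_eq_square)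
  have tanh: "0 \<le> y * cosh y - sinh y" if "0 \<le> y" for y :: real
  proof -
    have "(0::real) * cosh 0 - sinh 0 \<le> y * cosh y - sinh y"
    proof (rule DERIV_nonneg_imp_nondecreasing[OF that])
      fix z :: real assume z: "0 \<le> z" "z \<le> y"
      have "((\<lambda>y. y * cosh y - sinh y) has_real_derivative z * sinh z) (at z)"
        by (auto intro!: derivative_eq_intros)
      moreover have "0 \<le> z * sinh z" using z by simp
      ultimately show "\<exists>d. ((\<lambda>y. y * cosh y - sinh y) has_real_derivative d) (at z) \<and> 0 \<le> d" by blast
    qed
    then show ?thesis by simp
  qed
  have f1: "0 \<le> f1 y" if "0 \<le> y" for y
  proof -
    have "f1 0 \<le> f1 y"
    proof (rule DERIV_nonneg_imp_nondecreasing[OF that])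
      fix z :: real assume z: "0 \<le> z" "z \<le> y"
      show "\<exists>d. (f1 has_real_derivative d) (at z) \<and> 0 \<le> d"
        using d1[of z] tanh[of z] z by (intro exI[of _ "2/3 * (z * cosh z - sinh z) + z\<^sup>2 * sinh z / 6"]) auto
    qed
    then show ?thesis by (simp add: f1_def)
  qed
  have "f 0 \<le> f x"
    using x f1 d by (intro DERIV_nonneg_imp_nondecreasing[of 0 x f]) (auto intro!: exI)
  then have "sinh x - x \<le> x\<^sup>2 * sinh x / 6" by (simp add: f_def)
  then have "(sinh x - x) / (2 * x * sinh x) \<le> (x\<^sup>2 * sinh x / 6) / (2 * x * sinh x)"
    using x sx by (intro divide_right_mono) auto
  also have "(sinh x - x) / (2 * x * sinh x) = csch_gap u"
    using x sx by (simp add: csch_gap_def field_simps)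
  also have "(x\<^sup>2 * sinh x / 6) / (2 * x * sinh x) = u / 24"
    using x sx by (simp add: field_simps power2_eq_square)
  finally show "csch_gap u \<le> u / 24" .
qed

lemma csch_gap_bounds:
  assumes "u \<noteq> 0"
  shows "\<bar>csch_gap u\<bar> \<le> \<bar>u\<bar> / 24" "\<bar>csch_gap u\<bar> \<le> 1 / \<bar>u\<bar>"
proof -
  have "\<bar>csch_gap u\<bar> = csch_gap \<bar>u\<bar>"
    using csch_gap_bounds_pos[of "\<bar>u\<bar>"] assms csch_gap_minus[of "- u"] by (cases "u > 0") auto
  then show "\<bar>csch_gap u\<bar> \<le> \<bar>u\<bar> / 24" "\<bar>csch_gap u\<bar> \<le> 1 / \<bar>u\<bar>"
    using csch_gap_bounds_pos[of "\<bar>u\<bar>"] assms by auto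
qed

lemma has_integral_cos_affine:
  fixes k :: int
  assumes "k \<noteq> 0"
  shows "((\<lambda>x. cos (of_int k * x + f)) has_integral 0) {0..2 * pi}"
    and "((\<lambda>x. (pi - x) * cos (of_int k * x + f)) has_integral - (2 * pi * (sin f / of_int k))) {0..2 * pi}"
proof -
  have per: "sin (of_int k * (2 * pi) + f) = sin f" "cos (of_int k * (2 * pi) + f) = cos f"
    using sin_int_2pin[of k] cos_int_2pin[of k] by (simp_all add: sin_add cos_add mult.commute mult.left_commute)
  have "((\<lambda>x. cos (of_int k * x + f)) has_integral sin (of_int k * (2 * pi) + f) / of_int k - sin (of_int k * 0 + f) / of_int k) {0..2 * pi}"
    using assms by (intro fundamental_theorem_of_calculus)
      (auto simp flip: has_real_derivative_iff_has_vector_derivative intro!: derivative_eq_intros)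
  then show "((\<lambda>x. cos (of_int k * x + f)) has_integral 0) {0..2 * pi}" unfolding per by simp
  define G where "G = (\<lambda>x. (pi - x) * (sin (of_int k * x + f) / of_int k) - cos (of_int k * x + f) / (of_int k)\<^sup>2)"
  have "((\<lambda>x. (pi - x) * cos (of_int k * x + f)) has_integral G (2 * pi) - G 0) {0..2 * pi}"
    using assms unfolding G_def by (intro fundamental_theorem_of_calculus)
      (auto simp flip: has_real_derivative_iff_has_vector_derivative intro!: derivative_eq_intros simp: field_simps power2_eq_square)
  moreover have "G (2 * pi) - G 0 = - (2 * pi * (sin f / of_int k))"
    unfolding G_def per by simp
  ultimately show "((\<lambda>x. (pi - x) * cos (of_int k * x + f)) has_integral - (2 * pi * (sin f / of_int k))) {0..2 * pi}" by simp
qed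

lemma norm_trig_poly_squared:
  fixes c f :: "'a \<Rightarrow> real"
  shows "(\<Sum>n\<in>A. c n * cos (f n))\<^sup>2 + (\<Sum>n\<in>A. c n * sin (f n))\<^sup>2 = (\<Sum>m\<in>A. \<Sum>n\<in>A. c m * c n * cos (f n - f m))"
  unfolding power2_eq_square sum_product sum.distrib[symmetric]
  by (intro sum.cong refl) (simp add: cos_diff algebra_simps)

text \<open>Hilbert's inequality: \<open>\<pi> - x\<close> has the Fourier coefficients \<open>1/k\<close>, up to a factor, and is bounded.\<close>

lemma hilbert_inequality:
  fixes c f :: "nat \<Rightarrow> real"
  assumes "finite A"
  shows "(\<Sum>m\<in>A. \<Sum>n\<in>A - {m}. c m * c n * sin (f n - f m) / (real n - real m)) \<le> pi * (\<Sum>n\<in>A. (c n)\<^sup>2)"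
proof -
  \<comment> \<open>The squared modulus of the exponential sum with coefficients \<open>c n\<close>
    and phases \<open>n * x + f n\<close>, hence nonnegative.\<close>
  define B where "B = (\<lambda>x. (\<Sum>n\<in>A. c n * cos (real n * x + f n))\<^sup>2 + (\<Sum>n\<in>A. c n * sin (real n * x + f n))\<^sup>2)"
  have Beq: "B x = (\<Sum>m\<in>A. \<Sum>n\<in>A. c m * c n * cos (of_int (int n - int m) * x + (f n - f m)))" for x
    unfolding B_def norm_trig_poly_squared by (simp add: algebra_simps)
  have split: "(\<Sum>n\<in>A. h n) = h m + (\<Sum>n\<in>A - {m}. h n)" if "m \<in> A" for m and h :: "nat \<Rightarrow> real"
    using that assms by (rule sum.remove[rotated])
  have key1: "((\<lambda>x. cos (of_int (int n - int m) * x + (f n - f m))) has_integral (if n = m then 2 * pi else 0)) {0..2 * pi}" for m n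
    using has_integral_cos_affine(1)[of "int n - int m"] has_integral_const_real[of "1::real" 0 "2 * pi"] by (cases "n = m") auto
  have "((\<lambda>x. (\<Sum>m\<in>A. \<Sum>n\<in>A. c m * c n * cos (of_int (int n - int m) * x + (f n - f m)))) has_integral
      (\<Sum>m\<in>A. \<Sum>n\<in>A. c m * c n * (if n = m then 2 * pi else 0))) {0..2 * pi}"
    by (intro has_integral_sum assms has_integral_mult_right key1)
  also have "(\<Sum>m\<in>A. \<Sum>n\<in>A. c m * c n * (if n = m then 2 * pi else 0)) = 2 * pi * (\<Sum>n\<in>A. (c n)\<^sup>2)"
    using assms by (simp add: sum_distrib_left if_distrib[of "\<lambda>x. _ * x"] sum.delta power2_eq_square mult_ac cong: if_cong)
  finally have I1: "(B has_integral 2 * pi * (\<Sum>n\<in>A. (c n)\<^sup>2)) {0..2 * pi}"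
    unfolding Beq .
  have key2: "((\<lambda>x. (pi - x) * cos (of_int (int n - int m) * x + (f n - f m))) has_integral (if n = m then 0 else - (2 * pi * (sin (f n - f m) / of_int (int n - int m))))) {0..2 * pi}" for m n
  proof -
    have "((\<lambda>x. pi - x) has_integral (pi * (2 * pi) - (2 * pi)\<^sup>2 / 2) - (pi * 0 - 0\<^sup>2 / 2)) {0..2 * pi}"
      by (intro fundamental_theorem_of_calculus)
        (auto simp flip: has_real_derivative_iff_has_vector_derivative intro!: derivative_eq_intros)
    then have "((\<lambda>x. pi - x) has_integral 0) {0..2 * pi}" by (simp add: power2_eq_square)
    then show ?thesis
      using has_integral_cos_affine(2)[of "int n - int m"] by (cases "n = m") auto
  qed
  have "((\<lambda>x. (\<Sum>m\<in>A. \<Sum>n\<in>A. c m * c n * ((pi - x) * cos (of_int (int n - int m) * x + (f n - f m))))) has_integral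
      (\<Sum>m\<in>A. \<Sum>n\<in>A. c m * c n * (if n = m then 0 else - (2 * pi * (sin (f n - f m) / of_int (int n - int m)))))) {0..2 * pi}"
    by (intro has_integral_sum assms has_integral_mult_right key2)
  also have "(\<lambda>x. (\<Sum>m\<in>A. \<Sum>n\<in>A. c m * c n * ((pi - x) * cos (of_int (int n - int m) * x + (f n - f m))))) = (\<lambda>x. (pi - x) * B x)"
    unfolding Beq by (simp add: sum_distrib_left mult_ac)
  also have "(\<Sum>m\<in>A. \<Sum>n\<in>A. c m * c n * (if n = m then 0 else - (2 * pi * (sin (f n - f m) / of_int (int n - int m)))))
      = - (2 * pi) * (\<Sum>m\<in>A. \<Sum>n\<in>A - {m}. c m * c n * sin (f n - f m) / (real n - real m))" (is "_ = - (2 * pi) * ?H")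
    unfolding sum_distrib_left
  proof (rule sum.cong[OF refl])
    fix m assume "m \<in> A"
    show "(\<Sum>n\<in>A. c m * c n * (if n = m then 0 else - (2 * pi * (sin (f n - f m) / of_int (int n - int m)))))
      = (\<Sum>n\<in>A - {m}. - (2 * pi) * (c m * c n * sin (f n - f m) / (real n - real m)))"
      unfolding split[OF \<open>m \<in> A\<close>] by (auto intro!: sum.cong)
  qed
  finally have I2: "((\<lambda>x. - ((pi - x) * B x)) has_integral - (- (2 * pi) * ?H)) {0..2 * pi}"
    by (rule has_integral_neg)
  \<comment> \<open>On the period \<open>pi - x\<close> is at least \<open>- pi\<close>, and its
    mean is 0, so the diagonal has dropped out on the left.\<close>
  have "- (- (2 * pi) * ?H) \<le> pi * (2 * pi * (\<Sum>n\<in>A. (c n)\<^sup>2))"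
  proof (rule has_integral_le[OF I2 has_integral_mult_right[OF I1, of pi]])
    fix x assume "x \<in> {0..2 * pi}"
    moreover have "0 \<le> B x" by (simp add: B_def)
    ultimately have "0 \<le> (2 * pi - x) * B x" by (intro mult_nonneg_nonneg) auto
    then show "- ((pi - x) * B x) \<le> pi * B x" by (simp add: algebra_simps)
  qed
  then show ?thesis by simp
qed

text \<open>Two integrations by parts, the second with the nonnegative primitive
  \<open>1 - cos\<close>. As \<open>a\<close> lies in \<open>[0, 1]\<close>, the new integrand and
  the second boundary term at \<open>T\<close> have the favourable sign. The end \<open>e\<close>
  costs \<open>e powr (1 + a)\<close> and half of it, uniformly in \<open>l\<close>.\<close>

lemma integral_powr_cos_le:
  fixes a l e T :: real
  assumes a: "0 \<le> a" "a \<le> 1" and e: "0 < e" "e \<le> T" and l: "l \<noteq> 0"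
  shows "integral {e..T} (\<lambda>t. t powr a * cos (l * t)) \<le> T powr a * (sin (l * T) / l) + 3/2 * e powr (1 + a)"
proof -
  define G where "G = (\<lambda>t. t powr a * (sin (l * t) / l) - a * t powr (a - 1) * ((1 - cos (l * t)) / l\<^sup>2))"
  define G' where "G' = (\<lambda>t. t powr a * cos (l * t) + a * (1 - a) * t powr (a - 2) * ((1 - cos (l * t)) / l\<^sup>2))"
  have "(G' has_integral G T - G e) {e..T}"
  proof (rule fundamental_theorem_of_calculus[OF e(2)])
    fix t assume "t \<in> {e..T}"
    then have t: "t > 0" using e by simp
    have A: "((\<lambda>t. t powr a) has_real_derivative a * t powr (a - 1)) (at t)"
      "((\<lambda>t. t powr (a - 1)) has_real_derivative (a - 1) * t powr (a - 2)) (at t)"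
      using t by (auto intro!: derivative_eq_intros simp: algebra_simps)
    have "(G has_real_derivative (a * t powr (a - 1)) * (sin (l * t) / l) + t powr a * cos (l * t)
       - (a * ((a - 1) * t powr (a - 2)) * ((1 - cos (l * t)) / l\<^sup>2) + a * t powr (a - 1) * (sin (l * t) / l))) (at t)"
    proof -
      have "((\<lambda>t. sin (l * t) / l) has_real_derivative cos (l * t)) (at t)"
        "((\<lambda>t. (1 - cos (l * t)) / l\<^sup>2) has_real_derivative sin (l * t) / l) (at t)"
        using l by (auto intro!: derivative_eq_intros simp: power2_eq_square)
      from DERIV_diff[OF DERIV_mult'[OF A(1) this(1)] DERIV_mult'[OF DERIV_cmult[OF A(2), of a] this(2)]]
      show ?thesis unfolding G_def by (rule DERIV_cong) (simp add: algebra_simps)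
    qed
    then have "(G has_real_derivative G' t) (at t)" by (simp add: G'_def algebra_simps)
    then show "(G has_vector_derivative G' t) (at t within {e..T})"
      by (simp add: has_real_derivative_iff_has_vector_derivative has_vector_derivative_at_within)
  qed
  moreover have "(\<lambda>t. t powr a * cos (l * t)) integrable_on {e..T}"
    using e by (intro integrable_continuous_interval continuous_intros) auto
  ultimately have A: "integral {e..T} (\<lambda>t. t powr a * cos (l * t)) \<le> G T - G e"
  proof (intro has_integral_le[OF integrable_integral])
    fix t assume "t \<in> {e..T}"
    show "t powr a * cos (l * t) \<le> G' t" using a by (auto simp: G'_def)
  qed
  have B: "G T \<le> T powr a * (sin (l * T) / l)" using a by (auto simp: G_def)
  have C: "- G e \<le> 3/2 * e powr (1 + a)"
  proof -
    have "\<bar>sin (l * e) / l\<bar> \<le> e"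
      using abs_sin_x_le_abs_x[of "l * e"] l e by (simp add: abs_mult divide_le_eq mult.commute)
    then have "- (sin (l * e) / l) \<le> e" by linarith
    then have 1: "e powr a * - (sin (l * e) / l) \<le> e powr a * e" by (intro mult_left_mono) auto
    have "1 - cos (l * e) \<le> (l * e)\<^sup>2 / 2" 
    proof -
      have "\<bar>sin (l * e / 2)\<bar>\<^sup>2 \<le> \<bar>l * e / 2\<bar>\<^sup>2" by (intro power_mono abs_sin_x_le_abs_x) auto
      then show ?thesis using cos_double_sin[of "l * e / 2"] by (simp add: power_divide)
    qed
    then have "(1 - cos (l * e)) / l\<^sup>2 \<le> e\<^sup>2 / 2" using l by (simp add: divide_le_eq power_mult_distrib mult.commute)
    then have 2: "a * e powr (a - 1) * ((1 - cos (l * e)) / l\<^sup>2) \<le> 1 * e powr (a - 1) * (e\<^sup>2 / 2)"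
      using a by (intro mult_mono) auto
    have "e powr (a - 1) * e\<^sup>2 = e powr (1 + a)" "e powr a * e = e powr (1 + a)"
      using e powr_add[of e "a - 1" 2] powr_add[of e a 1] by (simp_all add: add.commute)
    moreover have "- G e = e powr a * - (sin (l * e) / l) + a * e powr (a - 1) * ((1 - cos (l * e)) / l\<^sup>2)"
      by (simp add: G_def)
    ultimately show ?thesis using 1 2 by linarith
  qed
  from A B C show ?thesis by linarith
qed


lemma inverse_two_sinh_half_ln:
  fixes m n :: nat
  assumes "0 < m" "0 < n" "m \<noteq> n"
  shows "1 / (2 * sinh ((ln (real n) - ln (real m)) / 2)) = sqrt (real m) * sqrt (real n) / (real n - real m)"
proof -
  define x y where "x = sqrt (real m)" and "y = sqrt (real n)"
  have xy: "0 < x" "0 < y" "x * x = real m" "y * y = real n" "x \<noteq> y" using assms by (auto simp: x_def y_def)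
  have "ln (real n) / 2 = ln y" "ln (real m) / 2 = ln x"
    using assms by (simp_all add: x_def y_def ln_sqrt)
  then have "sinh ((ln (real n) - ln (real m)) / 2) = (y / x - x / y) / 2"
    using xy by (simp add: diff_divide_distrib sinh_def exp_diff exp_minus)
  also have "... = (y * y - x * x) / (2 * (x * y))" using xy by (simp add: field_simps)
  also have "y * y - x * x = real n - real m" using xy by simp
  finally have e: "sinh ((ln (real n) - ln (real m)) / 2) = (real n - real m) / (2 * (x * y))" .
  have "2 * (p / (2 * q)) = p / q" for p q :: real by simp
  then have "2 * sinh ((ln (real n) - ln (real m)) / 2) = (real n - real m) / (x * y)" unfolding e .
  then show ?thesis by (simp add: x_def y_def)
qed

section \<open>Diagonal and off-diagonal part of the mean square\<close>

definition dpoly_sq :: "real \<Rightarrow> nat \<Rightarrow> real \<Rightarrow> real" where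
  "dpoly_sq \<sigma> M t = (cmod (\<Sum>n=1..M. of_nat n powr (- Complex \<sigma> t)))\<^sup>2"

definition powsum :: "real \<Rightarrow> nat \<Rightarrow> real" where
  "powsum p M = (\<Sum>n=1..M. real n powr p)"

lemma dpoly_sq_eq:
  "dpoly_sq \<sigma> M t = (\<Sum>m=1..M. \<Sum>n=1..M. real m powr (-\<sigma>) * real n powr (-\<sigma>) * cos ((ln (real n) - ln (real m)) * t))"
proof -
  have h: "of_nat n powr (- Complex \<sigma> t) = Complex (real n powr (-\<sigma>) * cos (t * ln (real n))) (- (real n powr (-\<sigma>) * sin (t * ln (real n))))" if "n \<in> {1..M}" for n
  proof -
    have "of_nat n powr (- Complex \<sigma> t) = exp (Complex (-\<sigma> * ln (real n)) (- (t * ln (real n))))"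
    proof -
      have "- Complex \<sigma> t * of_real (ln (real n)) = Complex (-\<sigma> * ln (real n)) (- (t * ln (real n)))"
        by (simp add: complex_eq_iff)
      moreover have "of_nat n powr (- Complex \<sigma> t) = exp (- Complex \<sigma> t * of_real (ln (real n)))"
        using that by (simp add: powr_def Ln_of_nat)
      ultimately show ?thesis by simp
    qed
    then show ?thesis using that by (simp add: exp_eq_polar cis.ctr powr_def complex_eq_iff)
  qed
  have "(\<Sum>n=1..M. of_nat n powr (- Complex \<sigma> t)) = (\<Sum>n=1..M. Complex (real n powr (-\<sigma>) * cos (t * ln (real n))) (- (real n powr (-\<sigma>) * sin (t * ln (real n)))))"
    by (rule sum.cong[OF refl h])
  then have "dpoly_sq \<sigma> M t = (\<Sum>n=1..M. real n powr (-\<sigma>) * cos (t * ln (real n)))\<^sup>2 + (\<Sum>n=1..M. real n powr (-\<sigma>) * sin (t * ln (real n)))\<^sup>2"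
    unfolding dpoly_sq_def by (simp add: cmod_power2 Re_sum Im_sum sum_negf)
  then show ?thesis unfolding norm_trig_poly_squared by (simp add: algebra_simps)
qed

lemma continuous_on_dpoly_sq: "continuous_on A (dpoly_sq \<sigma> M)"
  unfolding dpoly_sq_eq[abs_def] by (intro continuous_intros)

text \<open>The kernel is a parameter: the sum is linear and monotone in \<open>F\<close>, so
  estimates can be made on kernels alone.\<close>

definition offdiag :: "real \<Rightarrow> nat \<Rightarrow> (real \<Rightarrow> real) \<Rightarrow> real" where
  "offdiag \<sigma> M F = (\<Sum>m=1..M. \<Sum>n\<in>{1..M}-{m}. real m powr (-\<sigma>) * real n powr (-\<sigma>) * F (ln (real n) - ln (real m)))"

lemma offdiag_mono:
  assumes "\<And>u. u \<noteq> 0 \<Longrightarrow> F u \<le> G u"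
  shows "offdiag \<sigma> M F \<le> offdiag \<sigma> M G"
  unfolding offdiag_def by (intro sum_mono mult_left_mono assms) auto

lemma offdiag_add: "offdiag \<sigma> M (\<lambda>u. F u + G u) = offdiag \<sigma> M F + offdiag \<sigma> M G"
  by (simp add: offdiag_def distrib_left sum.distrib)

lemma offdiag_cmult: "offdiag \<sigma> M (\<lambda>u. c * F u) = c * offdiag \<sigma> M F"
  by (simp add: offdiag_def sum_distrib_left mult_ac)

lemma offdiag_const_le:
  assumes "0 \<le> c"
  shows "offdiag \<sigma> M (\<lambda>u. c) \<le> c * (powsum (-\<sigma>) M)\<^sup>2"
proof -
  have "offdiag \<sigma> M (\<lambda>u. c) \<le> (\<Sum>m=1..M. \<Sum>n=1..M. real m powr (-\<sigma>) * real n powr (-\<sigma>) * c)"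
    unfolding offdiag_def using assms by (intro sum_mono sum_mono2) auto
  also have "... = c * (powsum (-\<sigma>) M)\<^sup>2"
    by (simp add: powsum_def power2_eq_square sum_product sum_distrib_left mult_ac)
  finally show ?thesis .
qed

lemma offdiag_integral_le:
  assumes int: "\<And>u. F u integrable_on {a..b}" and le: "\<And>u. u \<noteq> 0 \<Longrightarrow> integral {a..b} (F u) \<le> G u"
  shows "(\<lambda>t. offdiag \<sigma> M (\<lambda>u. F u t)) integrable_on {a..b}"
    and "integral {a..b} (\<lambda>t. offdiag \<sigma> M (\<lambda>u. F u t)) \<le> offdiag \<sigma> M G"
proof -
  have "((\<lambda>t. offdiag \<sigma> M (\<lambda>u. F u t)) has_integral offdiag \<sigma> M (\<lambda>u. integral {a..b} (F u))) {a..b}"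
    unfolding offdiag_def by (intro has_integral_sum has_integral_mult_right integrable_integral int) auto
  then show "(\<lambda>t. offdiag \<sigma> M (\<lambda>u. F u t)) integrable_on {a..b}"
    "integral {a..b} (\<lambda>t. offdiag \<sigma> M (\<lambda>u. F u t)) \<le> offdiag \<sigma> M G"
    using offdiag_mono[where \<sigma> = \<sigma> and M = M, OF le] by (auto simp: has_integral_iff)
qed

lemma dpoly_sq_eq_offdiag:
  "dpoly_sq \<sigma> M t = powsum (-2 * \<sigma>) M + offdiag \<sigma> M (\<lambda>u. cos (u * t))"
proof -
  have "(\<Sum>n=1..M. real m powr (-\<sigma>) * real n powr (-\<sigma>) * cos ((ln (real n) - ln (real m)) * t))
     = real m powr (-2 * \<sigma>) + (\<Sum>n\<in>{1..M}-{m}. real m powr (-\<sigma>) * real n powr (-\<sigma>) * cos ((ln (real n) - ln (real m)) * t))" if "m \<in> {1..M}" for m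
    using that by (subst sum.remove[of _ m]) (auto simp flip: powr_add)
  then show ?thesis
    unfolding dpoly_sq_eq powsum_def offdiag_def sum.distrib[symmetric] by (intro sum.cong refl)
qed

lemma offdiag_sin_le:
  "offdiag \<sigma> M (\<lambda>u. sin (u * T) / u) \<le> pi * powsum (1 - 2 * \<sigma>) M + offdiag \<sigma> M (\<lambda>u. csch_gap u * sin (u * T))"
proof -
  \<comment> \<open>The factor \<open>sqrt m * sqrt n\<close> of the hyperbolic kernel goes into the
    coefficients, which is why Hilbert's inequality yields the exponent
    \<open>1 - 2 * \<sigma>\<close>.\<close>
  define c where "c = (\<lambda>n. sqrt (real n) * real n powr (-\<sigma>))"
  define f where "f = (\<lambda>n. ln (real n) * T)"
  have "offdiag \<sigma> M (\<lambda>u. sin (u * T) / u) = (\<Sum>m=1..M. \<Sum>n\<in>{1..M}-{m}. c m * c n * sin (f n - f m) / (real n - real m)) + offdiag \<sigma> M (\<lambda>u. csch_gap u * sin (u * T))"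
    unfolding offdiag_def sum.distrib[symmetric]
  proof (intro sum.cong refl)
    fix m n assume "m \<in> {1..M}" "n \<in> {1..M} - {m}"
    then have mn: "0 < m" "0 < n" "m \<noteq> n" by auto
    define u where "u = ln (real n) - ln (real m)"
    have "sin (u * T) / u = (1 / (2 * sinh (u / 2))) * sin (u * T) + csch_gap u * sin (u * T)"
      by (simp add: csch_gap_def algebra_simps)
    also have "1 / (2 * sinh (u / 2)) = sqrt (real m) * sqrt (real n) / (real n - real m)"
      unfolding u_def by (rule inverse_two_sinh_half_ln[OF mn])
    finally have "real m powr (-\<sigma>) * real n powr (-\<sigma>) * (sin (u * T) / u) = c m * c n * sin (f n - f m) / (real n - real m) + real m powr (-\<sigma>) * real n powr (-\<sigma>) * (csch_gap u * sin (u * T))"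
      by (simp add: c_def f_def u_def algebra_simps)
    then show "real m powr (-\<sigma>) * real n powr (-\<sigma>) * (sin ((ln (real n) - ln (real m)) * T) / (ln (real n) - ln (real m))) = c m * c n * sin (f n - f m) / (real n - real m) + real m powr (-\<sigma>) * real n powr (-\<sigma>) * (csch_gap (ln (real n) - ln (real m)) * sin ((ln (real n) - ln (real m)) * T))"
      by (simp only: u_def)
  qed
  also have "(\<Sum>m=1..M. \<Sum>n\<in>{1..M}-{m}. c m * c n * sin (f n - f m) / (real n - real m)) \<le> pi * (\<Sum>n=1..M. (c n)\<^sup>2)"
    by (rule hilbert_inequality) simp
  also have "(\<Sum>n=1..M. (c n)\<^sup>2) = powsum (1 - 2 * \<sigma>) M"
    unfolding powsum_def
  proof (rule sum.cong[OF refl])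
    fix n assume "n \<in> {1..M}"
    then have "(c n)\<^sup>2 = real n powr 1 * (real n powr (-\<sigma>) * real n powr (-\<sigma>))"
      by (simp add: c_def power_mult_distrib power2_eq_square)
    also have "... = real n powr (1 + (-\<sigma> + -\<sigma>))" by (simp only: powr_add)
    finally show "(c n)\<^sup>2 = real n powr (1 - 2 * \<sigma>)" by simp
  qed
  finally show ?thesis by simp
qed

lemma weighted_mean_square_le:
  fixes a T \<sigma> :: real
  assumes a: "0 \<le> a" "a \<le> 1" and T: "1 \<le> T"
  shows "integral {1..T} (\<lambda>t. t powr a * dpoly_sq \<sigma> M t) \<le>
    T powr (1 + a) / (1 + a) * powsum (-2 * \<sigma>) M + T powr a * (pi * powsum (1 - 2 * \<sigma>) M)
     + T powr a * offdiag \<sigma> M (\<lambda>u. csch_gap u * sin (u * T)) + (powsum (-\<sigma>) M)\<^sup>2 * (3 / 80)"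
proof -
  \<comment> \<open>Integrating from \<open>e\<close> instead of \<open>1\<close> makes the boundary terms at the lower end small.\<close>
  define e :: real where "e = 1 / 40"
  have e: "0 < e" "e \<le> T" "e \<le> 1" using T by (auto simp: e_def)
  have int: "(\<lambda>t. t powr a * dpoly_sq \<sigma> M t) integrable_on {b..T}" if "0 < b" for b
    using that by (intro integrable_continuous_interval continuous_intros continuous_on_dpoly_sq) auto
  have int_cos: "(\<lambda>t. t powr a * cos (u * t)) integrable_on {e..T}" for u
    using e by (intro integrable_continuous_interval continuous_intros) auto
  have int_powr: "((\<lambda>t. t powr a) has_integral (T powr (1 + a) - e powr (1 + a)) / (1 + a)) {e..T}"
  proof -
    have "((\<lambda>t. t powr a) has_integral T powr (1 + a) / (1 + a) - e powr (1 + a) / (1 + a)) {e..T}"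
      using e a by (intro fundamental_theorem_of_calculus)
        (auto simp flip: has_real_derivative_iff_has_vector_derivative intro!: derivative_eq_intros)
    then show ?thesis by (simp add: diff_divide_distrib)
  qed
  have "integral {1..T} (\<lambda>t. t powr a * dpoly_sq \<sigma> M t) \<le> integral {e..T} (\<lambda>t. t powr a * dpoly_sq \<sigma> M t)"
    using e by (intro integral_subset_le int) (auto simp: dpoly_sq_def)
  also have E: "(\<lambda>t. t powr a * dpoly_sq \<sigma> M t) = (\<lambda>t. powsum (-2 * \<sigma>) M * t powr a + offdiag \<sigma> M (\<lambda>u. t powr a * cos (u * t)))"
    by (simp add: dpoly_sq_eq_offdiag offdiag_cmult algebra_simps)
  also have "integral {e..T} (\<lambda>t. powsum (-2 * \<sigma>) M * t powr a + offdiag \<sigma> M (\<lambda>u. t powr a * cos (u * t)))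
     = powsum (-2 * \<sigma>) M * ((T powr (1 + a) - e powr (1 + a)) / (1 + a)) + integral {e..T} (\<lambda>t. offdiag \<sigma> M (\<lambda>u. t powr a * cos (u * t)))"
    using has_integral_mult_right[OF int_powr, of "powsum (-2 * \<sigma>) M"] offdiag_integral_le(1)[of "\<lambda>u t. t powr a * cos (u * t)", OF int_cos order.refl]
    by (subst integral_add) (auto simp: has_integral_iff)
  also have "integral {e..T} (\<lambda>t. offdiag \<sigma> M (\<lambda>u. t powr a * cos (u * t))) \<le> offdiag \<sigma> M (\<lambda>u. T powr a * (sin (u * T) / u) + 3/2 * e powr (1 + a))"
    by (intro offdiag_integral_le int_cos integral_powr_cos_le a e)
  also have "... = T powr a * offdiag \<sigma> M (\<lambda>u. sin (u * T) / u) + offdiag \<sigma> M (\<lambda>u. 3/2 * e powr (1 + a))"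
    unfolding offdiag_add offdiag_cmult[of \<sigma> M "T powr a" "\<lambda>u. sin (u * T) / u"] ..
  finally have A: "integral {1..T} (\<lambda>t. t powr a * dpoly_sq \<sigma> M t) \<le>
      powsum (-2 * \<sigma>) M * ((T powr (1 + a) - e powr (1 + a)) / (1 + a)) +
      (T powr a * offdiag \<sigma> M (\<lambda>u. sin (u * T) / u) + offdiag \<sigma> M (\<lambda>u. 3/2 * e powr (1 + a)))"
    unfolding E by simp
  have "offdiag \<sigma> M (\<lambda>u. 3/2 * e powr (1 + a)) \<le> 3/2 * e powr (1 + a) * (powsum (-\<sigma>) M)\<^sup>2"
    by (rule offdiag_const_le) simp
  \<comment> \<open>As \<open>e \<le> 1\<close>, the exponent may be lowered to 1; then
    \<open>3/2 * 1/40 = 3/80\<close>.\<close>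
  also have "... \<le> 3/2 * e powr 1 * (powsum (-\<sigma>) M)\<^sup>2"
    using e a by (intro mult_right_mono mult_left_mono powr_mono') auto
  finally have B: "offdiag \<sigma> M (\<lambda>u. 3/2 * e powr (1 + a)) \<le> (powsum (-\<sigma>) M)\<^sup>2 * (3 / 80)"
    by (simp add: e_def)
  have C: "T powr a * offdiag \<sigma> M (\<lambda>u. sin (u * T) / u) \<le> T powr a * (pi * powsum (1 - 2 * \<sigma>) M + offdiag \<sigma> M (\<lambda>u. csch_gap u * sin (u * T)))"
    by (intro mult_left_mono offdiag_sin_le) auto
  have "powsum (-2 * \<sigma>) M * ((T powr (1 + a) - e powr (1 + a)) / (1 + a)) \<le> powsum (-2 * \<sigma>) M * (T powr (1 + a) / (1 + a))"
    using a by (intro mult_left_mono divide_right_mono) (auto simp: powsum_def intro!: sum_nonneg)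
  with A B C show ?thesis by (simp add: algebra_simps)
qed

text \<open>The gap kernel is at most \<open>5/24\<close> up to distance 5 and at most
  \<open>1/5\<close> beyond, so \<open>17/80\<close> covers both; the \<open>3/80\<close> from the
  lower end point completes \<open>1/4\<close>.\<close>

lemma weighted_mean_square_le_quarter:
  fixes a T \<sigma> :: real
  assumes a: "0 \<le> a" "a \<le> 1" and T: "1 \<le> T"
  shows "integral {1..T} (\<lambda>t. t powr a * dpoly_sq \<sigma> M t) \<le>
    T powr (1 + a) / (1 + a) * powsum (-2 * \<sigma>) M + T powr a * (pi * powsum (1 - 2 * \<sigma>) M + (powsum (-\<sigma>) M)\<^sup>2 / 4)"
proof -
  have "offdiag \<sigma> M (\<lambda>u. csch_gap u * sin (u * T)) \<le> offdiag \<sigma> M (\<lambda>u. 17/80)"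
  proof (rule offdiag_mono)
    fix u :: real assume u: "u \<noteq> 0"
    have "\<bar>csch_gap u\<bar> \<le> 17/80"
    proof (cases "\<bar>u\<bar> \<le> 5")
      case True then show ?thesis using csch_gap_bounds(1)[OF u] by linarith
    next
      case False
      then have "1 / \<bar>u\<bar> \<le> 1 / 5" by (intro divide_left_mono) auto
      then show ?thesis using csch_gap_bounds(2)[OF u] by linarith
    qed
    then have "\<bar>csch_gap u * sin (u * T)\<bar> \<le> 17/80 * 1"
      unfolding abs_mult by (intro mult_mono) auto
    then show "csch_gap u * sin (u * T) \<le> 17/80" by linarith
  qed
  also have "... \<le> 17/80 * (powsum (-\<sigma>) M)\<^sup>2" by (rule offdiag_const_le) simp
  finally have "T powr a * offdiag \<sigma> M (\<lambda>u. csch_gap u * sin (u * T)) \<le> T powr a * (17/80 * (powsum (-\<sigma>) M)\<^sup>2)"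
    by (intro mult_left_mono) auto
  moreover have "(powsum (-\<sigma>) M)\<^sup>2 * (3/80) \<le> T powr a * ((powsum (-\<sigma>) M)\<^sup>2 * (3/80))"
    using mult_right_mono[of 1 "T powr a" "(powsum (-\<sigma>) M)\<^sup>2 * (3/80)"] ge_one_powr_ge_zero[OF T a(1)] by simp
  ultimately show ?thesis
    using weighted_mean_square_le[OF assms, of \<sigma> M] by (simp add: algebra_simps)
qed


text \<open>The second bound comes from integration by parts; its factor
  \<open>1 / \<bar>u\<bar>\<close> and the decay of the gap kernel combine to an inverse
  square.\<close>

lemma abs_integral_mult_sin_le:
  fixes T u :: real
  assumes T: "0 \<le> T" and u: "u \<noteq> 0"
  shows "\<bar>integral {T..T + 1} (\<lambda>v. v * sin (u * v))\<bar> \<le> T + 1"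
    and "\<bar>integral {T..T + 1} (\<lambda>v. v * sin (u * v))\<bar> \<le> 2 * (T + 1) / \<bar>u\<bar>"
proof -
  have int: "(\<lambda>v. v * sin (u * v)) integrable_on {T..T + 1}"
    by (intro integrable_continuous_interval continuous_intros)
  have "norm (integral {T..T + 1} (\<lambda>v. v * sin (u * v))) \<le> integral {T..T + 1} (\<lambda>v. T + 1)"
  proof (rule integral_norm_bound_integral[OF int])
    fix v assume v: "v \<in> {T..T + 1}"
    have "\<bar>v\<bar> * \<bar>sin (u * v)\<bar> \<le> (T + 1) * 1"
      using v T by (intro mult_mono) auto
    then show "norm (v * sin (u * v)) \<le> T + 1" by (simp add: abs_mult)
  qed auto
  then show "\<bar>integral {T..T + 1} (\<lambda>v. v * sin (u * v))\<bar> \<le> T + 1" by simp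
  define G where "G = (\<lambda>v. sin (u * v) / u\<^sup>2 - v * cos (u * v) / u)"
  have "((\<lambda>v. v * sin (u * v)) has_integral G (T + 1) - G T) {T..T + 1}"
  proof (rule fundamental_theorem_of_calculus)
    fix v
    have "((\<lambda>v. sin (u * v)) has_real_derivative cos (u * v) * u) (at v)"
      "((\<lambda>v. v * cos (u * v)) has_real_derivative 1 * cos (u * v) - v * (sin (u * v) * u)) (at v)"
      by (auto intro!: derivative_eq_intros)
    from DERIV_diff[OF DERIV_cdivide[OF this(1), of "u\<^sup>2"] DERIV_cdivide[OF this(2), of u]]
    have "(G has_real_derivative cos (u * v) * u / u\<^sup>2 - (1 * cos (u * v) - v * (sin (u * v) * u)) / u) (at v)"
      unfolding G_def .
    moreover have "cos (u * v) * u / u\<^sup>2 - (1 * cos (u * v) - v * (sin (u * v) * u)) / u = v * sin (u * v)"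
      using u by (simp add: power2_eq_square diff_divide_distrib)
    ultimately show "(G has_vector_derivative v * sin (u * v)) (at v within {T..T + 1})"
      by (simp add: has_real_derivative_iff_has_vector_derivative has_vector_derivative_at_within)
  qed simp
  then have eq: "integral {T..T + 1} (\<lambda>v. v * sin (u * v)) = (sin (u * (T + 1)) - sin (u * T)) / u\<^sup>2 - (T + 1) * cos (u * (T + 1)) / u + T * cos (u * T) / u"
    by (simp add: has_integral_iff G_def diff_divide_distrib)
  have "\<bar>(sin (u * (T + 1)) - sin (u * T)) / u\<^sup>2\<bar> \<le> 1 / \<bar>u\<bar>"
  proof -
    have "\<bar>sin (u * (T + 1)) - sin (u * T)\<bar> \<le> \<bar>u * (T + 1) - u * T\<bar>"
    proof -
      have "\<bar>sin x - sin y\<bar> \<le> \<bar>x - y\<bar>" for x y :: real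
      proof -
        have "\<bar>sin x - sin y\<bar> = 2 * \<bar>sin ((x - y) / 2)\<bar> * \<bar>cos ((x + y) / 2)\<bar>"
          by (simp add: sin_diff_sin abs_mult)
        also have "... \<le> 2 * \<bar>(x - y) / 2\<bar> * 1"
          by (intro mult_mono abs_sin_x_le_abs_x mult_nonneg_nonneg) auto
        finally show ?thesis by simp
      qed
      then show ?thesis .
    qed
    then have "\<bar>sin (u * (T + 1)) - sin (u * T)\<bar> \<le> \<bar>u\<bar>" by (simp add: algebra_simps)
    then have "\<bar>sin (u * (T + 1)) - sin (u * T)\<bar> / u\<^sup>2 \<le> \<bar>u\<bar> / u\<^sup>2" by (intro divide_right_mono) auto
    also have "\<bar>u\<bar> / u\<^sup>2 = 1 / \<bar>u\<bar>" using u by (simp add: power2_eq_square abs_if)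
    finally show ?thesis by (simp add: abs_divide)
  qed
  moreover have "\<bar>(T + 1) * cos (u * (T + 1)) / u\<bar> \<le> (T + 1) / \<bar>u\<bar>"
    using T by (simp add: abs_mult abs_divide divide_right_mono mult_left_le)
  moreover have "\<bar>T * cos (u * T) / u\<bar> \<le> T / \<bar>u\<bar>"
    using T by (simp add: abs_mult abs_divide divide_right_mono mult_left_le)
  moreover have "2 * (T + 1) / \<bar>u\<bar> = 1 / \<bar>u\<bar> + (T + 1) / \<bar>u\<bar> + T / \<bar>u\<bar>"
    by (simp add: add_divide_distrib)
  ultimately show "\<bar>integral {T..T + 1} (\<lambda>v. v * sin (u * v))\<bar> \<le> 2 * (T + 1) / \<bar>u\<bar>"
    unfolding eq by linarith
qed

text \<open>A discrete form of the integral of \<open>1 / (x * (1 + ln (x / m))\<^sup>2)\<close>: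
  since \<open>1 / (n + 1) \<le> b - a\<close>, each new term is at most
  \<open>1 / a - 1 / b\<close>, and these telescope.\<close>

lemma sum_inverse_log_squared_le:
  assumes "0 < m" "m \<le> M"
  shows "(\<Sum>n\<in>{m<..M}. 1 / real n * (1 / (1 + (ln (real n) - ln (real m)))\<^sup>2)) \<le> 1 - 1 / (1 + (ln (real M) - ln (real m)))"
  using assms(2)
proof (induction M rule: dec_induct)
  case (step n)
  define a b where "a = 1 + (ln (real n) - ln (real m))" and "b = 1 + (ln (real (Suc n)) - ln (real m))"
  have a: "1 \<le> a" using step assms by (simp add: a_def)
  have n: "0 < n" using step assms by simp
  have "ln (real n / real (Suc n)) \<le> real n / real (Suc n) - 1"
    using n by (intro ln_le_minus_one) auto
  also have "real n / real (Suc n) - 1 = - (1 / real (Suc n))" by (simp add: field_simps)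
  also have "ln (real n / real (Suc n)) = a - b"
    using n by (simp add: a_def b_def ln_div)
  finally have ba: "1 / real (Suc n) \<le> b - a" by simp
  moreover have "0 < 1 / real (Suc n)" by simp
  ultimately have "a \<le> b" by linarith
  have "1 / real (Suc n) * (1 / b\<^sup>2) \<le> (b - a) * (1 / (a * b))"
    using ba a \<open>a \<le> b\<close> by (intro mult_mono divide_left_mono) (auto simp: power2_eq_square)
  also have "... = 1 / a - 1 / b" using a \<open>a \<le> b\<close> by (simp add: field_simps)
  finally have "1 / real (Suc n) * (1 / b\<^sup>2) \<le> 1 / a - 1 / b" .
  moreover have "{m<..Suc n} = insert (Suc n) {m<..n}" using step by auto
  ultimately show ?case using step.IH by (simp add: a_def b_def del: of_nat_Suc)
qed simp

lemma offdiag_symmetric: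
  assumes "\<And>u. F (- u) = F u"
  shows "offdiag \<sigma> M F = 2 * (\<Sum>m=1..M. \<Sum>n\<in>{m<..M}. real m powr (-\<sigma>) * real n powr (-\<sigma>) * F (ln (real n) - ln (real m)))"
proof -
  define f where "f = (\<lambda>m n. real m powr (-\<sigma>) * real n powr (-\<sigma>) * F (ln (real n) - ln (real m)))"
  have f: "f m n = f n m" for m n
    using assms[of "ln (real n) - ln (real m)"] by (simp add: f_def mult_ac)
  have "offdiag \<sigma> M F = (\<Sum>m=1..M. \<Sum>n\<in>{1..M}-{m}. f m n)"
    by (simp only: offdiag_def f_def)
  also have "... = (\<Sum>m=1..M. (\<Sum>n\<in>{m<..M}. f m n) + (\<Sum>n\<in>{1..<m}. f m n))"
  proof (rule sum.cong[OF refl])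
    fix m assume "m \<in> {1..M}"
    then have eq: "{1..M} - {m} = {m<..M} \<union> {1..<m}" by auto
    show "(\<Sum>n\<in>{1..M}-{m}. f m n) = (\<Sum>n\<in>{m<..M}. f m n) + (\<Sum>n\<in>{1..<m}. f m n)"
      unfolding eq by (rule sum.union_disjoint) auto
  qed
  also have "... = (\<Sum>m=1..M. \<Sum>n\<in>{m<..M}. f m n) + (\<Sum>m=1..M. \<Sum>n\<in>{1..<m}. f m n)"
    by (rule sum.distrib)
  also have "(\<Sum>m=1..M. \<Sum>n\<in>{1..<m}. f m n) = (\<Sum>m=1..M. \<Sum>n | n \<in> {1..M} \<and> n < m. f m n)"
    by (intro sum.cong) auto
  also have "... = (\<Sum>n=1..M. \<Sum>m | m \<in> {1..M} \<and> n < m. f m n)"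
    by (rule sum.swap_restrict) auto
  also have "... = (\<Sum>n=1..M. \<Sum>m\<in>{n<..M}. f n m)"
    by (intro sum.cong) (auto simp: f)
  finally show ?thesis by (simp add: f_def)
qed

text \<open>Averaging over \<open>[T, T + 1]\<close> makes the part of the kernel that is far from the diagonal
  absolutely summable, which saves a logarithm.\<close>

lemma weighted_mean_square_one_le:
  fixes T :: real
  assumes T: "1 \<le> T"
  shows "integral {1..T} (\<lambda>t. t * dpoly_sq 1 M t) \<le>
    (T + 1)\<^sup>2 / 2 * powsum (-2) M + (T + 1) * ((pi + 8) * powsum (-1) M) + (powsum (-1) M)\<^sup>2 * (3 / 80)"
proof -
  define C where "C = (T + 1)\<^sup>2 / 2 * powsum (-2) M + (T + 1) * (pi * powsum (-1) M) + (powsum (-1) M)\<^sup>2 * (3 / 80)"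
  define R where "R = (\<lambda>v. offdiag 1 M (\<lambda>u. csch_gap u * (v * sin (u * v))))"
  define F where "F = (\<lambda>v. integral {1..v} (\<lambda>t. t * dpoly_sq 1 M t))"
  have int: "(\<lambda>t. t * dpoly_sq 1 M t) integrable_on {1..v}" for v
    by (intro integrable_continuous_interval continuous_intros continuous_on_dpoly_sq)
  have pos: "0 \<le> powsum p M" for p by (auto simp: powsum_def intro!: sum_nonneg)
  \<comment> \<open>The integrand is nonnegative, so \<open>F T \<le> F v\<close>; this is what
    allows the average over \<open>v\<close>.\<close>
  have le: "F T \<le> C + R v" if v: "v \<in> {T..T + 1}" for v
  proof -
    have "F T \<le> F v"
      unfolding F_def using v by (intro integral_subset_le int) (auto simp: dpoly_sq_def)
    also have "F v = integral {1..v} (\<lambda>t. t powr 1 * dpoly_sq 1 M t)"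
      unfolding F_def by (rule integral_cong) simp
    also have "... \<le> v powr (1 + 1) / (1 + 1) * powsum (-2 * 1) M + v powr 1 * (pi * powsum (1 - 2 * 1) M)
     + v powr 1 * offdiag 1 M (\<lambda>u. csch_gap u * sin (u * v)) + (powsum (-1) M)\<^sup>2 * (3 / 80)"
      using v T by (intro weighted_mean_square_le) auto
    also have "... = v\<^sup>2 / 2 * powsum (-2) M + v * (pi * powsum (-1) M) + R v + (powsum (-1) M)\<^sup>2 * (3 / 80)"
      using v T by (simp add: R_def algebra_simps flip: offdiag_cmult)
    also have "v\<^sup>2 / 2 * powsum (-2) M \<le> (T + 1)\<^sup>2 / 2 * powsum (-2) M"
      using v T by (intro mult_right_mono divide_right_mono power_mono pos) auto
    also have "v * (pi * powsum (-1) M) \<le> (T + 1) * (pi * powsum (-1) M)"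
      using v T by (intro mult_right_mono mult_nonneg_nonneg pos) auto
    finally show ?thesis by (simp add: C_def)
  qed
  have intS: "(\<lambda>v. csch_gap u * (v * sin (u * v))) integrable_on {T..T + 1}" for u
    by (intro integrable_continuous_interval continuous_intros)
  have bound: "integral {T..T + 1} (\<lambda>v. csch_gap u * (v * sin (u * v))) \<le> (T + 1) * (4 * (1 / (1 + \<bar>u\<bar>)\<^sup>2))" if u: "u \<noteq> 0" for u
  proof -
    have "integral {T..T + 1} (\<lambda>v. csch_gap u * (v * sin (u * v))) \<le> \<bar>csch_gap u\<bar> * \<bar>integral {T..T + 1} (\<lambda>v. v * sin (u * v))\<bar>"
      by (simp flip: abs_mult)
    also have "... \<le> (T + 1) * (4 * (1 / (1 + \<bar>u\<bar>)\<^sup>2))"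
    \<comment> \<open>The threshold 3 serves both sides: below it
      \<open>1/4 \<le> 4 / (1 + \<bar>u\<bar>)\<^sup>2\<close>, and above it
      \<open>(1 + \<bar>u\<bar>)\<^sup>2 \<le> 2 * u\<^sup>2\<close>.\<close>
    proof (cases "\<bar>u\<bar> \<le> 3")
      case True
      have "\<bar>csch_gap u\<bar> * \<bar>integral {T..T + 1} (\<lambda>v. v * sin (u * v))\<bar> \<le> (1/4) * (T + 1)"
        using T True csch_gap_bounds(1)[OF u] by (intro mult_mono abs_integral_mult_sin_le u) auto
      moreover have "1/4 \<le> 4 * (1 / (1 + \<bar>u\<bar>)\<^sup>2)"
      proof -
        have "(1 + \<bar>u\<bar>)\<^sup>2 \<le> 4\<^sup>2" using True by (intro power_mono) auto
        then have "1 / 4\<^sup>2 \<le> 1 / (1 + \<bar>u\<bar>)\<^sup>2" by (intro divide_left_mono) (auto intro!: mult_pos_pos add_pos_nonneg)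
        then show ?thesis by simp
      qed
      then have "(1/4) * (T + 1) \<le> 4 * (1 / (1 + \<bar>u\<bar>)\<^sup>2) * (T + 1)" using T by (intro mult_right_mono) auto
      ultimately show ?thesis by (simp only: mult.commute[of "T + 1"])
    next
      case False
      have "\<bar>csch_gap u\<bar> * \<bar>integral {T..T + 1} (\<lambda>v. v * sin (u * v))\<bar> \<le> (1 / \<bar>u\<bar>) * (2 * (T + 1) / \<bar>u\<bar>)"
        using T by (intro mult_mono abs_integral_mult_sin_le csch_gap_bounds u) auto
      also have "... = (T + 1) * (2 / u\<^sup>2)" by (simp add: power2_eq_square)
      also have "2 / u\<^sup>2 \<le> 4 * (1 / (1 + \<bar>u\<bar>)\<^sup>2)"
      proof -
        have "3 * \<bar>u\<bar> \<le> \<bar>u\<bar> * \<bar>u\<bar>" using False by (intro mult_right_mono) auto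
        then have "(1 + \<bar>u\<bar>)\<^sup>2 \<le> 2 * u\<^sup>2" using False by (simp add: power2_eq_square algebra_simps abs_mult_self_eq)
        then show ?thesis using u False by (simp add: divide_simps) 
      qed
      finally show ?thesis using T by (simp add: mult_left_mono)
    qed
    finally show ?thesis .
  qed
  have "integral {T..T + 1} (\<lambda>v. F T) \<le> integral {T..T + 1} (\<lambda>v. C + R v)"
    unfolding R_def by (intro integral_le integrable_add integrable_const_ivl offdiag_integral_le(1)[OF intS order.refl] le[unfolded R_def])
  also have "integral {T..T + 1} (\<lambda>v. C + R v) = C + integral {T..T + 1} R"
    unfolding R_def by (subst integral_add[OF integrable_const_ivl offdiag_integral_le(1)[OF intS order.refl]]) simp
  also have "integral {T..T + 1} R \<le> offdiag 1 M (\<lambda>u. (T + 1) * (4 * (1 / (1 + \<bar>u\<bar>)\<^sup>2)))"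
    unfolding R_def by (intro offdiag_integral_le(2) intS bound)
  also have "... = (T + 1) * (4 * offdiag 1 M (\<lambda>u. 1 / (1 + \<bar>u\<bar>)\<^sup>2))"
    by (simp only: offdiag_cmult)
  \<comment> \<open>For fixed \<open>m\<close> the terms with \<open>n > m\<close> sum to at most
    \<open>1 / m\<close>, and symmetry doubles this. With the factor 4 it gives the 8 of the
    statement.\<close>
  also have "offdiag 1 M (\<lambda>u. 1 / (1 + \<bar>u\<bar>)\<^sup>2) \<le> 2 * powsum (-1) M"
  proof -
    have "offdiag 1 M (\<lambda>u. 1 / (1 + \<bar>u\<bar>)\<^sup>2) = 2 * (\<Sum>m=1..M. \<Sum>n\<in>{m<..M}. real m powr (-1) * real n powr (-1) * (1 / (1 + \<bar>ln (real n) - ln (real m)\<bar>)\<^sup>2))"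
      by (rule offdiag_symmetric) simp
    also have "(\<Sum>m=1..M. \<Sum>n\<in>{m<..M}. real m powr (-1) * real n powr (-1) * (1 / (1 + \<bar>ln (real n) - ln (real m)\<bar>)\<^sup>2)) \<le> (\<Sum>m=1..M. real m powr (-1) * 1)"
    proof (rule sum_mono)
      fix m assume m: "m \<in> {1..M}"
      have "(\<Sum>n\<in>{m<..M}. real m powr (-1) * real n powr (-1) * (1 / (1 + \<bar>ln (real n) - ln (real m)\<bar>)\<^sup>2))
        = real m powr (-1) * (\<Sum>n\<in>{m<..M}. 1 / real n * (1 / (1 + (ln (real n) - ln (real m)))\<^sup>2))"
        unfolding sum_distrib_left
      proof (rule sum.cong[OF refl])
        fix n assume "n \<in> {m<..M}"
        then have "ln (real m) \<le> ln (real n)" using m by auto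
        then show "real m powr (-1) * real n powr (-1) * (1 / (1 + \<bar>ln (real n) - ln (real m)\<bar>)\<^sup>2) =
          real m powr (-1) * (1 / real n * (1 / (1 + (ln (real n) - ln (real m)))\<^sup>2))"
          by (simp add: powr_minus divide_inverse)
      qed
      also have "... \<le> real m powr (-1) * 1"
      proof (rule mult_left_mono)
        have "ln (real m) \<le> ln (real M)" using m by auto
        then have "0 \<le> 1 / (1 + (ln (real M) - ln (real m)))" by simp
        then show "(\<Sum>n\<in>{m<..M}. 1 / real n * (1 / (1 + (ln (real n) - ln (real m)))\<^sup>2)) \<le> 1"
          using sum_inverse_log_squared_le[of m M] m by (intro order.trans[OF sum_inverse_log_squared_le]) auto
      qed simp
      finally show "(\<Sum>n\<in>{m<..M}. real m powr (-1) * real n powr (-1) * (1 / (1 + \<bar>ln (real n) - ln (real m)\<bar>)\<^sup>2)) \<le> real m powr (-1) * 1" .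
    qed
    finally show ?thesis by (simp add: powsum_def)
  qed
  finally have "F T \<le> C + (T + 1) * (4 * (2 * powsum (-1) M))" using T by simp
  then show ?thesis by (simp add: F_def C_def algebra_simps)
qed

section \<open>Bounds for power sums\<close>

lemma powsum_le_powr:
  assumes "0 < p" "p < 1"
  shows "powsum (-p) M \<le> real M powr (1 - p) / (1 - p)"
proof -
  have "powsum (-p) M = (\<Sum>n<M. real (Suc n) powr (-p))"
    unfolding powsum_def by (simp add: sum.atLeast1_atMost_eq)
  also have "... \<le> (\<Sum>n<M. (real (Suc n) powr (1 - p) - real n powr (1 - p)) / (1 - p))"
    by (intro sum_mono powr_difference_ge assms)
  also have "... = (real M powr (1 - p) - real 0 powr (1 - p)) / (1 - p)"
    unfolding sum_divide_distrib[symmetric]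
    by (subst sum_lessThan_telescope[of "\<lambda>n. real n powr (1 - p)"]) simp
  finally show ?thesis by simp
qed

lemma powsum_minus_one_le:
  assumes "0 < M"
  shows "powsum (-1) M \<le> 1 + ln (real M)"
proof -
  have "1 \<le> M" using assms by simp
  then show ?thesis
  proof (induction M rule: dec_induct)
    case (step n)
    have "ln (real n / real (Suc n)) \<le> real n / real (Suc n) - 1"
      using step by (intro ln_le_minus_one) auto
    then have "1 / real (Suc n) \<le> ln (real (Suc n)) - ln (real n)"
      using step by (simp add: ln_div field_simps)
    then show ?case using step.IH by (simp add: powsum_def powr_minus_divide del: of_nat_Suc)
  qed (simp add: powsum_def)
qed

lemma powsum_le_zeta:
  assumes "1 < p"
  shows "powsum (-p) M \<le> Re (zeta (of_real p))"
proof -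
  have "powsum (-p) M = (\<Sum>n<M. real (Suc n) powr (-p))"
    unfolding powsum_def by (simp add: sum.atLeast1_atMost_eq)
  also have "... \<le> (\<Sum>n. real (Suc n) powr (-p))"
    using zeta_of_real_sums[OF assms] by (intro sum_le_suminf) (auto simp: sums_iff)
  also have "... = Re (zeta (of_real p))" using zeta_of_real_sums[OF assms] by (simp add: sums_iff)
  finally show ?thesis .
qed

section \<open>Mean squares of the zeta function\<close>

lemma continuous_on_norm_zeta:
  assumes "1 \<notin> (\<lambda>t. Complex \<sigma> t) ` A"
  shows "continuous_on A (\<lambda>t. zeta_sq \<sigma> t)"
proof -
  have "continuous_on ((\<lambda>t. Complex \<sigma> t) ` A) zeta"
    by (rule continuous_on_subset[OF holomorphic_on_imp_continuous_on[OF holomorphic_zeta]]) (use assms in auto)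
  moreover have "continuous_on A (\<lambda>t. Complex \<sigma> t)"
    unfolding Complex_eq by (intro continuous_intros)
  ultimately have "continuous_on A (\<lambda>t. zeta (Complex \<sigma> t))"
    by (rule continuous_on_compose2) auto
  then show ?thesis by (intro continuous_intros)
qed

lemma continuous_on_norm_zeta_Icc: "continuous_on {1..T} (\<lambda>t. zeta_sq \<sigma> t)"
  by (rule continuous_on_norm_zeta) (auto simp: complex_eq_iff)

lemma integrable_weighted_zeta:
  "(\<lambda>t. t powr a * zeta_sq \<sigma> t) integrable_on {1..T}"
  by (intro integrable_continuous_interval continuous_intros continuous_on_norm_zeta_Icc) auto

section \<open>From the polynomial to the zeta function\<close>

text \<open>Bounds the approximation error after division by \<open>T powr (1 - \<sigma>)\<close>:
  \<open>9/8\<close> exceeds \<open>sqrt (5/4)\<close>, where \<open>Suc M \<le> 5/4 * T\<close>,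
  and \<open>8/5\<close> is the constant of \<open>zeta_approx\<close>.\<close>

definition remainder_weight :: "real \<Rightarrow> real \<Rightarrow> real" where "remainder_weight T t = 9/8 * (1 / t) + 8/5 * (1 / T)"

text \<open>\<open>zeta_approx\<close> with \<open>N = Suc M\<close>: this exceeds \<open>T\<close>,
  so one polynomial serves all \<open>t\<close> in the range. The pole term is at most
  \<open>N powr (1 - \<sigma>) / t\<close>.\<close>

lemma norm_zeta_squared_le:
  fixes \<sigma> t T :: real
  assumes \<sigma>: "1/2 \<le> \<sigma>" "\<sigma> \<le> 1" and t: "1 \<le> t" "t \<le> T" and T: "4 \<le> T"
  defines "M \<equiv> nat \<lfloor>T\<rfloor>"
  defines "R \<equiv> real (Suc M) powr (1 - \<sigma>) * (1 / t) + 8/5 * real (Suc M) powr (-\<sigma>)"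
  shows "zeta_sq \<sigma> t \<le> dpoly_sq \<sigma> M t + 2 * sqrt (dpoly_sq \<sigma> M t) * R + R\<^sup>2"
proof -
  define s where "s = Complex \<sigma> t"
  define P where "P = (\<Sum>n=1..M. (of_nat n :: complex) powr (-s))"
  have M: "4 \<le> M" "T < real (Suc M)" using T unfolding M_def by linarith+
  have "cmod (zeta s - (\<Sum>n=1..<Suc M. of_nat n powr (-s)) - of_nat (Suc M) powr (1 - s) / (s - 1)) \<le> 8/5 * real (Suc M) powr (- Re s)"
    using \<sigma> t M by (intro zeta_approx) (auto simp: s_def)
  also have "(\<Sum>n=1..<Suc M. of_nat n powr (-s)) = P" unfolding P_def by (simp add: atLeastLessThanSuc_atLeastAtMost)
  finally have 1: "cmod (zeta s - P - of_nat (Suc M) powr (1 - s) / (s - 1)) \<le> 8/5 * real (Suc M) powr (-\<sigma>)"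
    by (simp add: s_def)
  have "t \<le> cmod (s - 1)" using abs_Im_le_cmod[of "s - 1"] t by (simp add: s_def)
  then have "cmod (of_nat (Suc M) powr (1 - s) / (s - 1)) \<le> real (Suc M) powr (1 - \<sigma>) / t"
    unfolding norm_divide using t
    by (intro frac_le) (auto simp: s_def norm_powr_real_powr)
  then have "cmod (zeta s - P) \<le> R"
    using 1 norm_triangle_sub[of "zeta s - P" "of_nat (Suc M) powr (1 - s) / (s - 1)"] by (simp add: R_def)
  then have "cmod (zeta s) \<le> cmod P + R" using norm_triangle_sub[of "zeta s" P] by linarith
  then have "(cmod (zeta s))\<^sup>2 \<le> (cmod P + R)\<^sup>2" by (intro power_mono) auto
  also have "... = dpoly_sq \<sigma> M t + 2 * sqrt (dpoly_sq \<sigma> M t) * R + R\<^sup>2"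
    by (simp add: dpoly_sq_def P_def s_def power2_sum)
  finally show ?thesis by (simp add: s_def)
qed

lemma sqrt_dpoly_sq_le: "sqrt (dpoly_sq \<sigma> M t) \<le> powsum (-\<sigma>) M"
proof -
  have "sqrt (dpoly_sq \<sigma> M t) = cmod (\<Sum>n=1..M. of_nat n powr (- Complex \<sigma> t))" by (simp add: dpoly_sq_def)
  also have "... \<le> powsum (-\<sigma>) M"
    unfolding powsum_def by (intro sum_norm_le) (auto simp: norm_powr_real_powr)
  finally show ?thesis .
qed

lemma powsum_nonneg: "0 \<le> powsum p M"
  by (auto simp: powsum_def intro!: sum_nonneg)

lemma Suc_floor_powr_le:
  fixes \<sigma> T :: real
  assumes \<sigma>: "1/2 \<le> \<sigma>" "\<sigma> \<le> 1" and T: "4 \<le> T"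
  shows "real (Suc (nat \<lfloor>T\<rfloor>)) powr (1 - \<sigma>) \<le> 9/8 * T powr (1 - \<sigma>)"
    and "real (Suc (nat \<lfloor>T\<rfloor>)) powr (-\<sigma>) \<le> T powr (1 - \<sigma>) * (1 / T)"
proof -
  define N where "N = real (Suc (nat \<lfloor>T\<rfloor>))"
  have N: "T < N" "N \<le> 5/4 * T" using T unfolding N_def by linarith+
  have "N powr (1 - \<sigma>) \<le> (5/4 * T) powr (1 - \<sigma>)" using N T \<sigma> by (intro powr_mono2) auto
  also have "... = (5/4) powr (1 - \<sigma>) * T powr (1 - \<sigma>)" using T by (subst powr_mult) auto
  also have "(5/4 :: real) powr (1 - \<sigma>) \<le> (5/4) powr (1/2)" using \<sigma> by (intro powr_mono) auto
  also have "(5/4 :: real) powr (1/2) = sqrt (5/4)" by (rule powr_half_sqrt) simp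
  also have "sqrt (5/4) \<le> (9/8 :: real)" by (rule real_le_lsqrt) (auto simp: power2_eq_square)
  finally show "real (Suc (nat \<lfloor>T\<rfloor>)) powr (1 - \<sigma>) \<le> 9/8 * T powr (1 - \<sigma>)"
    by (simp add: N_def mult_right_mono)
  have "N powr (-\<sigma>) \<le> T powr (-\<sigma>)" using N T \<sigma> by (intro powr_mono2') auto
  also have "... = T powr (1 - \<sigma>) * (1 / T)" using T by (simp add: powr_diff powr_minus field_simps)
  finally show "real (Suc (nat \<lfloor>T\<rfloor>)) powr (-\<sigma>) \<le> T powr (1 - \<sigma>) * (1 / T)" by (simp add: N_def)
qed

lemma ln_bounds:
  fixes T :: real
  assumes "4 \<le> T"
  shows "4/3 \<le> ln T" "ln T \<le> 35/100 * T"
proof -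
  have l4: "ln (4::real) = 2 * ln 2" using ln_realpow[of "2::real" 2] by simp
  have "4/3 \<le> ln (4::real)" using ln2_ge_two_thirds l4 by simp
  also have "... \<le> ln T" using assms by simp
  finally show "4/3 \<le> ln T" .
  have "ln (T / 4) \<le> T / 4 - 1" using assms by (intro ln_le_minus_one) auto
  then have "ln T \<le> T / 4 - 1 + ln 4" using assms by (simp add: ln_div)
  also have "ln (4::real) \<le> 25/18" using ln2_le_25_over_36 l4 by simp
  finally show "ln T \<le> 35/100 * T" using assms by simp
qed

lemma has_integral_inverse:
  assumes "1 \<le> (T::real)"
  shows "((\<lambda>t. 1 / t) has_integral ln T) {1..T}"
proof -
  have "((\<lambda>t. 1 / t) has_integral ln T - ln 1) {1..T}"
    using assms by (intro fundamental_theorem_of_calculus)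
      (auto simp flip: has_real_derivative_iff_has_vector_derivative intro!: derivative_eq_intros)
  then show ?thesis by simp
qed

lemma has_integral_inverse_square:
  assumes "1 \<le> (T::real)"
  shows "((\<lambda>t. 1 / t\<^sup>2) has_integral (1 - 1 / T)) {1..T}"
proof -
  have "((\<lambda>t. 1 / t\<^sup>2) has_integral (- (1 / T)) - (- (1 / 1))) {1..T}"
    using assms by (intro fundamental_theorem_of_calculus)
      (auto simp: power2_eq_square simp flip: has_real_derivative_iff_has_vector_derivative intro!: derivative_eq_intros)
  then show ?thesis by simp
qed

lemma integral_remainder_weight_square_le:
  fixes T :: real
  assumes T: "4 \<le> T"
  shows "(\<lambda>t. (remainder_weight T t)\<^sup>2) integrable_on {1..T}" "integral {1..T} (\<lambda>t. (remainder_weight T t)\<^sup>2) \<le> 3"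
proof -
  have eq: "(remainder_weight T t)\<^sup>2 = 81/64 * (1 / t\<^sup>2) + (18/5 * (1 / T) * (1 / t) + 64/25 * (1 / T)\<^sup>2)" for t
    by (simp add: remainder_weight_def power2_sum power_mult_distrib power_divide)
  have "((\<lambda>t. (remainder_weight T t)\<^sup>2) has_integral 81/64 * (1 - 1 / T) + (18/5 * (1 / T) * ln T + (T - 1) * (64/25 * (1 / T)\<^sup>2))) {1..T}"
    unfolding eq
  proof (intro has_integral_add has_integral_mult_right has_integral_inverse has_integral_inverse_square)
    show "((\<lambda>t. 64/25 * (1 / T)\<^sup>2) has_integral (T - 1) * (64/25 * (1 / T)\<^sup>2)) {1..T}"
      using has_integral_const_real[of "64/25 * (1 / T)\<^sup>2" 1 T] T by simp
  qed (use T in auto)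
  moreover have "81/64 * (1 - 1 / T) + (18/5 * (1 / T) * ln T + (T - 1) * (64/25 * (1 / T)\<^sup>2)) \<le> 3"
  proof -
    have "18/5 * (1 / T) * ln T \<le> 18/5 * (1 / T) * (35/100 * T)" using ln_bounds[OF T] T by (intro mult_left_mono) auto
    also have "... = 126/100" using T by simp
    finally have 1: "18/5 * (1 / T) * ln T \<le> 126/100" .
    have "(T - 1) * (64/25 * (1 / T)\<^sup>2) \<le> T * (64/25 * (1 / T)\<^sup>2)" using T by (intro mult_right_mono) auto
    also have "... = 64/25 * (1 / T)" using T by (simp add: power2_eq_square)
    finally have 2: "(T - 1) * (64/25 * (1 / T)\<^sup>2) \<le> 64/25 * (1 / T)" .
    have "1 / T \<le> 1 / 4" using T by (intro divide_left_mono) auto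
    moreover have "81/64 * (1 - y) + (A + C) \<le> 3" if "A \<le> 126/100" "C \<le> 64/25 * y" "y \<le> 1/4" for A C y :: real
      using that unfolding right_diff_distrib by linarith
    ultimately show ?thesis using 1 2 by blast
  qed
  ultimately show "(\<lambda>t. (remainder_weight T t)\<^sup>2) integrable_on {1..T}" "integral {1..T} (\<lambda>t. (remainder_weight T t)\<^sup>2) \<le> 3"
    by (auto simp: has_integral_iff)
qed

text \<open>In the cross term the polynomial is bounded pointwise by
  \<open>powsum (-\<sigma>) M\<close>. The integral of the weight is left as \<open>J\<close>, since
  it is logarithmic for \<open>a = 0\<close> but not for \<open>a > 0\<close>.\<close>

lemma weighted_zeta_le:
  fixes a \<sigma> T J :: real
  assumes a: "0 \<le> a" and \<sigma>: "1/2 \<le> \<sigma>" "\<sigma> \<le> 1" and T: "4 \<le> T"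
    and J: "integral {1..T} (\<lambda>t. t powr a * remainder_weight T t) \<le> J"
  defines "M \<equiv> nat \<lfloor>T\<rfloor>"
  shows "integral {1..T} (\<lambda>t. t powr a * zeta_sq \<sigma> t) \<le>
    integral {1..T} (\<lambda>t. t powr a * dpoly_sq \<sigma> M t) + 2 * powsum (-\<sigma>) M * T powr (1 - \<sigma>) * J
      + 3 * T powr a * (T powr (1 - \<sigma>))\<^sup>2"
proof -
  define D where "D = powsum (-\<sigma>) M"
  define B where "B = T powr (1 - \<sigma>)"
  have D: "0 \<le> D" "0 \<le> B" by (auto simp: D_def B_def powsum_nonneg)
  have cr: "continuous_on {1..T} (remainder_weight T)" unfolding remainder_weight_def[abs_def] by (intro continuous_intros) auto
  have "integral {1..T} (\<lambda>t. t powr a * zeta_sq \<sigma> t) \<le>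
    integral {1..T} (\<lambda>t. t powr a * dpoly_sq \<sigma> M t + (2 * D * B * (t powr a * remainder_weight T t) + T powr a * B\<^sup>2 * (remainder_weight T t)\<^sup>2))"
  proof (intro integral_le integrable_weighted_zeta)
    show "(\<lambda>t. t powr a * dpoly_sq \<sigma> M t + (2 * D * B * (t powr a * remainder_weight T t) + T powr a * B\<^sup>2 * (remainder_weight T t)\<^sup>2)) integrable_on {1..T}"
      by (intro integrable_continuous_interval continuous_intros continuous_on_dpoly_sq cr) auto
    fix t assume "t \<in> {1..T}"
    then have t: "1 \<le> t" "t \<le> T" by auto
    define R where "R = real (Suc M) powr (1 - \<sigma>) * (1 / t) + 8/5 * real (Suc M) powr (-\<sigma>)"
    have R: "0 \<le> R" "zeta_sq \<sigma> t \<le> dpoly_sq \<sigma> M t + 2 * sqrt (dpoly_sq \<sigma> M t) * R + R\<^sup>2"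
      using norm_zeta_squared_le[OF \<sigma> t T] t by (auto simp: R_def M_def)
    note R_def
    also have "real (Suc M) powr (1 - \<sigma>) * (1 / t) + 8/5 * real (Suc M) powr (-\<sigma>) \<le> (9/8 * B) * (1 / t) + 8/5 * (B * (1 / T))"
      unfolding M_def B_def using t by (intro add_mono mult_right_mono mult_left_mono Suc_floor_powr_le \<sigma> T) auto
    also have "... = B * remainder_weight T t" by (simp add: remainder_weight_def algebra_simps)
    finally have RB: "R \<le> B * remainder_weight T t" .
    have "2 * sqrt (dpoly_sq \<sigma> M t) * R \<le> 2 * D * (B * remainder_weight T t)"
      using RB R(1) sqrt_dpoly_sq_le[of \<sigma> M t] D by (intro mult_mono) (auto simp: D_def dpoly_sq_def)
    moreover have "R\<^sup>2 \<le> (B * remainder_weight T t)\<^sup>2" using RB R(1) by (rule power_mono)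
    ultimately have "zeta_sq \<sigma> t \<le> dpoly_sq \<sigma> M t + 2 * D * (B * remainder_weight T t) + (B * remainder_weight T t)\<^sup>2"
      using R(2) by linarith
    then have "t powr a * zeta_sq \<sigma> t \<le> t powr a * (dpoly_sq \<sigma> M t + 2 * D * (B * remainder_weight T t) + (B * remainder_weight T t)\<^sup>2)"
      by (intro mult_left_mono) auto
    also have "... = t powr a * dpoly_sq \<sigma> M t + (2 * D * B * (t powr a * remainder_weight T t) + t powr a * (B * remainder_weight T t)\<^sup>2)"
      by (simp add: algebra_simps)
    also have "t powr a * (B * remainder_weight T t)\<^sup>2 \<le> T powr a * (B * remainder_weight T t)\<^sup>2"
      using t a by (intro mult_right_mono powr_mono2) auto
    finally show "t powr a * zeta_sq \<sigma> t \<le> t powr a * dpoly_sq \<sigma> M t + (2 * D * B * (t powr a * remainder_weight T t) + T powr a * B\<^sup>2 * (remainder_weight T t)\<^sup>2)"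
      by (simp add: power_mult_distrib mult.assoc)
  qed
  also have "... = integral {1..T} (\<lambda>t. t powr a * dpoly_sq \<sigma> M t) + (2 * D * B * integral {1..T} (\<lambda>t. t powr a * remainder_weight T t) + T powr a * B\<^sup>2 * integral {1..T} (\<lambda>t. (remainder_weight T t)\<^sup>2))"
  proof -
    have i: "(\<lambda>t. t powr a * dpoly_sq \<sigma> M t) integrable_on {1..T}" "(\<lambda>t. 2 * D * B * (t powr a * remainder_weight T t)) integrable_on {1..T}"
      "(\<lambda>t. T powr a * B\<^sup>2 * (remainder_weight T t)\<^sup>2) integrable_on {1..T}"
      by (intro integrable_continuous_interval continuous_intros continuous_on_dpoly_sq cr; auto)+
    show ?thesis
      unfolding integral_add[OF i(1) integrable_add[OF i(2,3)]] integral_add[OF i(2,3)] by simp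
  qed
  also have "... \<le> integral {1..T} (\<lambda>t. t powr a * dpoly_sq \<sigma> M t) + (2 * D * B * J + T powr a * B\<^sup>2 * 3)"
    using D by (intro add_left_mono add_mono mult_left_mono J integral_remainder_weight_square_le T) auto
  finally show ?thesis by (simp add: D_def B_def algebra_simps)
qed

lemma integral_remainder_weight_le:
  assumes T: "4 \<le> (T::real)"
  shows "integral {1..T} (\<lambda>t. t powr 0 * remainder_weight T t) \<le> 9/8 * ln T + 8/5"
proof -
  have "((\<lambda>t. 9/8 * (1 / t) + 8/5 * (1 / T)) has_integral 9/8 * ln T + (T - 1) * (8/5 * (1 / T))) {1..T}"
  proof (intro has_integral_add has_integral_mult_right has_integral_inverse)
    show "((\<lambda>t. 8/5 * (1 / T)) has_integral (T - 1) * (8/5 * (1 / T))) {1..T}"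
      using has_integral_const_real[of "8/5 * (1 / T)" 1 T] T by simp
  qed (use T in auto)
  then have "integral {1..T} (\<lambda>t. 9/8 * (1 / t) + 8/5 * (1 / T)) = 9/8 * ln T + (T - 1) * (8/5 * (1 / T))" by (rule integral_unique)
  moreover have "integral {1..T} (\<lambda>t. t powr 0 * remainder_weight T t) = integral {1..T} (\<lambda>t. 9/8 * (1 / t) + 8/5 * (1 / T))"
    by (rule integral_cong) (auto simp: remainder_weight_def)
  moreover have "(T - 1) * (8/5 * (1 / T)) \<le> 8/5" using T by (simp add: field_simps)
  ultimately show ?thesis by simp
qed

text \<open>Now \<open>1 / t\<close> contributes \<open>T powr a / a\<close> instead of a logarithm;
  this \<open>1 / a\<close> is a source of \<open>1/2 - \<sigma>\<close> in the denominator for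
  \<open>0 < \<sigma> < 1/2\<close>.\<close>

lemma integral_powr_remainder_weight_le:
  assumes T: "4 \<le> (T::real)" and a: "0 < a" "a \<le> 1"
  shows "integral {1..T} (\<lambda>t. t powr a * remainder_weight T t) \<le> T powr a * (9 / (8 * a) + 8/5)"
proof -
  have p: "((\<lambda>t. t powr b) has_integral (T powr (b + 1) - 1) / (b + 1)) {1..T}" if "-1 < b" for b
  proof -
    have "((\<lambda>t. t powr b) has_integral T powr (b + 1) / (b + 1) - 1 powr (b + 1) / (b + 1)) {1..T}"
      using T that by (intro fundamental_theorem_of_calculus)
        (auto simp flip: has_real_derivative_iff_has_vector_derivative intro!: derivative_eq_intros)
    then show ?thesis by (simp add: diff_divide_distrib)
  qed
  have "((\<lambda>t. 9/8 * t powr (a - 1) + 8/5 * (1 / T) * t powr a) has_integral 9/8 * ((T powr (a - 1 + 1) - 1) / (a - 1 + 1)) + 8/5 * (1 / T) * ((T powr (a + 1) - 1) / (a + 1))) {1..T}"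
    using a by (intro has_integral_add has_integral_mult_right p) auto
  then have "integral {1..T} (\<lambda>t. 9/8 * t powr (a - 1) + 8/5 * (1 / T) * t powr a) = 9/8 * ((T powr (a - 1 + 1) - 1) / (a - 1 + 1)) + 8/5 * (1 / T) * ((T powr (a + 1) - 1) / (a + 1))"
    by (rule integral_unique)
  moreover have "integral {1..T} (\<lambda>t. t powr a * remainder_weight T t) = integral {1..T} (\<lambda>t. 9/8 * t powr (a - 1) + 8/5 * (1 / T) * t powr a)"
    by (rule integral_cong) (auto simp: remainder_weight_def powr_diff algebra_simps)
  moreover have "9/8 * ((T powr (a - 1 + 1) - 1) / (a - 1 + 1)) \<le> T powr a * (9 / (8 * a))"
    using a by (simp add: field_simps)
  moreover have "8/5 * (1 / T) * ((T powr (a + 1) - 1) / (a + 1)) \<le> 8/5 * (1 / T) * (T powr (a + 1) / 1)"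
    using a T by (intro mult_left_mono frac_le) (auto simp: ge_one_powr_ge_zero)
  moreover have "8/5 * (1 / T) * (T powr (a + 1) / 1) = T powr a * (8/5)"
    using T by (simp add: powr_add)
  ultimately show ?thesis by (simp add: distrib_left)
qed


lemma integral_powr_zero_mult:
  "integral {1..T} (\<lambda>t. t powr 0 * f t) = integral {1..T::real} f"
  by (rule integral_cong) auto

lemma floor_powsum_bounds:
  fixes T :: real
  assumes T: "4 \<le> T"
  defines "M \<equiv> nat \<lfloor>T\<rfloor>"
  shows "0 < M" "real M \<le> T" "T < real (Suc M)" "powsum (-1) M \<le> 1 + ln T"
    and "0 < p \<Longrightarrow> p < 1 \<Longrightarrow> powsum (-p) M \<le> T powr (1 - p) / (1 - p)"
proof -
  show M: "0 < M" "real M \<le> T" "T < real (Suc M)" using T unfolding M_def by linarith+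
  have "ln (real M) \<le> ln T" using M by (intro ln_mono) auto
  then show "powsum (-1) M \<le> 1 + ln T" using powsum_minus_one_le[OF M(1)] by simp
  assume p: "0 < p" "p < 1"
  have "real M powr (1 - p) / (1 - p) \<le> T powr (1 - p) / (1 - p)"
    using M p by (intro divide_right_mono powr_mono2) auto
  then show "powsum (-p) M \<le> T powr (1 - p) / (1 - p)" using powsum_le_powr[OF p, of M] by linarith
qed

lemma powsum_minus_two_le: "powsum (-2) M \<le> pi\<^sup>2 / 6"
proof -
  have s: "(\<lambda>n. 1 / (real n + 1)\<^sup>2) sums (pi\<^sup>2 / 6)"
    using inverse_squares_sums by (simp add: add.commute)
  have "powsum (-2) M = (\<Sum>n<M. 1 / (real n + 1)\<^sup>2)"
    unfolding powsum_def by (simp add: sum.atLeast1_atMost_eq powr_minus divide_inverse add.commute)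
  also have "... \<le> (\<Sum>n. 1 / (real n + 1)\<^sup>2)"
    by (rule sum_le_suminf[OF sums_summable[OF s]]) auto
  also have "... = pi\<^sup>2 / 6" by (rule sums_unique[OF s, symmetric])
  finally show ?thesis .
qed

section \<open>The ranges of \<sigma>\<close>

text \<open>Beyond the diagonal everything is quadratic in \<open>L\<close>. It is absorbed by
  \<open>sqrt T = (exp (L / 4))\<^sup>2\<close>, bounded below through the quadratic Taylor
  polynomial.\<close>

lemma mean_square_zeta_one:
  fixes T :: real
  assumes T: "4 \<le> T"
  shows "integral {1..T} (\<lambda>t. zeta_sq 1 t) \<le> pi\<^sup>2 / 6 * T + 18.34 * sqrt T"
proof -
  define M where "M = nat \<lfloor>T\<rfloor>"
  define H where "H = powsum (-1) M"
  define L where "L = ln T"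
  have L: "4/3 \<le> L" using ln_bounds[OF T] by (simp add: L_def)
  have H: "0 \<le> H" "H \<le> 1 + L" using floor_powsum_bounds(4)[OF T] by (auto simp: H_def M_def L_def powsum_nonneg)
  have "integral {1..T} (\<lambda>t. t powr 0 * zeta_sq 1 t) \<le>
    integral {1..T} (\<lambda>t. t powr 0 * dpoly_sq 1 M t) + 2 * powsum (-1) M * T powr (1 - 1) * (9/8 * ln T + 8/5)
      + 3 * T powr 0 * (T powr (1 - 1))\<^sup>2"
    unfolding M_def by (intro weighted_zeta_le integral_remainder_weight_le T) auto
  also have "... = integral {1..T} (\<lambda>t. t powr 0 * dpoly_sq 1 M t) + 2 * H * (9/8 * L + 8/5) + 3"
    using T by (simp add: H_def L_def)
  also have "integral {1..T} (\<lambda>t. t powr 0 * dpoly_sq 1 M t) \<le> T powr (1 + 0) / (1 + 0) * powsum (-2 * 1) M + T powr 0 * (pi * powsum (1 - 2 * 1) M + (powsum (-1) M)\<^sup>2 / 4)"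
    using T by (intro weighted_mean_square_le_quarter) auto
  also have "... = T * powsum (-2) M + pi * H + H\<^sup>2 / 4" using T by (simp add: H_def)
  finally have 1: "integral {1..T} (\<lambda>t. zeta_sq 1 t) \<le> T * powsum (-2) M + pi * H + H\<^sup>2 / 4 + 2 * H * (9/8 * L + 8/5) + 3"
    unfolding integral_powr_zero_mult by simp
  have f1: "T * powsum (-2) M \<le> pi\<^sup>2 / 6 * T"
    using T powsum_minus_two_le[of M] by (simp add: mult.commute mult_left_mono)
  have f2: "pi * H \<le> 315/100 * (1 + L)" using pi_approx H by (intro mult_mono) auto
  have f3: "H\<^sup>2 / 4 \<le> (1 + L)\<^sup>2 / 4" using H by (intro divide_right_mono power_mono) auto
  have f4: "2 * H * (9/8 * L + 8/5) \<le> 2 * (1 + L) * (9/8 * L + 8/5)"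
    using H L by (intro mult_right_mono) auto
  have f5: "315/100 * (1 + L) + (1 + L)\<^sup>2 / 4 + 2 * (1 + L) * (9/8 * L + 8/5) + 3 \<le> 18.34 * (1 + L / 4 + (L / 4)\<^sup>2 / 2)\<^sup>2"
  proof -
    \<comment> \<open>The cubic term supplies what the quadratic coefficient lacks; the linear
      coefficients, \<open>9.1\<close> against \<open>9.17\<close>, nearly agree.\<close>
    have "(4/3) * L\<^sup>2 \<le> L ^ 3" using L by (simp add: power2_eq_square power3_eq_cube mult_right_mono)
    moreover have "(1 + L / 4 + (L / 4)\<^sup>2 / 2)\<^sup>2 = 1 + L / 2 + L\<^sup>2 / 8 + L ^ 3 / 64 + L ^ 4 / 1024"
      by (simp add: power2_eq_square power3_eq_cube power4_eq_xxxx field_simps)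
    moreover have "0 \<le> L ^ 4" by simp
    moreover have "315/100 * (1 + L) + (1 + 2 * L + p) / 4 + (9/4 * p + 109/20 * L + 16/5) + 3 \<le> 18.34 * (1 + L / 2 + p / 8 + q / 64 + r / 1024)"
      if "(4/3) * p \<le> q" "0 \<le> r" "0 \<le> p" for p q r :: real
      using that L by (simp add: field_simps)
    moreover have "0 \<le> L\<^sup>2" by simp
    moreover have "(1 + L)\<^sup>2 = 1 + 2 * L + L\<^sup>2" "2 * (1 + L) * (9/8 * L + 8/5) = 9/4 * L\<^sup>2 + 109/20 * L + 16/5"
      by (simp_all add: power2_eq_square field_simps)
    ultimately show ?thesis by (simp only:)
  qed
  have f6: "(1 + L / 4 + (L / 4)\<^sup>2 / 2)\<^sup>2 \<le> sqrt T"
  proof -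
    have "(1 + L / 4 + (L / 4)\<^sup>2 / 2)\<^sup>2 \<le> (exp (L / 4))\<^sup>2"
      using L by (intro power_mono exp_lower_Taylor_quadratic) auto
    also have "... = exp (L / 2)" by (simp flip: exp_double)
    also have "... = sqrt T" using T by (simp add: L_def flip: ln_sqrt)
    finally show ?thesis .
  qed
  note 1
  also have "T * powsum (-2) M + pi * H + H\<^sup>2 / 4 + 2 * H * (9/8 * L + 8/5) + 3 \<le> pi\<^sup>2 / 6 * T + 315/100 * (1 + L) + (1 + L)\<^sup>2 / 4 + 2 * (1 + L) * (9/8 * L + 8/5) + 3"
    by (intro add_mono f1 f2 f3 f4 order.refl)
  also have "... = pi\<^sup>2 / 6 * T + (315/100 * (1 + L) + (1 + L)\<^sup>2 / 4 + 2 * (1 + L) * (9/8 * L + 8/5) + 3)"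
    by (simp only: add.assoc)
  also have "... \<le> pi\<^sup>2 / 6 * T + 18.34 * (1 + L / 4 + (L / 4)\<^sup>2 / 2)\<^sup>2" by (intro add_left_mono f5)
  also have "... \<le> pi\<^sup>2 / 6 * T + 18.34 * sqrt T" by (intro add_left_mono mult_left_mono f6) auto
  finally show ?thesis .
qed

text \<open>\<open>63/40\<close> is half of \<open>3.15 \<ge> pi\<close>, \<open>1/4\<close> comes
  from the gap kernel and the lower end point, and \<open>3\<close> from the squared remainder. Both
  \<open>a = 0\<close> and \<open>a = 2 * \<sigma> - 1\<close> are needed.\<close>

lemma weighted_zeta_strip_le:
  fixes a \<sigma> T J :: real
  assumes a: "0 \<le> a" "a \<le> 1" and \<sigma>: "1/2 < \<sigma>" "\<sigma> < 1" and T: "4 \<le> T"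
    and J: "integral {1..T} (\<lambda>t. t powr a * remainder_weight T t) \<le> J" "0 \<le> J"
  defines "b \<equiv> 1 - \<sigma>" and "M \<equiv> nat \<lfloor>T\<rfloor>"
  shows "integral {1..T} (\<lambda>t. t powr a * zeta_sq \<sigma> t) \<le>
    T powr (1 + a) / (1 + a) * powsum (-(2 * \<sigma>)) M
      + T powr a * (T powr b)\<^sup>2 * (63/40 / b + 1/4 / b\<^sup>2 + 3) + 2 / b * (T powr b)\<^sup>2 * J"
proof -
  define D where "D = powsum (-\<sigma>) M"
  define B where "B = T powr b"
  have b: "0 < b" "b < 1/2" using \<sigma> by (auto simp: b_def)
  have B: "0 < B" "T powr (2 - 2 * \<sigma>) = B\<^sup>2" using T by (auto simp: B_def b_def power2_eq_square simp flip: powr_add)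
  have D: "0 \<le> D" "D \<le> B / b" using floor_powsum_bounds(5)[OF T, of \<sigma>] \<sigma> by (auto simp: D_def M_def B_def b_def powsum_nonneg)
  have S1: "powsum (1 - 2 * \<sigma>) M \<le> B\<^sup>2 / (2 * b)"
    using floor_powsum_bounds(5)[OF T, of "2 * \<sigma> - 1"] \<sigma> B by (simp add: M_def b_def algebra_simps)
  have "integral {1..T} (\<lambda>t. t powr a * zeta_sq \<sigma> t) \<le>
    integral {1..T} (\<lambda>t. t powr a * dpoly_sq \<sigma> M t) + 2 * powsum (-\<sigma>) M * T powr (1 - \<sigma>) * J
      + 3 * T powr a * (T powr (1 - \<sigma>))\<^sup>2"
    unfolding M_def using \<sigma> a by (intro weighted_zeta_le J T) auto
  also have "... = integral {1..T} (\<lambda>t. t powr a * dpoly_sq \<sigma> M t) + 2 * D * B * J + 3 * T powr a * B\<^sup>2"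
    by (simp add: D_def B_def b_def)
  also have "integral {1..T} (\<lambda>t. t powr a * dpoly_sq \<sigma> M t) \<le> T powr (1 + a) / (1 + a) * powsum (-2 * \<sigma>) M + T powr a * (pi * powsum (1 - 2 * \<sigma>) M + (powsum (-\<sigma>) M)\<^sup>2 / 4)"
    using T a by (intro weighted_mean_square_le_quarter) auto
  also have "pi * powsum (1 - 2 * \<sigma>) M + (powsum (-\<sigma>) M)\<^sup>2 / 4 \<le> 315/100 * (B\<^sup>2 / (2 * b)) + (B / b)\<^sup>2 / 4"
    using pi_approx S1 D by (intro add_mono mult_mono divide_right_mono power_mono) (auto simp: powsum_nonneg D_def)
  also have "2 * D * B * J \<le> 2 * (B / b) * B * J"
    using D J B by (intro mult_right_mono mult_left_mono) auto
  finally have "integral {1..T} (\<lambda>t. t powr a * zeta_sq \<sigma> t) \<le> T powr (1 + a) / (1 + a) * powsum (-2 * \<sigma>) M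
     + T powr a * (315/100 * (B\<^sup>2 / (2 * b)) + (B / b)\<^sup>2 / 4) + 2 * (B / b) * B * J + 3 * T powr a * B\<^sup>2"
    by (simp add: mult_left_mono)
  also have "... = T powr (1 + a) / (1 + a) * powsum (-(2 * \<sigma>)) M + T powr a * B\<^sup>2 * (63/40 / b + 1/4 / b\<^sup>2 + 3) + 2 / b * B\<^sup>2 * J"
    using b by (simp add: power_divide power2_eq_square algebra_simps)
  finally show ?thesis by (simp add: B_def)
qed

text \<open>The sum stays truncated, to be compared with the zeta value in one case and with
  \<open>1 + 1 / a\<close> in the other.\<close>

lemma mean_square_zeta_right_powsum:
  fixes \<sigma> T :: real
  assumes \<sigma>: "1/2 < \<sigma>" "\<sigma> < 1" and T: "4 \<le> T"
  defines "b \<equiv> 1 - \<sigma>" and "M \<equiv> nat \<lfloor>T\<rfloor>"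
  shows "integral {1..T} (\<lambda>t. zeta_sq \<sigma> t) \<le> T * powsum (-(2 * \<sigma>)) M
      + (T powr b)\<^sup>2 * (63/40 / b + 1/4 / b\<^sup>2 + 3 + 2 / b * (9/8 * ln T + 8/5))"
proof -
  have "integral {1..T} (\<lambda>t. t powr 0 * zeta_sq \<sigma> t) \<le>
    T powr (1 + 0) / (1 + 0) * powsum (-(2 * \<sigma>)) M
      + T powr 0 * (T powr b)\<^sup>2 * (63/40 / b + 1/4 / b\<^sup>2 + 3) + 2 / b * (T powr b)\<^sup>2 * (9/8 * ln T + 8/5)"
    unfolding b_def M_def using \<sigma> ln_bounds[OF T] by (intro weighted_zeta_strip_le integral_remainder_weight_le T) auto
  then show ?thesis using T unfolding integral_powr_zero_mult by (simp add: algebra_simps)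
qed

lemma mean_square_zeta_right:
  fixes \<sigma> T :: real
  assumes \<sigma>: "1/2 < \<sigma>" "\<sigma> < 1" and T: "4 \<le> T"
  shows "integral {1..T} (\<lambda>t. zeta_sq \<sigma> t) \<le> Re (zeta (of_real (2 * \<sigma>))) * T
           + 2.12 / ((\<sigma> - 1/2) * (1 - \<sigma>)\<^sup>2) * (T powr (2 - 2 * \<sigma>) * ln T)"
proof -
  define M where "M = nat \<lfloor>T\<rfloor>"
  define b where "b = 1 - \<sigma>"
  define L where "L = ln T"
  define B where "B = T powr b"
  have b: "0 < b" "b < 1/2" using \<sigma> by (auto simp: b_def)
  have L: "4/3 \<le> L" using ln_bounds[OF T] by (simp add: L_def)
  have B: "T powr (2 - 2 * \<sigma>) = B\<^sup>2" using T by (auto simp: B_def b_def power2_eq_square simp flip: powr_add)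
  have 1: "integral {1..T} (\<lambda>t. zeta_sq \<sigma> t) \<le> T * powsum (-(2 * \<sigma>)) M
      + B\<^sup>2 * (63/40 / b + 1/4 / b\<^sup>2 + 3 + 2 / b * (9/8 * L + 8/5))"
    using mean_square_zeta_right_powsum[OF assms] by (simp only: B_def b_def M_def L_def)
  have "T * powsum (-(2 * \<sigma>)) M \<le> Re (zeta (of_real (2 * \<sigma>))) * T"
    using T powsum_le_zeta[of "2 * \<sigma>" M] \<sigma> by (simp add: mult.commute mult_left_mono)
  moreover have "B\<^sup>2 * (63/40 / b + 1/4 / b\<^sup>2 + 3 + 2 / b * (9/8 * L + 8/5)) \<le> 2.12 / ((\<sigma> - 1/2) * (1 - \<sigma>)\<^sup>2) * (B\<^sup>2 * L)"
  proof -
    have "B\<^sup>2 * (63/40 / b + 1/4 / b\<^sup>2 + 3 + 2 / b * (9/8 * L + 8/5))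
      = (B / b)\<^sup>2 * (315/200 * b + 1/4 + 2 * b * (9/8 * L + 8/5) + 3 * b\<^sup>2)"
      using b by (simp add: field_simps power2_eq_square)
    \<comment> \<open>With \<open>b < 1/2\<close> and \<open>L \<ge> 4/3\<close>. The constant is
      twice \<open>2.12\<close>, and the factor 2 is then replaced by
      \<open>1 / (\<sigma> - 1/2)\<close>.\<close>
    also have "... \<le> (B / b)\<^sup>2 * (424/100 * L)"
    proof (rule mult_left_mono)
      have "b * L \<le> 1/2 * L" using b L by (intro mult_right_mono) auto
      moreover have "b\<^sup>2 \<le> (1/2)\<^sup>2" using b by (intro power_mono) auto
      moreover have "315/200 * b + 1/4 + 9/4 * y + 16/5 * b + 3 * z \<le> 424/100 * L" if "y \<le> 1/2 * L" "z \<le> (1/2)\<^sup>2" for y z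
        using that b L by (simp add: power2_eq_square)
      moreover have "2 * b * (9/8 * L + 8/5) = 9/4 * (b * L) + 16/5 * b" by (simp add: algebra_simps)
      ultimately show "315/200 * b + 1/4 + 2 * b * (9/8 * L + 8/5) + 3 * b\<^sup>2 \<le> 424/100 * L"
        by (simp only: add.assoc)
    qed simp
    also have "... = 424/100 / b\<^sup>2 * (B\<^sup>2 * L)" by (simp add: power_divide)
    also have "424/100 / b\<^sup>2 \<le> 2.12 / ((\<sigma> - 1/2) * (1 - \<sigma>)\<^sup>2)"
    proof -
      have "2 \<le> 1 / (\<sigma> - 1/2)" using \<sigma> by (simp add: le_divide_eq)
      then have "2.12 / b\<^sup>2 * 2 \<le> 2.12 / b\<^sup>2 * (1 / (\<sigma> - 1/2))" by (intro mult_left_mono) auto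
      moreover have "2.12 / ((\<sigma> - 1/2) * (1 - \<sigma>)\<^sup>2) = 2.12 / b\<^sup>2 * (1 / (\<sigma> - 1/2))" by (simp add: b_def)
      moreover have "424/100 / b\<^sup>2 = 2.12 / b\<^sup>2 * 2" by simp
      ultimately show ?thesis by (simp only:)
    qed
    finally show ?thesis using L by (simp add: mult_right_mono)
  qed
  ultimately show ?thesis using 1 unfolding B L_def by linarith
qed


text \<open>The pointwise bound in \<open>weighted_zeta_le\<close> would give about
  \<open>4.5 * T * ln T\<close> in the cross term. AM-GM uses the mean square of the polynomial
  instead and costs only \<open>2 * T * k\<close>.\<close>

lemma mean_square_zeta_half:
  fixes T :: real
  assumes T: "4 \<le> T"
  shows "integral {1..T} (\<lambda>t. zeta_sq (1/2) t) \<le> T * ln T + 2 * T * sqrt (ln T) + 21.16 * T"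
proof -
  define M where "M = nat \<lfloor>T\<rfloor>"
  define N where "N = real (Suc M)"
  define P where "P = dpoly_sq (1/2) M"
  define L where "L = ln T"
  define k where "k = sqrt (L + 515/100)"
  \<comment> \<open>The weight in the AM-GM step below: it balances the mean square \<open>T k\<^sup>2\<close> of the polynomial
    against the integral of \<open>N / t\<^sup>2\<close>.\<close>
  note M = floor_powsum_bounds(1,2,3)[OF T, folded M_def]
  have N: "T < N" "N \<le> T + 1" using M by (auto simp: N_def)
  have L: "4/3 \<le> L" "L \<le> 35/100 * T" using ln_bounds[OF T] by (auto simp: L_def)
  have k: "0 < k" "k * k = L + 515/100" using L by (auto simp: k_def)
  have P0: "0 \<le> P t" for t by (simp add: P_def dpoly_sq_def)
  have cP: "continuous_on {1..T} P" unfolding P_def by (rule continuous_on_dpoly_sq)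
  have D: "powsum (-1/2) M \<le> 2 * sqrt (real M)"
    using powsum_le_powr[of "1/2" M] by (simp add: powr_half_sqrt)
  \<comment> \<open>\<open>k\<^sup>2\<close> collects \<open>1 + L\<close> from the diagonal,
    \<open>3.15 \<ge> pi\<close> from Hilbert's inequality, and 1 from
    \<open>(2 * sqrt M)\<^sup>2 / 4\<close>.\<close>
  have intP: "integral {1..T} P \<le> T * k\<^sup>2"
  proof -
    have "integral {1..T} (\<lambda>t. t powr 0 * P t) \<le> T powr (1 + 0) / (1 + 0) * powsum (-2 * (1/2)) M + T powr 0 * (pi * powsum (1 - 2 * (1/2)) M + (powsum (-(1/2)) M)\<^sup>2 / 4)"
      unfolding P_def using T by (intro weighted_mean_square_le_quarter) auto
    also have "... = T * powsum (-1) M + (pi * real M + (powsum (-1/2) M)\<^sup>2 / 4)"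
      using T by (simp add: powsum_def)
    also have "T * powsum (-1) M \<le> T * (1 + L)"
      using floor_powsum_bounds(4)[OF T] T by (intro mult_left_mono) (auto simp: M_def L_def)
    also have "pi * real M \<le> 315/100 * T" using pi_approx M by (intro mult_mono) auto
    also have "(powsum (-1/2) M)\<^sup>2 \<le> (2 * sqrt (real M))\<^sup>2" using D by (intro power_mono powsum_nonneg)
    also have "(2 * sqrt (real M))\<^sup>2 / 4 \<le> T" using M by (simp add: power_mult_distrib)
    finally have "integral {1..T} (\<lambda>t. t powr 0 * P t) \<le> T * (1 + L) + (315/100 * T + T)" by simp
    also have "... = T * k\<^sup>2" using k by (simp add: power2_eq_square algebra_simps)
    finally show ?thesis unfolding integral_powr_zero_mult .
  qed
  \<comment> \<open>Only the part \<open>1 / t\<close> of the remainder goes through AM-GM; for the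
    other, \<open>sqrt (P t) \<le> 2 * sqrt N\<close> suffices and gives
    \<open>32/5\<close>.\<close>
  have pw: "zeta_sq (1/2) t \<le> (1 + 1 / k) * P t + ((k * N) * (1 / t\<^sup>2) + 32/5) + T * (remainder_weight T t)\<^sup>2" if "t \<in> {1..T}" for t
  proof -
    have t: "1 \<le> t" "t \<le> T" using that by auto
    define R where "R = N powr (1 - 1/2) * (1 / t) + 8/5 * N powr (-(1/2))"
    have R: "R \<le> N powr (1 - 1/2) * (1 / t) + 8/5 * N powr (-(1/2))" "0 \<le> R"
      "zeta_sq (1/2) t \<le> P t + 2 * sqrt (P t) * R + R\<^sup>2"
      using norm_zeta_squared_le[of "1/2" t T] t T by (auto simp: R_def M_def N_def P_def)
    have N12: "N powr (1 - 1/2) = sqrt N" "N powr (-(1/2)) = 1 / sqrt N"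
      using N T by (simp_all add: powr_half_sqrt powr_minus_divide)
    have "R \<le> (9/8 * T powr (1 - 1/2)) * (1 / t) + 8/5 * (T powr (1 - 1/2) * (1 / T))"
    proof (rule order.trans[OF R(1)])
      show "N powr (1 - 1/2) * (1 / t) + 8/5 * N powr (-(1/2)) \<le> (9/8 * T powr (1 - 1/2)) * (1 / t) + 8/5 * (T powr (1 - 1/2) * (1 / T))"
        unfolding N_def M_def using t T by (intro add_mono mult_right_mono mult_left_mono Suc_floor_powr_le) auto
    qed
    also have "... = sqrt T * remainder_weight T t" using T by (simp add: remainder_weight_def powr_half_sqrt algebra_simps)
    finally have "R\<^sup>2 \<le> (sqrt T * remainder_weight T t)\<^sup>2" using R(2) by (rule power_mono)
    then have 1: "R\<^sup>2 \<le> T * (remainder_weight T t)\<^sup>2" using T by (simp add: power_mult_distrib)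
    have "2 * sqrt (P t) * R \<le> 2 * sqrt (P t) * (sqrt N * (1 / t) + 8/5 * (1 / sqrt N))"
      using R(1) P0 unfolding N12 by (intro mult_left_mono) auto
    also have "... = 2 * sqrt (P t) * (sqrt N / t) + 16/5 * (sqrt (P t) / sqrt N)" by (simp add: algebra_simps)
    also have "2 * sqrt (P t) * (sqrt N / t) \<le> P t / k + k * (N / t\<^sup>2)"
    proof -
      have "0 \<le> (sqrt (P t) / sqrt k - sqrt k * (sqrt N / t))\<^sup>2" by simp
      also have "... = P t / k + k * (N / t\<^sup>2) - 2 * (sqrt (P t) / sqrt k) * (sqrt k * (sqrt N / t))"
        using P0[of t] k N T by (simp add: power2_diff power_divide power_mult_distrib)
      also have "2 * (sqrt (P t) / sqrt k) * (sqrt k * (sqrt N / t)) = 2 * sqrt (P t) * (sqrt N / t)" using k by simp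
      finally show ?thesis by simp
    qed
    also have "sqrt (P t) / sqrt N \<le> 2"
    proof -
      have "sqrt (P t) \<le> 2 * sqrt (real M)" using sqrt_dpoly_sq_le[of "1/2" M t] D by (simp add: P_def)
      also have "... \<le> 2 * sqrt N" by (simp add: N_def)
      finally show ?thesis using N T by (simp add: divide_le_eq)
    qed
    finally have "2 * sqrt (P t) * R \<le> P t / k + k * (N / t\<^sup>2) + 32/5" by simp
    then show ?thesis using R(3) 1 by (simp add: algebra_simps)
  qed
  have i1: "(\<lambda>t. (1 + 1 / k) * P t) integrable_on {1..T}"
    by (intro integrable_continuous_interval continuous_intros cP)
  have i2: "(\<lambda>t. T * (remainder_weight T t)\<^sup>2) integrable_on {1..T}"
    by (rule has_integral_integrable[OF has_integral_mult_right[OF integrable_integral[OF integral_remainder_weight_square_le(1)[OF T]]]])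
  note i = i1 i2
  have j: "((\<lambda>t. (k * N) * (1 / t\<^sup>2) + 32/5) has_integral (k * N) * (1 - 1 / T) + (T - 1) * (32/5)) {1..T}"
    using T has_integral_const_real[of "32/5 :: real" 1 T]
    by (intro has_integral_add has_integral_mult_right has_integral_inverse_square) auto
  have "integral {1..T} (\<lambda>t. zeta_sq (1/2) t) \<le> integral {1..T} (\<lambda>t. (1 + 1 / k) * P t + ((k * N) * (1 / t\<^sup>2) + 32/5) + T * (remainder_weight T t)\<^sup>2)"
    by (intro integral_le pw integrable_add[OF integrable_add[OF i1 has_integral_integrable[OF j]] i2]
      integrable_continuous_interval[OF continuous_on_norm_zeta_Icc])
  also have "... = (1 + 1 / k) * integral {1..T} P + ((k * N) * (1 - 1 / T) + (T - 1) * (32/5)) + T * integral {1..T} (\<lambda>t. (remainder_weight T t)\<^sup>2)"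
    unfolding integral_add[OF integrable_add[OF i1 has_integral_integrable[OF j]] i2]
      integral_add[OF i1 has_integral_integrable[OF j]] integral_unique[OF j] by simp
  also have "... \<le> (1 + 1 / k) * (T * k\<^sup>2) + (k * T + T * (32/5)) + T * 3"
  proof (intro add_mono mult_left_mono intP integral_remainder_weight_square_le(2) T)
    have "N * (1 - 1 / T) \<le> (T + 1) * (1 - 1 / T)" using N T by (intro mult_right_mono) auto
    also have "... \<le> T" using T by (simp add: field_simps)
    finally show "k * N * (1 - 1 / T) \<le> k * T" using k by (simp add: mult.assoc mult_left_mono)
  qed (use k T in auto)
  \<comment> \<open>\<open>T * k\<close> occurs twice, once from
    \<open>(1 + 1 / k) * k\<^sup>2\<close>; the rest is \<open>32/5 + 3\<close>.\<close>
  also have "... = T * (k * k) + 2 * T * k + 94/10 * T"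
    using k(1) by (simp add: field_simps power2_eq_square)
  also have "... = T * L + 2 * T * k + (515/100 + 94/10) * T"
    unfolding k(2) by (simp add: algebra_simps)
  also have "k \<le> sqrt L + 227/100"
  proof -
    have "k \<le> sqrt L + sqrt (515/100)" unfolding k_def using L by (intro sqrt_add_le_add_sqrt) auto
    also have "sqrt (515/100) \<le> (227/100 :: real)" by (rule real_le_lsqrt) (auto simp: power2_eq_square)
    finally show ?thesis by simp
  qed
  finally have "integral {1..T} (\<lambda>t. zeta_sq (1/2) t) \<le> T * L + 2 * T * (sqrt L + 227/100) + (515/100 + 94/10) * T"
    using T by (simp add: mult_left_mono)
  also have "... \<le> T * L + 2 * T * sqrt L + 21.16 * T" using T by (simp add: algebra_simps)
  finally show ?thesis by (simp add: L_def)
qed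


text \<open>Integral comparison after the first term. It makes the pole at \<open>p = 1\<close>
  explicit, so that a factor \<open>p - 1\<close> can cancel it.\<close>

lemma powsum_le_gt_one:
  fixes p :: real
  assumes p: "1 < p"
  shows "powsum (-p) M \<le> 1 + 1 / (p - 1)"
proof (cases "M = 0")
  case True
  then show ?thesis using p by (simp add: powsum_def)
next
  case False
  then have "1 \<le> M" by simp
  then have "powsum (-p) M \<le> 1 + (1 - real M powr (1 - p)) / (p - 1)"
  proof (induction M rule: dec_induct)
    case (step n)
    have "((\<lambda>x. x powr (1 - p)) has_real_derivative (1 - p) * x powr (-p)) (at x)" if "real n \<le> x" for x
      using that step by (auto intro!: derivative_eq_intros)
    then obtain z where z: "real n < z" "z < real (Suc n)"
      "real (Suc n) powr (1 - p) - real n powr (1 - p) = (real (Suc n) - real n) * ((1 - p) * z powr (-p))"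
      using MVT2[of "real n" "real (Suc n)" "\<lambda>x. x powr (1 - p)" "\<lambda>x. (1 - p) * x powr (-p)"] by auto
    have "real (Suc n) powr (-p) \<le> z powr (-p)" using z p by (intro powr_mono2') auto
    then have "(p - 1) * real (Suc n) powr (-p) \<le> (p - 1) * z powr (-p)" using p by (intro mult_left_mono) auto
    also have "... = real n powr (1 - p) - real (Suc n) powr (1 - p)" using z(3) by (simp add: algebra_simps)
    finally have "real (Suc n) powr (-p) \<le> (real n powr (1 - p) - real (Suc n) powr (1 - p)) / (p - 1)"
      using p by (simp add: pos_le_divide_eq mult.commute del: of_nat_Suc)
    then show ?case using step.IH by (simp add: powsum_def diff_divide_distrib del: of_nat_Suc)
  qed (simp add: powsum_def)
  also have "... \<le> 1 + 1 / (p - 1)" using p by (intro add_left_mono divide_right_mono) auto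
  finally show ?thesis .
qed

text \<open>Concavity, in the form of Young's inequality with exponents \<open>a\<close> and
  \<open>1 - a\<close>. The factor \<open>a\<close> in the correction later cancels the
  \<open>1 / a\<close> of the diagonal sum.\<close>

lemma add_two_powr_le:
  fixes t a :: real
  assumes "1 \<le> t" "0 < a" "a \<le> 1"
  shows "(t + 2) powr a \<le> t powr a + 2 * a"
proof -
  have "(1 + 2 / t) powr a * 1 powr (1 - a) \<le> a * (1 + 2 / t) + (1 - a) * 1"
    using assms by (intro Youngs_inequality_0) (auto intro: add_pos_pos)
  then have "(1 + 2 / t) powr a \<le> 1 + a * (2 / t)" by (simp add: algebra_simps)
  then have "t powr a * (1 + 2 / t) powr a \<le> t powr a * (1 + a * (2 / t))" by (intro mult_left_mono) auto
  also have "t powr a * (1 + 2 / t) powr a = (t * (1 + 2 / t)) powr a" using assms by (subst powr_mult) auto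
  also have "t * (1 + 2 / t) = t + 2" using assms by (simp add: field_simps)
  also have "t powr a * (1 + a * (2 / t)) = t powr a + 2 * a * (t powr a / t)" by (simp add: algebra_simps)
  also have "t powr a / t \<le> 1"
  proof -
    have "t powr a \<le> t powr 1" using assms by (intro powr_mono) auto
    then show ?thesis using assms by simp
  qed
  finally show ?thesis using assms by (simp add: mult_left_mono)
qed

text \<open>Splitting \<open>(t + 2) powr a\<close> separates the weighted mean square, which
  carries the main term, from an unweighted one of lower order.\<close>

lemma mean_square_reflection_le:
  fixes x T :: real
  assumes x: "1/2 < x" "x \<le> 1" and T: "4 \<le> T"
  defines "a \<equiv> 2 * x - 1"
  shows "integral {1..T} (\<lambda>t. zeta_sq (1 - x) t) \<le>
    (2 * pi) powr (-a) * (integral {1..T} (\<lambda>t. t powr a * zeta_sq x t)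
       + 2 * a * integral {1..T} (\<lambda>t. zeta_sq x t))"
proof -
  have i: "(\<lambda>t. zeta_sq x t) integrable_on {1..T}"
    by (rule integrable_continuous_interval[OF continuous_on_norm_zeta_Icc])
  have I: "((\<lambda>t. (2 * pi) powr (-a) * (t powr a * zeta_sq x t + 2 * a * zeta_sq x t)) has_integral
     (2 * pi) powr (-a) * (integral {1..T} (\<lambda>t. t powr a * zeta_sq x t)
       + 2 * a * integral {1..T} (\<lambda>t. zeta_sq x t))) {1..T}"
    by (intro has_integral_mult_right has_integral_add integrable_integral integrable_weighted_zeta i)
  show ?thesis
  proof (rule has_integral_le[OF integrable_integral[OF integrable_continuous_interval[OF continuous_on_norm_zeta_Icc]] I])
    fix t assume "t \<in> {1..T}"
    then have t: "1 \<le> t" by simp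
    have "zeta_sq (1 - x) t \<le> ((t + 2) / (2 * pi)) powr a * zeta_sq x t"
      unfolding a_def using x t by (intro norm_zeta_reflection_le) auto
    also have "((t + 2) / (2 * pi)) powr a = (2 * pi) powr (-a) * (t + 2) powr a"
      using t by (simp add: powr_divide powr_minus_divide)
    also have "(t + 2) powr a \<le> t powr a + 2 * a"
      using x t by (intro add_two_powr_le) (auto simp: a_def)
    finally show "zeta_sq (1 - x) t \<le> (2 * pi) powr (-a) * (t powr a * zeta_sq x t + 2 * a * zeta_sq x t)"
      by (simp add: algebra_simps mult_left_mono mult_right_mono)
  qed
qed

lemma mean_square_zeta_left:
  fixes \<sigma> T :: real
  assumes \<sigma>: "0 < \<sigma>" "\<sigma> < 1/2" and T: "4 \<le> T"
  shows "integral {1..T} (\<lambda>t. zeta_sq \<sigma> t) \<le>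
     Re (zeta (of_real (2 - 2 * \<sigma>))) / ((2 * pi) powr (1 - 2 * \<sigma>) * (2 - 2 * \<sigma>)) * T powr (2 - 2 * \<sigma>)
           + 7.75 / (\<sigma>\<^sup>2 * (1/2 - \<sigma>)) * T"
proof -
  define M where "M = nat \<lfloor>T\<rfloor>"
  define x where "x = 1 - \<sigma>"
  define a where "a = 1 - 2 * \<sigma>"
  define L where "L = ln T"
  define B where "B = T powr \<sigma>"
  define S where "S = powsum (-(2 * x)) M"
  define K where "K = 63/40 / \<sigma> + 1/4 / \<sigma>\<^sup>2 + 3"
  have x: "1/2 < x" "x < 1" "1 - x = \<sigma>" "2 * x - 1 = a" "2 * x = 2 - 2 * \<sigma>" using \<sigma> by (auto simp: x_def a_def)
  have a: "0 < a" "a < 1" using \<sigma> by (auto simp: a_def)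
  have K: "0 \<le> K" using \<sigma> by (simp add: K_def)
  have B2: "B\<^sup>2 = T powr (1 - a)" using T by (simp add: B_def a_def power2_eq_square flip: powr_add)
  \<comment> \<open>Because \<open>a + 2 * \<sigma> = 1\<close>, the secondary terms at weight
    \<open>T powr a\<close> are multiples of \<open>T\<close>.\<close>
  have TB: "T powr a * B\<^sup>2 = T" unfolding B2 using T by (simp flip: powr_add)
  have B2T: "B\<^sup>2 \<le> T"
  proof -
    have "T powr (1 - a) \<le> T powr 1" using T a by (intro powr_mono) auto
    then show ?thesis using T by (simp add: B2)
  qed
  \<comment> \<open>The logarithm of the unweighted mean square is absorbed by
    \<open>ln y \<le> y\<close> at \<open>y = T powr a\<close>; the factor \<open>a\<close> comes
    from the correction in \<open>add_two_powr_le\<close>.\<close>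
  have B2L: "a * (B\<^sup>2 * L) \<le> T"
  proof -
    have "a * L = ln (T powr a)" using T by (simp add: L_def ln_powr)
    also have "... \<le> T powr a" using T ln_le_minus_one[of "T powr a"] by simp
    finally have "B\<^sup>2 * (a * L) \<le> B\<^sup>2 * T powr a" by (intro mult_left_mono) auto
    then show ?thesis using TB by (simp add: mult_ac)
  qed
  have S0: "S \<le> 1 + 1 / a" unfolding S_def using powsum_le_gt_one[of "2 * x" M] x a by (simp add: a_def)
  have Sz: "S \<le> Re (zeta (of_real (2 - 2 * \<sigma>)))"
    using powsum_le_zeta[of "2 * x" M] x by (simp add: S_def)
  define W1 where "W1 = integral {1..T} (\<lambda>t. t powr a * zeta_sq x t)"
  define W0 where "W0 = integral {1..T} (\<lambda>t. zeta_sq x t)"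
  have "W1 \<le> T powr (1 + a) / (1 + a) * powsum (-(2 * x)) M
      + T powr a * (T powr (1 - x))\<^sup>2 * (63/40 / (1 - x) + 1/4 / (1 - x)\<^sup>2 + 3) + 2 / (1 - x) * (T powr (1 - x))\<^sup>2 * (T powr a * (9 / (8 * a) + 8/5))"
    unfolding W1_def M_def using a x by (intro weighted_zeta_strip_le integral_powr_remainder_weight_le T) auto
  also have "... = T powr (1 + a) / (1 + a) * S + (T powr a * B\<^sup>2) * K + 2 / \<sigma> * (T powr a * B\<^sup>2) * (9 / (8 * a) + 8/5)"
    by (simp add: S_def B_def K_def x(3) mult_ac)
  finally have W1: "W1 \<le> T powr (1 + a) / (1 + a) * S + T * (K + 2 / \<sigma> * (9 / (8 * a) + 8/5))"
    unfolding TB by (simp add: algebra_simps)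
  have "W0 \<le> T * S + B\<^sup>2 * (K + 2 / \<sigma> * (9/8 * L + 8/5))"
    using mean_square_zeta_right_powsum[OF x(1,2) T] unfolding W0_def x by (simp only: S_def B_def K_def L_def M_def x add.assoc)
  then have "2 * a * W0 \<le> 2 * a * (T * S + B\<^sup>2 * (K + 2 / \<sigma> * (9/8 * L + 8/5)))"
    using a by (intro mult_left_mono) auto
  also have "... = T * (2 * (a * S)) + 2 * a * (B\<^sup>2 * (K + 16/5 / \<sigma>)) + 9/2 / \<sigma> * (a * (B\<^sup>2 * L))"
    by (simp add: algebra_simps)
  also have "... \<le> T * (2 * (a + 1)) + 2 * a * (T * (K + 16/5 / \<sigma>)) + 9/2 / \<sigma> * T"
  proof (intro add_mono mult_left_mono mult_right_mono)
    have "a * S \<le> a * (1 + 1 / a)" using S0 a by (intro mult_left_mono) auto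
    then show "a * S \<le> a + 1" using a by (simp add: algebra_simps)
  qed (use B2T B2L a \<sigma> T K in auto)
  finally have W0: "2 * a * W0 \<le> T * (2 * (a + 1) + 2 * a * (K + 16/5 / \<sigma>) + 9/2 / \<sigma>)"
    by (simp add: algebra_simps)
  \<comment> \<open>After multiplication by \<open>\<sigma>\<^sup>2 * c\<close> every term is a
    monomial in \<open>\<sigma>\<close> and \<open>c\<close>, both below \<open>1/2\<close>; bounded
    one by one they stay below 7.75.\<close>
  have E: "K + 2 / \<sigma> * (9 / (8 * a) + 8/5) + (2 * (a + 1) + 2 * a * (K + 16/5 / \<sigma>) + 9/2 / \<sigma>) \<le> 7.75 / (\<sigma>\<^sup>2 * (1/2 - \<sigma>))"
  proof -
    define c where "c = 1/2 - \<sigma>"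
    have c: "0 < c" "c < 1/2" "a = 2 * c" using \<sigma> by (auto simp: c_def a_def)
    have m: "\<sigma> * c \<le> 1/2 * (1/2)" "\<sigma> * \<sigma> * c \<le> 1/2 * (1/2) * (1/2)" "\<sigma> * (c * c) \<le> 1/2 * (1/2 * (1/2))" "c * c \<le> 1/2 * (1/2)" "\<sigma> * \<sigma> * (c * c) \<le> 1/2 * (1/2) * (1/2 * (1/2))"
      using \<sigma> c by (intro mult_mono; simp)+
    have "(K + 2 / \<sigma> * (9 / (8 * a) + 8/5) + (2 * (a + 1) + 2 * a * (K + 16/5 / \<sigma>) + 9/2 / \<sigma>)) * (\<sigma>\<^sup>2 * c)
      = 63/40 * (\<sigma> * c) + 1/4 * c + 3 * (\<sigma> * \<sigma> * c) + 9/8 * \<sigma> + 16/5 * (\<sigma> * c) + 63/10 * (\<sigma> * (c * c)) + c * c + 12 * (\<sigma> * \<sigma> * (c * c))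
        + 64/5 * (\<sigma> * (c * c)) + 4 * (\<sigma> * \<sigma> * (c * c)) + 2 * (\<sigma> * \<sigma> * c) + 9/2 * (\<sigma> * c)"
      unfolding K_def c using \<sigma> c by (simp add: field_simps power2_eq_square)
    also have "... \<le> 7.75" using m \<sigma> c by simp
    finally show ?thesis
      unfolding c_def[symmetric] using pos_le_divide_eq[of "\<sigma>\<^sup>2 * c"] \<sigma> c(1) by (simp only: mult_pos_pos zero_less_power)
  qed
  have "integral {1..T} (\<lambda>t. zeta_sq \<sigma> t) \<le> (2 * pi) powr (-a) * (W1 + 2 * a * W0)"
    using mean_square_reflection_le[OF x(1) less_imp_le[OF x(2)] T] unfolding x(3,4) W1_def W0_def .
  also have "... \<le> (2 * pi) powr (-a) * (T powr (1 + a) / (1 + a) * S + T * (7.75 / (\<sigma>\<^sup>2 * (1/2 - \<sigma>))))"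
  proof (rule mult_left_mono)
    have "W1 + 2 * a * W0 \<le> T powr (1 + a) / (1 + a) * S + T * (K + 2 / \<sigma> * (9 / (8 * a) + 8/5) + (2 * (a + 1) + 2 * a * (K + 16/5 / \<sigma>) + 9/2 / \<sigma>))"
      using W1 W0 by (simp add: distrib_left)
    also have "... \<le> T powr (1 + a) / (1 + a) * S + T * (7.75 / (\<sigma>\<^sup>2 * (1/2 - \<sigma>)))"
      using T by (intro add_left_mono mult_left_mono E) auto
    finally show "W1 + 2 * a * W0 \<le> T powr (1 + a) / (1 + a) * S + T * (7.75 / (\<sigma>\<^sup>2 * (1/2 - \<sigma>)))" .
  qed simp
  also have "... = (2 * pi) powr (-a) * (T powr (1 + a) / (1 + a)) * S + (2 * pi) powr (-a) * (7.75 / (\<sigma>\<^sup>2 * (1/2 - \<sigma>)) * T)"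
    by (simp add: algebra_simps)
  also have "... \<le> (2 * pi) powr (-a) * (T powr (1 + a) / (1 + a)) * Re (zeta (of_real (2 - 2 * \<sigma>))) + 1 * (7.75 / (\<sigma>\<^sup>2 * (1/2 - \<sigma>)) * T)"
  proof (intro add_mono mult_left_mono mult_right_mono Sz)
    have "1 \<le> (2 * pi) powr a" using pi_gt3 a by (intro ge_one_powr_ge_zero) auto
    then show "(2 * pi) powr (-a) \<le> 1" by (simp add: powr_minus_divide)
  qed (use a T \<sigma> in auto)
  also have "(2 * pi) powr (-a) * (T powr (1 + a) / (1 + a)) * Re (zeta (of_real (2 - 2 * \<sigma>))) = Re (zeta (of_real (2 - 2 * \<sigma>))) / ((2 * pi) powr (1 - 2 * \<sigma>) * (2 - 2 * \<sigma>)) * T powr (2 - 2 * \<sigma>)"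
  proof -
    have "1 + a = 2 - 2 * \<sigma>" "(2 * pi) powr (-a) = 1 / (2 * pi) powr (1 - 2 * \<sigma>)"
      by (simp_all add: a_def powr_minus_divide[symmetric])
    then show ?thesis by simp
  qed
  finally show ?thesis by simp
qed

text \<open>Reflection with \<open>x = 1\<close> and \<open>a = 1\<close>: the factor
  \<open>1 / (2 * pi)\<close> turns \<open>pi\<^sup>2 / 12\<close> into \<open>pi / 24\<close>. The
  averaged estimate is used since it has \<open>T\<close> times the harmonic sum, not its
  square.\<close>

lemma mean_square_zeta_zero:
  fixes T :: real
  assumes T: "4 \<le> T"
  shows "integral {1..T} (\<lambda>t. zeta_sq 0 t) \<le> pi / 24 * T\<^sup>2 + 9.3 * T * ln T"
proof -
  define M where "M = nat \<lfloor>T\<rfloor>"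
  define H where "H = powsum (-1) M"
  define L where "L = ln T"
  have L: "4/3 \<le> L" "L \<le> 35/100 * T" using ln_bounds[OF T] by (auto simp: L_def)
  have H: "0 \<le> H" "H \<le> 1 + L" using floor_powsum_bounds(4)[OF T] by (auto simp: H_def M_def L_def powsum_nonneg)
  define W1 where "W1 = integral {1..T} (\<lambda>t. t powr 1 * zeta_sq 1 t)"
  define W0 where "W0 = integral {1..T} (\<lambda>t. zeta_sq 1 t)"
  have pi2: "pi\<^sup>2 / 6 \<le> 166/100"
  proof -
    have "pi\<^sup>2 \<le> (315/100)\<^sup>2" using pi_approx by (intro power_mono) auto
    then show ?thesis by (simp add: power2_eq_square)
  qed
  have sqT: "sqrt T \<le> T / 2" using T by (intro real_le_lsqrt) (auto simp: power2_eq_square)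
  have W0: "2 * W0 \<le> 22 * T"
  proof -
    have "W0 \<le> pi\<^sup>2 / 6 * T + 18.34 * sqrt T" unfolding W0_def by (rule mean_square_zeta_one[OF T])
    also have "pi\<^sup>2 / 6 * T \<le> 166/100 * T" using pi2 T by (intro mult_right_mono) auto
    also have "18.34 * sqrt T \<le> 18.34 * (T / 2)" using sqT by (intro mult_left_mono) auto
    finally have "W0 \<le> 166/100 * T + 18.34 * (T / 2)" by simp
    then show ?thesis using T by simp
  qed
  have "W1 \<le> integral {1..T} (\<lambda>t. t powr 1 * dpoly_sq 1 M t) + 2 * powsum (-1) M * T powr (1 - 1) * (T powr 1 * (9 / (8 * 1) + 8/5)) + 3 * T powr 1 * (T powr (1 - 1))\<^sup>2"
    unfolding W1_def M_def using T by (intro weighted_zeta_le integral_powr_remainder_weight_le) auto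
  also have "... = integral {1..T} (\<lambda>t. t * dpoly_sq 1 M t) + 109/20 * (H * T) + 3 * T"
  proof -
    have "integral {1..T} (\<lambda>t. t powr 1 * dpoly_sq 1 M t) = integral {1..T} (\<lambda>t. t * dpoly_sq 1 M t)"
      by (rule integral_cong) auto
    then show ?thesis using T by (simp add: H_def)
  qed
  also have "integral {1..T} (\<lambda>t. t * dpoly_sq 1 M t) \<le> (T + 1)\<^sup>2 / 2 * powsum (-2) M + (T + 1) * ((pi + 8) * powsum (-1) M) + (powsum (-1) M)\<^sup>2 * (3 / 80)"
    using T by (intro weighted_mean_square_one_le) auto
  also have "(T + 1)\<^sup>2 / 2 * powsum (-2) M \<le> (T + 1)\<^sup>2 / 2 * (pi\<^sup>2 / 6)"
    by (intro mult_left_mono powsum_minus_two_le) auto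
  also have "(T + 1)\<^sup>2 / 2 * (pi\<^sup>2 / 6) = pi\<^sup>2 / 12 * T\<^sup>2 + (T + 1/2) * (pi\<^sup>2 / 6)"
    by (simp add: power2_eq_square field_simps)
  also have "(T + 1/2) * (pi\<^sup>2 / 6) \<le> (9/8 * T) * (166/100)" using T pi2 by (intro mult_mono) auto
  also have "(T + 1) * ((pi + 8) * powsum (-1) M) \<le> (5/4 * T) * ((1115/100) * (1 + L))"
    using T H L pi_approx by (intro mult_mono mult_nonneg_nonneg) (auto simp: H_def)
  \<comment> \<open>This square comes without a factor \<open>T\<close>, so one of its two factors
    may be bounded by \<open>T\<close>.\<close>
  also have "(powsum (-1) M)\<^sup>2 * (3 / 80) \<le> ((1 + L) * T) * (3 / 80)"
    using H L T unfolding power2_eq_square H_def by (intro mult_right_mono mult_mono) auto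
  also have "109/20 * (H * T) \<le> 109/20 * ((1 + L) * T)" using H T by (intro mult_left_mono mult_right_mono) auto
  finally have "W1 \<le> pi\<^sup>2 / 12 * T\<^sup>2 + (9/8 * T) * (166/100) + (5/4 * T) * ((1115/100) * (1 + L)) + ((1 + L) * T) * (3 / 80) + 109/20 * ((1 + L) * T) + 3 * T"
    by simp
  also have "... = pi\<^sup>2 / 12 * T\<^sup>2 + T * (9/8 * (166/100) + (5/4 * (1115/100) + 3/80 + 109/20) * (1 + L) + 3)"
    by (simp add: field_simps)
  finally have "W1 + 2 * W0 \<le> pi\<^sup>2 / 12 * T\<^sup>2 + T * (9/8 * (166/100) + (5/4 * (1115/100) + 3/80 + 109/20) * (1 + L) + 3) + 22 * T"
    using W0 by (rule add_mono)
  also have "... = pi\<^sup>2 / 12 * T\<^sup>2 + T * (9/8 * (166/100) + (5/4 * (1115/100) + 3/80 + 109/20) * (1 + L) + 25)"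
    by (simp add: field_simps)
  also have "... \<le> pi\<^sup>2 / 12 * T\<^sup>2 + T * (558/10 * L)"
  proof (intro add_left_mono mult_left_mono)
    show "9/8 * (166/100) + (5/4 * (1115/100) + 3/80 + 109/20) * (1 + L) + 25 \<le> 558/10 * L"
      using L(1) by (simp add: field_simps)
  qed (use T in auto)
  finally have W: "W1 + 2 * W0 \<le> pi\<^sup>2 / 12 * T\<^sup>2 + T * (558/10 * L)" .
  have "integral {1..T} (\<lambda>t. zeta_sq 0 t) \<le> (2 * pi) powr (-1) * (W1 + 2 * W0)"
    using mean_square_reflection_le[of 1 T] T unfolding W1_def W0_def by simp
  also have "... \<le> (2 * pi) powr (-1) * (pi\<^sup>2 / 12 * T\<^sup>2 + T * (558/10 * L))" by (intro mult_left_mono W) auto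
  also have "... = pi / 24 * T\<^sup>2 + T * L * (558/10 / (2 * pi))"
    by (simp add: powr_minus field_simps power2_eq_square)
  \<comment> \<open>\<open>55.8 / 6 = 9.3\<close>, and \<open>2 * pi > 6\<close>.\<close>
  also have "T * L * (558/10 / (2 * pi)) \<le> T * L * 9.3"
    using T L pi_gt3 by (intro mult_left_mono) (auto simp: divide_le_eq)
  finally show ?thesis by (simp add: L_def mult_ac)
qed

theorem theorem1p2:
  fixes \<sigma> T :: real
  assumes "0 \<le> \<sigma>" and "\<sigma> \<le> 1" and "T \<ge> 4"
  defines "I \<equiv> integral {1..T} (\<lambda>t. (cmod (zeta (Complex \<sigma> t)))\<^sup>2)"
  shows "(\<sigma> = 1 \<longrightarrow> I \<le> pi\<^sup>2 / 6 * T + 18.34 * sqrt T) \<and>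
    (1/2 < \<sigma> \<and> \<sigma> < 1 \<longrightarrow>
       I \<le> Re (zeta (of_real (2 * \<sigma>))) * T
           + 2.12 / ((\<sigma> - 1/2) * (1 - \<sigma>)\<^sup>2) * max (T powr (2 - 2 * \<sigma>) * ln T) (sqrt T)) \<and>
    (\<sigma> = 1/2 \<longrightarrow> I \<le> T * ln T + 2 * T * sqrt (ln T) + 21.16 * T) \<and>
    (0 < \<sigma> \<and> \<sigma> < 1/2 \<longrightarrow>
       I \<le> Re (zeta (of_real (2 - 2 * \<sigma>))) / ((2 * pi) powr (1 - 2 * \<sigma>) * (2 - 2 * \<sigma>))
             * T powr (2 - 2 * \<sigma>)
           + 7.75 / (\<sigma>\<^sup>2 * (1/2 - \<sigma>)) * T) \<and>
    (\<sigma> = 0 \<longrightarrow> I \<le> pi / 24 * T\<^sup>2 + 9.3 * T * ln T)"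
proof (intro conjI impI)
  note T = assms(3)
  show "I \<le> pi\<^sup>2 / 6 * T + 18.34 * sqrt T" if "\<sigma> = 1"
    unfolding I_def that by (rule mean_square_zeta_one[OF T])
  show "I \<le> Re (zeta (of_real (2 * \<sigma>))) * T
           + 2.12 / ((\<sigma> - 1/2) * (1 - \<sigma>)\<^sup>2) * max (T powr (2 - 2 * \<sigma>) * ln T) (sqrt T)" if "1/2 < \<sigma> \<and> \<sigma> < 1"
  proof -
    have "2.12 / ((\<sigma> - 1/2) * (1 - \<sigma>)\<^sup>2) * (T powr (2 - 2 * \<sigma>) * ln T) \<le> 2.12 / ((\<sigma> - 1/2) * (1 - \<sigma>)\<^sup>2) * max (T powr (2 - 2 * \<sigma>) * ln T) (sqrt T)"
      using that by (intro mult_left_mono) auto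
    then show ?thesis unfolding I_def using mean_square_zeta_right[of \<sigma> T] that T by linarith
  qed
  show "I \<le> T * ln T + 2 * T * sqrt (ln T) + 21.16 * T" if "\<sigma> = 1/2"
    unfolding I_def that by (rule mean_square_zeta_half[OF T])
  show "I \<le> Re (zeta (of_real (2 - 2 * \<sigma>))) / ((2 * pi) powr (1 - 2 * \<sigma>) * (2 - 2 * \<sigma>)) * T powr (2 - 2 * \<sigma>)
           + 7.75 / (\<sigma>\<^sup>2 * (1/2 - \<sigma>)) * T" if "0 < \<sigma> \<and> \<sigma> < 1/2"
    unfolding I_def using that by (intro mean_square_zeta_left T) auto
  show "I \<le> pi / 24 * T\<^sup>2 + 9.3 * T * ln T" if "\<sigma> = 0"
    unfolding I_def that by (rule mean_square_zeta_zero[OF T])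
qed

end
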